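(* Let $M\ge 3$ be an integer, $m:=\phi(M)$, and let $m_1,\dots,m_m$ be integers forming a set of representatives of $(\mathbb{Z}/M\mathbb{Z})^{\star}$. Let $a=(a_1,\dots,a_m)$ with $a_i\in\mathbb{Z}_{\ge 0}$, and write $A:=\sum_{i=1}^m a_i$. Define $$A^a(x):=\{N\le x : N \text{ is a squarefree positive integer coprime to } M,\ n_i(N)=a_i\text{ for all } 1\le i\le m\}.$$ Then $$|A^a(x)|\sim \frac{A}{a_1!\cdots a_m!\cdot m^A}\cdot x\cdot(\log x)^{-1}\cdot(\log\log x)^{A-1},\qquad x\to\infty.$$
   Context: $\phi$ is the Euler totient function. For a squarefree positive integer $N$ coprime to $M$ and $1\le i\le m$, $n_i(N)$ denotes the number of prime divisors $p$ of $N$ with $p\equiv m_i\pmod M$. The notation $f(x)\sim g(x)$ as $x\to\infty$ is the usual asymptotic equivalence, i.e. $f(x)/g(x)\to 1$.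
   Formalization: The case a = (0,…,0), i.e. A = 0, is excluded: there A^a(x) = {1} for x ≥ 1 while the claimed main term is identically 0, so the asymptotic fails; the theorem is stated for all a with A ≥ 1. *)

theory Defs
  imports "HOL-Number_Theory.Number_Theory" "HOL-Computational_Algebra.Squarefree"
    "HOL-Library.Landau_Symbols" Complex_Main
begin

definition unit_representatives :: "nat \<Rightarrow> (nat \<Rightarrow> int) \<Rightarrow> bool" where
  "unit_representatives M r \<longleftrightarrow>
     (\<forall>i\<in>{1..totient M}. coprime (r i) (int M)) \<and>
     (\<forall>u. coprime u (int M) \<longrightarrow> (\<exists>!i. i \<in> {1..totient M} \<and> [r i = u] (mod int M)))"

definition num_prime_divisors :: "nat \<Rightarrow> int \<Rightarrow> nat \<Rightarrow> nat" where
  "num_prime_divisors M c N = card {p. prime p \<and> p dvd N \<and> [int p = c] (mod int M)}"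

text \<open>Only the values \<open>r i\<close> and \<open>a i\<close> for \<open>i \<in> {1..totient M}\<close> matter.\<close>

definition squarefree_with_pattern ::
    "nat \<Rightarrow> (nat \<Rightarrow> int) \<Rightarrow> (nat \<Rightarrow> nat) \<Rightarrow> real \<Rightarrow> nat set" where
  "squarefree_with_pattern M r a x =
     {N. N > 0 \<and> real N \<le> x \<and> squarefree N \<and> coprime N M \<and>
         (\<forall>i\<in>{1..totient M}. num_prime_divisors M (r i) N = a i)}"

end

theory Submission
  imports "HOL-Complex_Analysis.Complex_Analysis" "HOL-Real_Asymp.Real_Asymp" Defs
begin

text \<open>For \<open>A = 1\<close> the statement is the prime number theorem in arithmetic progressions, which is obtained by
  Newman's method. The Dirichlet series of the von Mangoldt function restricted to a residue class is a
  combination of the \<open>-L'/L(s, \<xi>)\<close> over the characters \<open>\<xi>\<close> modulo \<open>M\<close>. The \<open>L(s, \<xi>)\<close> do not vanish on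
  \<open>Re s \<ge> 1\<close>: apart from \<open>s = 1\<close> with \<open>\<xi>\<close> real this follows from the inequality \<open>3 + 4 cos t + cos 2t \<ge> 0\<close>, and
  in the remaining case from Monsky's elementary argument. Newman's Tauberian theorem then gives the convergence of the integral of
  \<open>(\<psi>(x) - x / \<phi>(M)) / x\<^sup>2\<close>, where \<open>\<psi>\<close> is the Chebyshev function of the class, and monotonicity of \<open>\<psi>\<close> yields
  \<open>\<psi>(x) \<sim> x / \<phi>(M)\<close>.

  For general \<open>A\<close> no induction on the counting function is needed. Writing \<open>ln N = \<Sum> ln p\<close> over \<open>p | N\<close> and
  \<open>N = p N'\<close>, the sum of \<open>ln N\<close> over \<open>N \<le> x\<close> of pattern \<open>a\<close> becomes the sum over the classes \<open>i\<close> and over \<open>N'\<close> of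
  pattern \<open>a - e\<^sub>i\<close> of \<open>\<Sum> ln p\<close>, \<open>p \<le> x / N'\<close> in class \<open>i\<close>. By the prime number theorem this is asymptotic to
  \<open>x / \<phi>(M)\<close> times the sum of the \<open>1 / N'\<close>, and these reciprocal sums are evaluated by splitting
  off one prime at a time, using \<open>\<Sum> 1/p \<sim> ln (ln x) / \<phi>(M)\<close> in each class. Finally \<open>ln N\<close> may be replaced by \<open>ln x\<close>.\<close>

section \<open>Dirichlet characters\<close>

text \<open>The prime number theorem is used twice: averaged, in the sums of 1/p, and through an
  error bound eps * x + K valid for every x >= 1. The second form has to reach down to x = 1 because
  it is applied at x / N' with N' as large as x. Summed over N', the first error term gives eps * x
  times a reciprocal sum, and the second gives K times the number of N', which trivial bounds show
  to be of smaller order. So the logarithmic weight lets a reciprocal sum, rather than a count of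
  smaller patterns, carry the main term. The factor A arises because class i contributes a_i times
  the limit of the reciprocal sums of pattern a. On the analytic side, Newman's theorem needs a
  bounded integrand, supplied by Chebyshev's estimate, and holomorphy slightly to the left of the
  line, supplied by Abel summation once the mean of the character has been subtracted. Nonvanishing
  is read off from the limit of eps * V(z + eps) as eps tends to 0, with V = -L'/L: it equals the
  pole order minus the zero order, so the arguments become inequalities between natural
  numbers.\<close>

definition dchars :: "nat \<Rightarrow> (nat \<Rightarrow> complex) set" where
  "dchars M = {\<xi>. (\<forall>n. \<xi> n \<noteq> 0 \<longleftrightarrow> coprime n M) \<and> (\<forall>a b. \<xi> (a * b) = \<xi> a * \<xi> b) \<and>
                  (\<forall>n. \<xi> (n mod M) = \<xi> n)}"

text \<open>A character of a subgroup of the unit group, with \<open>H\<close> the union of the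
  residue classes in the subgroup. Closure under inverses follows from Euler's theorem.\<close>

definition partial_char :: "nat \<Rightarrow> nat set \<Rightarrow> (nat \<Rightarrow> complex) \<Rightarrow> bool" where
  "partial_char M H f \<longleftrightarrow> 1 \<in> H \<and> (\<forall>a\<in>H. coprime a M \<and> f a \<noteq> 0) \<and>
     (\<forall>a\<in>H. \<forall>b\<in>H. a * b \<in> H \<and> f (a * b) = f a * f b) \<and>
     (\<forall>a\<in>H. \<forall>b. [a = b] (mod M) \<longrightarrow> b \<in> H \<and> f b = f a)"

lemma partial_charD:
  assumes "partial_char M H f"
  shows "1 \<in> H" "a \<in> H \<Longrightarrow> coprime a M" "a \<in> H \<Longrightarrow> f a \<noteq> 0"
    "a \<in> H \<Longrightarrow> b \<in> H \<Longrightarrow> a * b \<in> H"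
    "a \<in> H \<Longrightarrow> b \<in> H \<Longrightarrow> f (a * b) = f a * f b"
    "a \<in> H \<Longrightarrow> [a = b] (mod M) \<Longrightarrow> b \<in> H"
    "a \<in> H \<Longrightarrow> [a = b] (mod M) \<Longrightarrow> f b = f a"
  using assms unfolding partial_char_def by blast+

lemma partial_char_power:
  assumes "partial_char M H f" "u \<in> H"
  shows "u ^ q \<in> H \<and> f (u ^ q) = f u ^ q"
proof (induction q)
  case 0
  have "f (1 * 1) = f 1 * f 1" "f 1 \<noteq> 0" "1 \<in> H"
    using assms unfolding partial_char_def by blast+
  then show ?case by simp
next
  case (Suc q)
  then show ?case using partial_charD(4,5)[OF assms(1) assms(2), of "u ^ q"] by simp
qed

text \<open>Modulo \<open>M\<close> the power \<open>u ^ (totient M - 1)\<close> inverts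
  \<open>u\<close>, and it stays inside \<open>H\<close>.\<close>

lemma partial_char_cancel:
  assumes "partial_char M H f" "u \<in> H" "u * v \<in> H" "M > 0"
  shows "v \<in> H"
proof -
  have cop: "coprime u M" using assms unfolding partial_char_def by auto
  have "[u ^ (totient M - 1) * (u * v) = 1 * v] (mod M)"
  proof -
    have "u ^ (totient M - 1) * (u * v) = u ^ totient M * v"
      using assms(4) by (simp add: mult.assoc power_eq_if[of u "totient M"])
    then show ?thesis
      using euler_theorem[OF cop] by (metis cong_scalar_right)
  qed
  moreover have "u ^ (totient M - 1) * (u * v) \<in> H"
    using partial_char_power[OF assms(1,2)] assms unfolding partial_char_def by blast
  ultimately show ?thesis using assms unfolding partial_char_def by auto
qed

text \<open>Adjoining one element \<open>g\<close> of order \<open>k\<close> modulo the subgroup.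
  The value at g^j h is forced to be w^j f(h), and w^k = f(g^k) is exactly what makes this
  independent of the representation.\<close>

lemma partial_char_extend:
  assumes pc: "partial_char M H f" and M: "M > 0" and g: "coprime g M" and k: "k > 0"
    and gk: "g ^ k \<in> H" and min: "\<And>j. 0 < j \<Longrightarrow> j < k \<Longrightarrow> g ^ j \<notin> H" and w: "w ^ k = f (g ^ k)"
  shows "\<exists>H' f'. partial_char M H' f' \<and> H \<subseteq> H' \<and> g \<in> H' \<and> f' g = w \<and> (\<forall>h\<in>H. f' h = f h)"
proof -
  have H1: "1 \<in> H" and Hc: "\<And>a. a \<in> H \<Longrightarrow> coprime a M" and f0: "\<And>a. a \<in> H \<Longrightarrow> f a \<noteq> 0"
    and Hm: "\<And>a b. a \<in> H \<Longrightarrow> b \<in> H \<Longrightarrow> a * b \<in> H"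
    and fm: "\<And>a b. a \<in> H \<Longrightarrow> b \<in> H \<Longrightarrow> f (a * b) = f a * f b"
    and Hcong: "\<And>a b. a \<in> H \<Longrightarrow> [a = b] (mod M) \<Longrightarrow> b \<in> H"
    and fcong: "\<And>a b. a \<in> H \<Longrightarrow> [a = b] (mod M) \<Longrightarrow> f b = f a"
    by (fact partial_charD[OF pc])+
  have w0: "w \<noteq> 0" using w f0[OF gk] k by (metis zero_power)
  have f1: "f 1 = 1" using partial_char_power[OF pc H1, of 0] by simp
  \<comment> \<open>Two representations whose exponents differ by \<open>d\<close> give g^d in
    \<open>H\<close>; minimality of \<open>k\<close> makes \<open>d\<close> a multiple of
    \<open>k\<close>, so w^d = f(g^d).\<close>
  have le: "w ^ j * f h = w ^ j' * f h'"
    if "j \<le> j'" "h \<in> H" "h' \<in> H" and c: "[g ^ j * h = g ^ j' * h'] (mod M)" for j j' h h'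
  proof -
    define d where "d = j' - j"
    have j': "j' = j + d" using that d_def by simp
    have "[g ^ j * h = g ^ j * (g ^ d * h')] (mod M)"
      using c by (simp add: j' power_add mult.assoc)
    then have "[h = g ^ d * h'] (mod M)"
      using cong_mult_lcancel_nat[of "g ^ j" M] g by (simp)
    then have c2: "[h = h' * g ^ d] (mod M)" by (simp add: mult.commute)
    then have gd: "g ^ d \<in> H"
      using partial_char_cancel[OF pc \<open>h' \<in> H\<close> _ M] Hcong[OF \<open>h \<in> H\<close>] by blast
    define q r where "q = d div k" and "r = d mod k"
    have d: "d = k * q + r" unfolding q_def r_def by simp
    have "(g ^ k) ^ q * g ^ r \<in> H" using gd d by (simp add: power_add power_mult)
    then have "g ^ r \<in> H"
      using partial_char_cancel[OF pc _ _ M] partial_char_power[OF pc gk] by blast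
    moreover have "r < k" using k r_def by simp
    ultimately have "r = 0" using min by blast
    then have "w ^ d = f (g ^ d)"
      using d w partial_char_power[OF pc gk, of q] by (simp add: power_mult)
    moreover have "f h = f (h' * g ^ d)"
      using fcong[OF \<open>h \<in> H\<close> c2] by simp
    ultimately show ?thesis using fm[OF \<open>h' \<in> H\<close> gd] by (simp add: j' power_add)
  qed
  have wd: "w ^ j * f h = w ^ j' * f h'"
    if "h \<in> H" "h' \<in> H" "[g ^ j * h = g ^ j' * h'] (mod M)" for j j' h h'
    using le[of j j' h h'] le[of j' j h' h] that by (metis cong_sym nat_le_linear)
  define H' where "H' = {x. \<exists>j. \<exists>h\<in>H. [x = g ^ j * h] (mod M)}"
  define f' where "f' x = (THE z. \<exists>j. \<exists>h\<in>H. [x = g ^ j * h] (mod M) \<and> z = w ^ j * f h)" for x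
  have f': "f' x = w ^ j * f h" if "h \<in> H" "[x = g ^ j * h] (mod M)" for x j h
    unfolding f'_def
  proof (rule the_equality)
    show "\<exists>ja. \<exists>ha\<in>H. [x = g ^ ja * ha] (mod M) \<and> w ^ j * f h = w ^ ja * f ha"
      using that by blast
  next
    fix z assume "\<exists>j. \<exists>h\<in>H. [x = g ^ j * h] (mod M) \<and> z = w ^ j * f h"
    then obtain j' h' where "h' \<in> H" "[x = g ^ j' * h'] (mod M)" "z = w ^ j' * f h'" by blast
    then show "z = w ^ j * f h" using wd[of h' h j' j] that by (metis cong_sym cong_trans)
  qed
  have sub: "h \<in> H' \<and> f' h = f h" if "h \<in> H" for h
  proof -
    have c: "[h = g ^ 0 * h] (mod M)" by simp
    have "h \<in> H'" unfolding H'_def using that c by blast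
    then show ?thesis using f'[OF that c] by simp
  qed
  have gH: "g \<in> H' \<and> f' g = w"
  proof -
    have c: "[g = g ^ 1 * 1] (mod M)" by simp
    have "g \<in> H'" unfolding H'_def using H1 c by blast
    then show ?thesis using f'[OF H1 c] f1 by simp
  qed
  have "partial_char M H' f'"
    unfolding partial_char_def
  proof (intro conjI ballI allI impI)
    show "1 \<in> H'" using sub H1 by blast
  next
    fix a assume "a \<in> H'"
    then obtain j h where jh: "h \<in> H" "[a = g ^ j * h] (mod M)" unfolding H'_def by blast
    show "coprime a M"
      using jh Hc g by (metis cong_imp_coprime cong_sym coprime_mult_left_iff coprime_power_left_iff)
    show "f' a \<noteq> 0" using f'[OF jh] w0 f0 jh by simp
    fix b
    {
      assume "b \<in> H'"
      then obtain j' h' where jh': "h' \<in> H" "[b = g ^ j' * h'] (mod M)" unfolding H'_def by blast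
      have c: "[a * b = g ^ (j + j') * (h * h')] (mod M)"
        using cong_mult[OF jh(2) jh'(2)] by (simp add: power_add algebra_simps)
      show "a * b \<in> H'" using c Hm jh(1) jh'(1) unfolding H'_def by blast
      show "f' (a * b) = f' a * f' b"
        using f'[OF Hm[OF jh(1) jh'(1)] c] f'[OF jh] f'[OF jh'] fm jh jh'
        by (simp add: power_add algebra_simps)
    }
    {
      assume ab: "[a = b] (mod M)"
      have c: "[b = g ^ j * h] (mod M)" using ab jh(2) cong_sym cong_trans by blast
      show "b \<in> H'" using c jh(1) unfolding H'_def by blast
      show "f' b = f' a" using f'[OF jh(1) c] f'[OF jh] by simp
    }
  qed
  then show ?thesis using sub gH by blast
qed

lemma complex_root_exists:
  assumes "k > 0" shows "\<exists>w::complex. w ^ k = c"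
proof (cases "c = 0")
  case True then show ?thesis using assms by (auto intro!: exI[of _ 0])
next
  case False
  have "exp (Ln c / of_nat k) ^ k = c"
    using False assms by (simp flip: exp_of_nat_mult)
  then show ?thesis by blast
qed

lemma partial_char_least_power:
  assumes "partial_char M H f" "M > 0" "coprime g M"
  obtains k where "k > 0" "g ^ k \<in> H" "\<And>j. 0 < j \<Longrightarrow> j < k \<Longrightarrow> g ^ j \<notin> H"
proof -
  have "[1 = g ^ totient M] (mod M)" using euler_theorem[OF assms(3)] cong_sym by blast
  then have "g ^ totient M \<in> H" using assms(1) unfolding partial_char_def by blast
  then have ex: "\<exists>k. k > 0 \<and> g ^ k \<in> H" using assms(2) by (auto intro!: exI[of _ "totient M"])
  define k where "k = (LEAST k. k > 0 \<and> g ^ k \<in> H)"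
  have "k > 0 \<and> g ^ k \<in> H" unfolding k_def using ex by (rule LeastI_ex)
  moreover have "g ^ j \<notin> H" if "0 < j" "j < k" for j
    using not_less_Least[of j "\<lambda>k. k > 0 \<and> g ^ k \<in> H"] that unfolding k_def by blast
  ultimately show ?thesis using that by blast
qed

text \<open>Induction on the number of residues below \<open>M\<close> outside \<open>H\<close>;
  each new generator moves at least its own residue into the domain.\<close>

lemma partial_char_extend_dchars:
  assumes "partial_char M H f" "M > 0"
  shows "\<exists>\<xi>\<in>dchars M. \<forall>h\<in>H. \<xi> h = f h"
  using assms(1)
proof (induction "card ({..<M} - H)" arbitrary: H f rule: less_induct)
  case less
  show ?case
  proof (cases "\<forall>g. coprime g M \<longrightarrow> g \<in> H")
    case True
    define \<xi> where "\<xi> n = (if coprime n M then f n else 0)" for n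
    have "\<xi> \<in> dchars M"
      unfolding dchars_def
    proof (intro CollectI conjI allI)
      fix n a b
      show "\<xi> n \<noteq> 0 \<longleftrightarrow> coprime n M"
        using partial_charD(3)[OF less.prems] True unfolding \<xi>_def by simp
      show "\<xi> (a * b) = \<xi> a * \<xi> b"
        using partial_charD(5)[OF less.prems] True unfolding \<xi>_def by simp
      have "[n = n mod M] (mod M)" by (simp add: cong_def)
      then have "f (n mod M) = f n" if "coprime n M"
        using partial_charD(7)[OF less.prems] True that by blast
      then show "\<xi> (n mod M) = \<xi> n" unfolding \<xi>_def using assms(2) by simp
    qed
    moreover have "\<forall>h\<in>H. \<xi> h = f h"
      using partial_charD(2)[OF less.prems] unfolding \<xi>_def by simp
    ultimately show ?thesis by blast
  next
    case False
    then obtain g where g: "coprime g M" "g \<notin> H" by blast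
    obtain k where k: "k > 0" "g ^ k \<in> H" "\<And>j. 0 < j \<Longrightarrow> j < k \<Longrightarrow> g ^ j \<notin> H"
      using partial_char_least_power[OF less.prems assms(2) g(1)] by blast
    obtain w where w: "w ^ k = f (g ^ k)" using complex_root_exists[OF k(1)] by blast
    obtain H' f' where H': "partial_char M H' f'" "H \<subseteq> H'" "g \<in> H'" "\<forall>h\<in>H. f' h = f h"
      using partial_char_extend[OF less.prems assms(2) g(1) k w] by blast
    have c: "[g = g mod M] (mod M)" by (simp add: cong_def)
    have "g mod M \<in> H'" using H' c unfolding partial_char_def by blast
    moreover have "g mod M \<notin> H"
      using g c less.prems cong_sym unfolding partial_char_def by blast
    moreover have "g mod M < M" using assms(2) by simp
    ultimately have "{..<M} - H' \<subset> {..<M} - H" using H'(2) by blast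
    then have "card ({..<M} - H') < card ({..<M} - H)" by (intro psubset_card_mono) auto
    from less.hyps[OF this H'(1)] show ?thesis using H' by (metis subsetD)
  qed
qed

text \<open>Start from the trivial character on the class of 1 and extend it to \<open>a\<close>,
  whose order \<open>k\<close> exceeds 1, by sending \<open>a\<close> to a primitive k-th root of
  unity.\<close>

lemma dchars_separate:
  assumes M: "M > 0" and a: "coprime a M" "\<not> [a = 1] (mod M)"
  shows "\<exists>\<xi>\<in>dchars M. \<xi> a \<noteq> 1"
proof -
  define H where "H = {x. [x = 1] (mod M)}"
  have pc: "partial_char M H (\<lambda>_. 1)"
    unfolding partial_char_def
  proof (intro conjI ballI allI impI)
    fix a b assume a: "a \<in> H"
    then have a1: "[a = 1] (mod M)" by (simp add: H_def)
    show "coprime a M" using cong_imp_coprime[OF cong_sym[OF a1]] by simp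
    show "a * b \<in> H" if "b \<in> H" using cong_mult[OF a1, of b 1] that by (simp add: H_def)
    show "b \<in> H" if "[a = b] (mod M)" using cong_trans[OF cong_sym[OF that] a1] by (simp add: H_def)
  qed (simp_all add: H_def)
  obtain k where k: "k > 0" "a ^ k \<in> H" "\<And>j. 0 < j \<Longrightarrow> j < k \<Longrightarrow> a ^ j \<notin> H"
    using partial_char_least_power[OF pc M a(1)] by blast
  have "k \<noteq> 1" using k(2) a(2) unfolding H_def by (metis mem_Collect_eq power_one_right)
  with k(1) have "k > 1" by simp
  define w where "w = cis (2 * pi / k)"
  have "real k * (2 * pi / real k) = 2 * pi" using k(1) by simp
  moreover have "w ^ k = cis (real k * (2 * pi / real k))" unfolding w_def by (rule Complex.DeMoivre)
  ultimately have wk: "w ^ k = 1" by simp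
  have w1: "w \<noteq> 1"
  proof
    assume "w = 1"
    then have "cos (2 * pi / k) = 1" unfolding w_def by (metis cis.sel(1) one_complex.sel(1))
    then obtain n :: int where "2 * pi / k = of_int n * (2 * pi)"
      using cos_one_2pi_int by auto
    then have "1 = of_int n * real k" using k(1) by (simp add: field_simps)
    then have "of_int (n * int k) = (1::real)" by simp
    then have "n * int k = 1" by linarith
    then show False using \<open>k > 1\<close> by (auto simp: zmult_eq_1_iff)
  qed
  obtain H' f' where "partial_char M H' f'" "a \<in> H'" "f' a = w"
    using partial_char_extend[OF pc M a(1) k, of w] wk by auto
  then show ?thesis using partial_char_extend_dchars[OF _ M, of H' f'] w1 by metis
qed

section \<open>Values of characters and finiteness of their number\<close>

lemma dchars_1: assumes "\<xi> \<in> dchars M" shows "\<xi> (Suc 0) = 1"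
proof -
  have "\<xi> (1 * 1) = \<xi> 1 * \<xi> 1" using assms unfolding dchars_def by blast
  moreover have "\<xi> 1 \<noteq> 0" using assms coprime_1_left unfolding dchars_def by blast
  ultimately show ?thesis by simp
qed

lemma dchars_mult: "\<xi> \<in> dchars M \<Longrightarrow> \<xi> (a * b) = \<xi> a * \<xi> b"
  and dchars_mod: "\<xi> \<in> dchars M \<Longrightarrow> \<xi> (n mod M) = \<xi> n"
  and dchars_zero_iff: "\<xi> \<in> dchars M \<Longrightarrow> \<xi> n = 0 \<longleftrightarrow> \<not> coprime n M"
  unfolding dchars_def by auto

lemma dchars_cong: "\<xi> \<in> dchars M \<Longrightarrow> [a = b] (mod M) \<Longrightarrow> \<xi> a = \<xi> b"
  using dchars_mod[of \<xi> M a] dchars_mod[of \<xi> M b] by (simp add: cong_def)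

lemma dchars_power: "\<xi> \<in> dchars M \<Longrightarrow> \<xi> (a ^ k) = \<xi> a ^ k"
  by (induction k) (auto simp: dchars_1 dchars_mult)

lemma dchars_power_totient:
  assumes "\<xi> \<in> dchars M" "coprime n M" shows "\<xi> n ^ totient M = 1"
  using dchars_cong[OF assms(1) euler_theorem[OF assms(2)]] dchars_power[OF assms(1)] dchars_1[OF assms(1)]
  by simp

lemma norm_dchars:
  assumes "\<xi> \<in> dchars M" "M > 0" shows "norm (\<xi> n) = (if coprime n M then 1 else 0)"
proof (cases "coprime n M")
  case True
  have "norm (\<xi> n) ^ totient M = 1"
    using dchars_power_totient[OF assms(1) True] by (metis norm_one norm_power)
  then show ?thesis using True assms(2)
    by (metis norm_ge_zero power_eq_1_iff real_norm_def abs_of_nonneg totient_gt_0_iff less_irrefl)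
qed (use dchars_zero_iff[OF assms(1)] in auto)

lemma norm_dchars_le: "\<xi> \<in> dchars M \<Longrightarrow> M > 0 \<Longrightarrow> norm (\<xi> n) \<le> 1"
  by (simp add: norm_dchars)

text \<open>A character is determined by its values below \<open>M\<close>, and these are 0 or roots
  of unity of exponent \<open>totient M\<close>.\<close>

lemma finite_dchars:
  assumes "M > 0" shows "finite (dchars M)"
proof (rule inj_on_finite)
  show "inj_on (\<lambda>\<xi>. restrict \<xi> {..<M}) (dchars M)"
  proof (rule inj_onI, rule ext)
    fix \<xi> \<psi> n
    assume *: "\<xi> \<in> dchars M" "\<psi> \<in> dchars M" "restrict \<xi> {..<M} = restrict \<psi> {..<M}"
    have "n mod M \<in> {..<M}" using assms by simp
    then have "\<xi> (n mod M) = \<psi> (n mod M)" using *(3) by (metis restrict_apply')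
    then show "\<xi> n = \<psi> n" using * dchars_mod by metis
  qed
  show "(\<lambda>\<xi>. restrict \<xi> {..<M}) ` dchars M \<subseteq> PiE {..<M} (\<lambda>_. insert 0 {z. z ^ totient M = 1})"
  proof (intro image_subsetI PiE_I)
    fix \<xi> n assume "\<xi> \<in> dchars M" "n \<in> {..<M}"
    then show "restrict \<xi> {..<M} n \<in> insert 0 {z. z ^ totient M = 1}"
      using dchars_power_totient dchars_zero_iff by auto
  qed auto
  have "finite {z::complex. z ^ totient M = 1}"
    using assms by (intro finite_roots_unity) (simp add: Suc_le_eq)
  then show "finite (PiE {..<M} (\<lambda>_. insert 0 {z::complex. z ^ totient M = 1}))"
    by (intro finite_PiE) auto
qed

definition dprincipal :: "nat \<Rightarrow> nat \<Rightarrow> complex" where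
  "dprincipal M n = (if coprime n M then 1 else 0)"

lemma dprincipal_dchars: "M > 0 \<Longrightarrow> dprincipal M \<in> dchars M"
  unfolding dchars_def dprincipal_def by auto

lemma dchars_times: "\<xi> \<in> dchars M \<Longrightarrow> \<psi> \<in> dchars M \<Longrightarrow> (\<lambda>n. \<xi> n * \<psi> n) \<in> dchars M"
  unfolding dchars_def by auto

section \<open>Orthogonality relations\<close>

lemma card_coprime_residues:
  assumes "M > 1" shows "card {n. n < M \<and> coprime n M} = totient M"
proof -
  have "{n. n < M \<and> coprime n M} = totatives M"
    using assms by (auto simp: totatives_def intro!: Nat.gr0I order.not_eq_order_implies_strict)
  then show ?thesis by (simp add: totient_def)
qed

text \<open>For a nonprincipal character, multiplication by some \<open>b\<close> with value other
  than 1 permutes the reduced residues and multiplies the sum by that value.\<close>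

lemma sum_dchars_residues:
  assumes chi: "\<xi> \<in> dchars M" and M: "M > 1"
  shows "(\<Sum>n<M. \<xi> n) = (if \<xi> = dprincipal M then of_nat (totient M) else 0)"
proof -
  define R where "R = {n. n < M \<and> coprime n M}"
  have fin: "finite R" unfolding R_def by auto
  have R: "(\<Sum>n<M. \<xi> n) = (\<Sum>n\<in>R. \<xi> n)"
    unfolding R_def by (rule sum.mono_neutral_right) (use dchars_zero_iff[OF chi] in auto)
  show ?thesis
  proof (cases "\<xi> = dprincipal M")
    case True
    then have "(\<Sum>n\<in>R. \<xi> n) = (\<Sum>n\<in>R. 1)"
      by (intro sum.cong) (auto simp: R_def dprincipal_def)
    then show ?thesis using R True card_coprime_residues[OF M] by (simp add: R_def)
  next
    case False
    then obtain b where "\<xi> b \<noteq> dprincipal M b" by blast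
    then have b: "coprime b M" "\<xi> b \<noteq> 1"
      using dchars_zero_iff[OF chi] by (auto simp: dprincipal_def split: if_splits)
    have inj: "inj_on (\<lambda>n. b * n mod M) R"
    proof (rule inj_onI)
      fix x y assume xy: "x \<in> R" "y \<in> R" "b * x mod M = b * y mod M"
      then have "[x = y] (mod M)" using b(1) cong_mult_lcancel_nat by (simp add: cong_def)
      then show "x = y" using xy by (simp add: R_def cong_def)
    qed
    have sub: "(\<lambda>n. b * n mod M) ` R \<subseteq> R" using M b(1) by (auto simp: R_def)
    have "(\<lambda>n. b * n mod M) ` R = R" using endo_inj_surj[OF fin sub inj] .
    then have "(\<Sum>n\<in>R. \<xi> n) = (\<Sum>n\<in>R. \<xi> (b * n mod M))"
      using sum.reindex[OF inj, of \<xi>] by simp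
    also have "\<dots> = \<xi> b * (\<Sum>n\<in>R. \<xi> n)"
      by (simp add: dchars_mod[OF chi] dchars_mult[OF chi] sum_distrib_left)
    finally have "(1 - \<xi> b) * (\<Sum>n\<in>R. \<xi> n) = 0" by (simp add: algebra_simps)
    then show ?thesis using b(2) R False by simp
  qed
qed

text \<open>The dual translation argument: multiplication by a character that separates
  \<open>b\<close> from 1 permutes the characters.\<close>

lemma sum_over_dchars_nontrivial:
  assumes M: "M > 0" and b: "\<not> [b = 1] (mod M)"
  shows "(\<Sum>\<xi>\<in>dchars M. \<xi> b) = 0"
proof (cases "coprime b M")
  case False
  then show ?thesis by (intro sum.neutral) (auto simp: dchars_zero_iff)
next
  case True
  obtain \<psi> where psi: "\<psi> \<in> dchars M" "\<psi> b \<noteq> 1" using dchars_separate[OF M True b] by blast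
  let ?F = "\<lambda>\<xi> n. \<psi> n * \<xi> n"
  have inj: "inj_on ?F (dchars M)"
  proof (rule inj_onI, rule ext)
    fix \<xi> \<phi> n assume *: "\<xi> \<in> dchars M" "\<phi> \<in> dchars M" "?F \<xi> = ?F \<phi>"
    then have "\<psi> n * \<xi> n = \<psi> n * \<phi> n" by meson
    then show "\<xi> n = \<phi> n"
      using *(1,2) psi(1) dchars_zero_iff by (metis mult_left_cancel)
  qed
  have sub: "?F ` dchars M \<subseteq> dchars M" using dchars_times psi(1) by blast
  have "?F ` dchars M = dchars M" using endo_inj_surj[OF finite_dchars[OF M] sub inj] .
  then have "(\<Sum>\<xi>\<in>dchars M. \<xi> b) = (\<Sum>\<xi>\<in>dchars M. \<psi> b * \<xi> b)"
    using sum.reindex[OF inj, of "\<lambda>\<xi>. \<xi> b"] by simp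
  also have "\<dots> = \<psi> b * (\<Sum>\<xi>\<in>dchars M. \<xi> b)" by (simp add: sum_distrib_left)
  finally have "(1 - \<psi> b) * (\<Sum>\<xi>\<in>dchars M. \<xi> b) = 0" by (simp add: algebra_simps)
  then show ?thesis using psi(2) by simp
qed

text \<open>Double counting over all characters and all n < M shows that there are
  \<open>totient M\<close> characters: summing over n first only the principal one survives, summing
  over characters first only n = 1 does.\<close>

lemma sum_over_dchars:
  assumes M: "M > 1"
  shows "(\<Sum>\<xi>\<in>dchars M. \<xi> b) = (if [b = 1] (mod M) then of_nat (totient M) else 0)"
proof -
  have M0: "M > 0" using M by simp
  have at1: "(\<Sum>\<xi>\<in>dchars M. \<xi> b) = of_nat (card (dchars M))" if "[b = 1] (mod M)" for b
  proof -
    have "(\<Sum>\<xi>\<in>dchars M. \<xi> b) = (\<Sum>\<xi>\<in>dchars M. 1)"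
    proof (intro sum.cong refl)
      fix \<xi> assume "\<xi> \<in> dchars M"
      then show "\<xi> b = 1" using dchars_cong[OF _ that] dchars_1 by (metis One_nat_def)
    qed
    then show ?thesis by simp
  qed
  have "(\<Sum>n<M. \<Sum>\<xi>\<in>dchars M. \<xi> n) = (\<Sum>n<M. if n = 1 then of_nat (card (dchars M)) else 0)"
  proof (intro sum.cong refl)
    fix n assume "n \<in> {..<M}"
    then have "[n = 1] (mod M) \<longleftrightarrow> n = 1" using M by (auto simp: cong_def)
    then show "(\<Sum>\<xi>\<in>dchars M. \<xi> n) = (if n = 1 then of_nat (card (dchars M)) else 0)"
      using at1[of n] sum_over_dchars_nontrivial[OF M0, of n] by auto
  qed
  also have "\<dots> = of_nat (card (dchars M))" using M by (simp add: sum.delta)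
  finally have "of_nat (card (dchars M)) = (\<Sum>\<xi>\<in>dchars M. \<Sum>n<M. \<xi> n)"
    by (subst sum.swap) simp
  also have "\<dots> = (\<Sum>\<xi>\<in>dchars M. if \<xi> = dprincipal M then of_nat (totient M) else 0)"
    by (intro sum.cong refl sum_dchars_residues M)
  also have "\<dots> = (of_nat (totient M) :: complex)"
    using finite_dchars[OF M0] dprincipal_dchars[OF M0] by (simp add: sum.delta)
  finally show ?thesis using at1 sum_over_dchars_nontrivial[OF M0] by simp
qed

lemma dchars_orthogonality:
  assumes M: "M > 1" and a: "coprime a M"
  shows "(\<Sum>\<xi>\<in>dchars M. cnj (\<xi> a) * \<xi> n) = (if [n = a] (mod M) then of_nat (totient M) else 0)"
proof -
  obtain a' where a': "[a * a' = 1] (mod M)" using cong_solve_coprime_nat[OF a] by auto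
  have "cnj (\<xi> a) = \<xi> a'" if chi: "\<xi> \<in> dchars M" for \<xi>
  proof -
    have 1: "\<xi> a * \<xi> a' = 1"
      using dchars_cong[OF chi a'] dchars_mult[OF chi] dchars_1[OF chi] by simp
    have "\<xi> a * cnj (\<xi> a) = 1"
      using norm_dchars[OF chi, of a] a M by (simp add: complex_norm_square[symmetric])
    then show ?thesis using 1 by (metis mult_left_cancel mult_zero_left zero_neq_one)
  qed
  then have "(\<Sum>\<xi>\<in>dchars M. cnj (\<xi> a) * \<xi> n) = (\<Sum>\<xi>\<in>dchars M. \<xi> (a' * n))"
    by (intro sum.cong) (auto simp: dchars_mult)
  moreover have "[a' * n = 1] (mod M) \<longleftrightarrow> [n = a] (mod M)"
  proof
    assume "[a' * n = 1] (mod M)"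
    then have "[a * (a' * n) = a * 1] (mod M)" using cong_scalar_left by blast
    moreover have "[a * a' * n = 1 * n] (mod M)" using a' cong_scalar_right by blast
    ultimately show "[n = a] (mod M)" by (metis cong_sym cong_trans mult.assoc mult_1 mult.right_neutral)
  next
    assume "[n = a] (mod M)"
    then have "[a' * n = a' * a] (mod M)" using cong_scalar_left by blast
    then show "[a' * n = 1] (mod M)" using a' by (metis cong_trans mult.commute)
  qed
  ultimately show ?thesis using sum_over_dchars[OF M] by simp
qed

section \<open>Mellin integrals over a bounded interval\<close>

text \<open>The kernel \<open>x\<^bsup>-s-1\<^esup>\<close> is written with \<open>exp\<close> so that it is visibly entire in \<open>s\<close>.\<close>

definition kint :: "(real \<Rightarrow> complex) \<Rightarrow> real \<Rightarrow> real \<Rightarrow> complex \<Rightarrow> complex" where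
  "kint w a b s = integral {a..b} (\<lambda>x. w x * exp (- (s + 1) * of_real (ln x)))"

lemma kint_integrand_continuous:
  fixes s :: complex
  assumes "0 < a" "continuous_on {a..b} w"
  shows "continuous_on {a..b} (\<lambda>x. w x * exp (- (s + 1) * of_real (ln x)))"
  using assms by (auto intro!: continuous_intros)

lemma kint_holomorphic:
  assumes a: "0 < a" and w: "continuous_on {a..b} w"
  shows "kint w a b holomorphic_on A"
proof -
  have "(\<lambda>s. integral (cbox a b) (\<lambda>x. w x * exp (- (s + 1) * of_real (ln x)))) holomorphic_on UNIV"
  proof (rule leibniz_rule_holomorphic)
    fix s :: complex and t :: real assume "t \<in> cbox a b"
    show "((\<lambda>s. w t * exp (- (s + 1) * of_real (ln t))) has_field_derivative
            w t * (exp (- (s + 1) * of_real (ln t)) * - of_real (ln t))) (at s within UNIV)"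
      by (auto intro!: derivative_eq_intros)
  next
    fix s :: complex
    show "(\<lambda>x. w x * exp (- (s + 1) * of_real (ln x))) integrable_on cbox a b"
      using kint_integrand_continuous[OF a w] by (simp add: integrable_continuous_interval)
  next
    have "continuous_on (UNIV \<times> {a..b}) (\<lambda>p::complex \<times> real. w (snd p))"
      by (rule continuous_on_compose2[OF w]) (auto intro!: continuous_intros)
    moreover have "continuous_on (UNIV \<times> {a..b}) (\<lambda>p::complex \<times> real. ln (snd p))"
      using a by (auto intro!: continuous_intros)
    ultimately show "continuous_on (UNIV \<times> cbox a b)
       (\<lambda>(s, t). w t * (exp (- (s + 1) * of_real (ln t)) * - of_real (ln t)))"
      unfolding case_prod_unfold box_real using a by (intro continuous_intros) auto
  qed auto
  then have "kint w a b holomorphic_on UNIV" by (simp add: kint_def[abs_def])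
  then show ?thesis using holomorphic_on_subset by blast
qed

lemma has_integral_powr_shift:
  fixes \<sigma> :: real
  assumes "0 < a" "a \<le> b" "\<sigma> \<noteq> 0"
  shows "((\<lambda>x. C * x powr (- \<sigma> - 1)) has_integral C * (a powr (- \<sigma>) - b powr (- \<sigma>)) / \<sigma>) {a..b}"
proof -
  have "((\<lambda>x. C * x powr (- \<sigma> - 1)) has_integral (- C * b powr (- \<sigma>) / \<sigma>) - (- C * a powr (- \<sigma>) / \<sigma>)) {a..b}"
  proof (rule fundamental_theorem_of_calculus[OF assms(2)])
    fix x assume "x \<in> {a..b}"
    then have "((\<lambda>x. - C * x powr (- \<sigma>) / \<sigma>) has_field_derivative C * x powr (- \<sigma> - 1)) (at x within {a..b})"
      using assms by (auto intro!: derivative_eq_intros simp: field_simps)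
    then show "((\<lambda>x. - C * x powr (- \<sigma>) / \<sigma>) has_vector_derivative C * x powr (- \<sigma> - 1)) (at x within {a..b})"
      by (simp add: has_real_derivative_iff_has_vector_derivative)
  qed
  then show ?thesis by (simp add: diff_divide_distrib right_diff_distrib)
qed

text \<open>For \<sigma> < Re s, which gives bounds uniform on discs, the comparison of powers
  relies on x >= 1. Negative \<sigma> is allowed, since numerator and denominator then change sign
  together; over consecutive intervals the bound telescopes.\<close>

lemma norm_kint_le:
  assumes a: "0 < a" "a \<le> b" and w: "continuous_on {a..b} w" and C: "\<And>x. x \<in> {a..b} \<Longrightarrow> norm (w x) \<le> C"
    and s: "\<sigma> \<noteq> 0" "\<sigma> \<le> Re s" "1 \<le> a \<or> \<sigma> = Re s"
  shows "norm (kint w a b s) \<le> C * (a powr (- \<sigma>) - b powr (- \<sigma>)) / \<sigma>"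
proof -
  have C0: "C \<ge> 0" using order_trans[OF norm_ge_zero C[of a]] a by simp
  have "norm (kint w a b s) \<le> integral {a..b} (\<lambda>x. C * x powr (- \<sigma> - 1))"
    unfolding kint_def
  proof (rule integral_norm_bound_integral)
    show "(\<lambda>x. w x * exp (- (s + 1) * of_real (ln x))) integrable_on {a..b}"
      using kint_integrand_continuous[OF a(1) w] by (simp add: integrable_continuous_interval)
    show "(\<lambda>x. C * x powr (- \<sigma> - 1)) integrable_on {a..b}"
      using has_integral_powr_shift[OF a s(1)] by blast
    fix x assume x: "x \<in> {a..b}"
    then have x0: "x > 0" using a by auto
    have "norm (exp (- (s + 1) * of_real (ln x))) = x powr (- Re s - 1)"
      using x0 by (simp add: powr_def algebra_simps)
    also have "\<dots> \<le> x powr (- \<sigma> - 1)"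
      using s x by (cases "\<sigma> = Re s") (auto intro!: powr_mono)
    finally show "norm (w x * exp (- (s + 1) * of_real (ln x))) \<le> C * x powr (- \<sigma> - 1)"
      unfolding norm_mult using C[OF x] C0 by (intro mult_mono) auto
  qed
  also have "\<dots> = C * (a powr (- \<sigma>) - b powr (- \<sigma>)) / \<sigma>"
    using has_integral_powr_shift[OF a s(1)] by (rule integral_unique)
  finally show ?thesis .
qed

text \<open>At s = 0 the kernel is 1/x; this case produces the logarithms in the summability
  condition at the end of Newman's method.\<close>

lemma kint_const:
  assumes "0 < a" "a \<le> b"
  shows "kint (\<lambda>_. c) a b s =
    (if s = 0 then c * (of_real (ln b) - of_real (ln a))
     else c * (exp (- s * of_real (ln a)) - exp (- s * of_real (ln b))) / s)"
proof (cases "s = 0")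
  case True
  have "((\<lambda>x. c * exp (- (s + 1) * of_real (ln x))) has_integral c * of_real (ln b) - c * of_real (ln a)) {a..b}"
  proof (rule fundamental_theorem_of_calculus[OF assms(2)])
    fix x assume "x \<in> {a..b}"
    then have x: "x > 0" using assms by auto
    have e: "exp (- (s + 1) * of_real (ln x)) = of_real (inverse x)"
    proof -
      have "exp (- (s + 1) * of_real (ln x)) = exp (of_real (- ln x))" using True by simp
      also have "\<dots> = of_real (exp (- ln x))" by (rule exp_of_real)
      finally show ?thesis using x by (simp add: exp_minus)
    qed
    have "((\<lambda>x. c * of_real (ln x)) has_vector_derivative c * of_real (inverse x)) (at x within {a..b})"
      using x by (auto intro!: derivative_eq_intros has_vector_derivative_of_real
           simp: has_real_derivative_iff_has_vector_derivative[symmetric] field_simps)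
    then show "((\<lambda>x. c * of_real (ln x)) has_vector_derivative c * exp (- (s + 1) * of_real (ln x))) (at x within {a..b})"
      by (simp only: e)
  qed
  from integral_unique[OF this] show ?thesis
    unfolding kint_def by (simp only: if_P[OF True] right_diff_distrib)
next
  case False
  have "((\<lambda>x. c * exp (- (s + 1) * of_real (ln x))) has_integral
      - c * exp (- s * of_real (ln b)) / s - - c * exp (- s * of_real (ln a)) / s) {a..b}"
  proof (rule fundamental_theorem_of_calculus[OF assms(2)])
    fix x assume "x \<in> {a..b}"
    then have x: "x > 0" using assms by auto
    have e: "exp (- (s + 1) * of_real (ln x)) = of_real (inverse x) * exp (- s * of_real (ln x))"
    proof -
      have "exp (- (s + 1) * of_real (ln x)) = exp (of_real (- ln x)) * exp (- s * of_real (ln x))"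
        by (simp add: algebra_simps flip: exp_add)
      also have "exp (of_real (- ln x) :: complex) = of_real (inverse x)"
        unfolding exp_of_real using x by (simp add: exp_minus)
      finally show ?thesis .
    qed
    have l: "((\<lambda>x. - s * of_real (ln x)) has_vector_derivative - s * of_real (inverse x)) (at x within {a..b})"
      using x by (intro has_vector_derivative_mult_right has_vector_derivative_of_real)
        (auto intro!: derivative_eq_intros simp: has_real_derivative_iff_has_vector_derivative[symmetric] field_simps)
    have "((\<lambda>x. exp (- s * of_real (ln x))) has_vector_derivative
             (- s * of_real (inverse x)) * exp (- s * of_real (ln x))) (at x within {a..b})"
      using field_vector_diff_chain_within[OF l, of exp "exp (- s * of_real (ln x))"]
      by (auto simp: o_def intro: DERIV_exp has_field_derivative_at_within)
    then have "((\<lambda>x. (- c / s) * exp (- s * of_real (ln x))) has_vector_derivative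
             (- c / s) * ((- s * of_real (inverse x)) * exp (- s * of_real (ln x)))) (at x within {a..b})"
      by (rule has_vector_derivative_mult_right)
    then show "((\<lambda>x. - c * exp (- s * of_real (ln x)) / s) has_vector_derivative c * exp (- (s + 1) * of_real (ln x))) (at x within {a..b})"
      unfolding e using False by (simp add: mult.assoc)
  qed
  from integral_unique[OF this] show ?thesis using False unfolding kint_def
    by (simp only: if_False) (simp add: right_diff_distrib diff_divide_distrib)
qed

lemma kint_shift:
  assumes "0 < a" shows "kint (\<lambda>x. w x * of_real x) a b s = kint w a b (s - 1)"
  unfolding kint_def
proof (rule integral_cong)
  fix x assume "x \<in> {a..b}"
  then have x: "x > 0" using assms by auto
  have "of_real x * exp (- (s + 1) * of_real (ln x)) = exp (of_real (ln x)) * exp (- (s + 1) * of_real (ln x))"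
    using x by (subst exp_of_real) simp
  also have "\<dots> = exp (- (s - 1 + 1) * of_real (ln x))"
    by (simp add: algebra_simps flip: exp_add)
  finally show "w x * of_real x * exp (- (s + 1) * of_real (ln x)) = w x * exp (- (s - 1 + 1) * of_real (ln x))"
    by (simp add: mult.assoc)
qed

lemma kint_linear:
  assumes "0 < a" "a \<le> b"
  shows "kint (\<lambda>x. c - d * of_real x) a b s = kint (\<lambda>_. c) a b s - kint (\<lambda>_. d) a b (s - 1)"
proof -
  have i: "(\<lambda>x. c * exp (- (s + 1) * of_real (ln x))) integrable_on {a..b}"
    and j: "(\<lambda>x. d * of_real x * exp (- (s + 1) * of_real (ln x))) integrable_on {a..b}"
    using assms by (intro integrable_continuous_interval continuous_intros; simp)+
  have "kint (\<lambda>x. c - d * of_real x) a b s = kint (\<lambda>_. c) a b s - kint (\<lambda>x. d * of_real x) a b s"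
    unfolding kint_def left_diff_distrib by (rule integral_diff[OF i j])
  then show ?thesis using kint_shift[OF assms(1), of "\<lambda>_. d"] by simp
qed

section \<open>Newman's Tauberian theorem\<close>

text \<open>Subtracting H(0) leaves the removable quotient \<open>q\<close>, whose integral over the
  closed curve vanishes. The remaining 1/z has the primitive Ln z off the negative axis and Ln (-z)
  off the positive axis, and each arc contributes pi i. Treating the arcs separately allows one of
  them to be replaced by another curve with the same end points.\<close>

lemma Cauchy_two_arcs:
  fixes R :: real
  assumes H: "H holomorphic_on S" "open S" "convex S" and R: "R > 0"
    and g1: "valid_path g1" "pathstart g1 = - (of_real R * \<i>)" "pathfinish g1 = of_real R * \<i>"
      "path_image g1 \<subseteq> S - \<real>\<^sub>\<le>\<^sub>0"
    and g2: "valid_path g2" "pathstart g2 = of_real R * \<i>" "pathfinish g2 = - (of_real R * \<i>)"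
      "path_image g2 \<subseteq> S - \<real>\<^sub>\<ge>\<^sub>0"
    and I1: "((\<lambda>z. H z / z) has_contour_integral I1) g1"
    and I2: "((\<lambda>z. H z / z) has_contour_integral I2) g2"
  shows "I1 + I2 = 2 * pi * \<i> * H 0"
proof -
  define q where "q z = (if z = 0 then deriv H 0 else (H z - H 0) / (z - 0))" for z
  have q: "q holomorphic_on S"
    unfolding q_def[abs_def] by (rule pole_lemma_open[OF H(1,2)])
  have "(q has_contour_integral 0) (g1 +++ g2)"
    using g1 g2 by (intro Cauchy_theorem_convex_simple[OF q H(3)]) (auto simp: path_image_join)
  moreover have "(q has_contour_integral (I1 - H 0 * (Ln (of_real R * \<i>) - Ln (- (of_real R * \<i>))))) g1"
  proof (rule has_contour_integral_eq)
    have "(inverse has_contour_integral (Ln (pathfinish g1) - Ln (pathstart g1))) g1"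
      by (rule contour_integral_primitive[where S = "- \<real>\<^sub>\<le>\<^sub>0"])
         (use g1 in \<open>auto intro!: derivative_eq_intros simp: field_simps\<close>)
    then show "((\<lambda>z. H z / z - H 0 * inverse z) has_contour_integral
        (I1 - H 0 * (Ln (of_real R * \<i>) - Ln (- (of_real R * \<i>))))) g1"
      unfolding g1 by (intro has_contour_integral_diff I1 has_contour_integral_lmul)
    show "H z / z - H 0 * inverse z = q z" if "z \<in> path_image g1" for z
      using that g1(4) by (auto simp: q_def divide_simps)
  qed
  moreover have "(q has_contour_integral (I2 - H 0 * (Ln (of_real R * \<i>) - Ln (- (of_real R * \<i>))))) g2"
  proof (rule has_contour_integral_eq)
    have "(inverse has_contour_integral (Ln (- pathfinish g2) - Ln (- pathstart g2))) g2"
    proof (rule contour_integral_primitive[where S = "- \<real>\<^sub>\<ge>\<^sub>0"])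
      fix z :: complex assume "z \<in> - \<real>\<^sub>\<ge>\<^sub>0"
      then have z: "- z \<notin> \<real>\<^sub>\<le>\<^sub>0" by simp
      then have "z \<noteq> 0" by auto
      with z show "((\<lambda>z. Ln (- z)) has_field_derivative inverse z) (at z within - \<real>\<^sub>\<ge>\<^sub>0)"
        by (auto intro!: derivative_eq_intros simp: field_simps)
    qed (use g2 in auto)
    then show "((\<lambda>z. H z / z - H 0 * inverse z) has_contour_integral
        (I2 - H 0 * (Ln (of_real R * \<i>) - Ln (- (of_real R * \<i>))))) g2"
      unfolding g2 minus_minus by (intro has_contour_integral_diff I2 has_contour_integral_lmul)
    show "H z / z - H 0 * inverse z = q z" if "z \<in> path_image g2" for z
      using that g2(4) by (auto simp: q_def divide_simps)
  qed
  ultimately have "I1 - H 0 * (Ln (of_real R * \<i>) - Ln (- (of_real R * \<i>))) +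
      (I2 - H 0 * (Ln (of_real R * \<i>) - Ln (- (of_real R * \<i>)))) = 0"
    using has_contour_integral_join[of q _ g1 _ g2] g1 g2 has_contour_integral_unique by blast
  moreover have "Ln (of_real R * \<i>) - Ln (- (of_real R * \<i>)) = pi * \<i>"
    using Ln_times_of_real[OF R, of \<i>] Ln_times_of_real[OF R, of "- \<i>"] by simp
  ultimately show ?thesis by (simp add: algebra_simps)
qed

text \<open>At parameter x the factor exp (z L) has modulus exp (- d L x), whose integral over the
  unit interval is at most 1 / (d L).\<close>

lemma contour_integral_exp_segment_bound:
  assumes d: "d > 0" and L: "L > 0" and v: "Re a = 0" "Re b = - d"
    and cont: "continuous_on (closed_segment a b) g"
    and B: "\<And>z. z \<in> closed_segment a b \<Longrightarrow> norm (g z) \<le> B"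
  shows "norm (contour_integral (linepath a b) (\<lambda>z. g z * exp (z * of_real L))) \<le> B * norm (b - a) / (d * L)"
proof -
  let ?f = "\<lambda>z. g z * exp (z * of_real L)"
  have "?f contour_integrable_on linepath a b"
    using cont by (intro contour_integrable_continuous_linepath continuous_intros)
  then have "(?f has_contour_integral contour_integral (linepath a b) ?f) (linepath a b)"
    using has_contour_integral_integral by blast
  then have I: "((\<lambda>x. ?f (linepath a b x) * (b - a)) has_integral contour_integral (linepath a b) ?f) {0..1}"
    by (simp add: has_contour_integral_linepath)
  have B0: "B \<ge> 0" using order_trans[OF norm_ge_zero B[of a]] by simp
  define E where "E x = B * norm (b - a) * exp (- (d * L) * x)" for x :: real
  have E: "(E has_integral (- B * norm (b - a) / (d * L) * exp (- (d * L) * 1) - - B * norm (b - a) / (d * L) * exp (- (d * L) * 0))) {0..1}"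
    unfolding E_def
    by (rule fundamental_theorem_of_calculus)
       (use d L in \<open>auto intro!: derivative_eq_intros simp flip: has_real_derivative_iff_has_vector_derivative\<close>)
  have "norm (integral {0..1} (\<lambda>x. ?f (linepath a b x) * (b - a))) \<le> integral {0..1} E"
  proof (rule integral_norm_bound_integral)
    show "(\<lambda>x. ?f (linepath a b x) * (b - a)) integrable_on {0..1}" using I by blast
    show "E integrable_on {0..1}" using E by blast
    fix x :: real assume x: "x \<in> {0..1}"
    have re: "Re (linepath a b x) = - d * x" using v by (simp add: linepath_def)
    have "linepath a b x \<in> closed_segment a b" using x linepath_in_path by auto

    show "norm (?f (linepath a b x) * (b - a)) \<le> E x"
    proof -
      have "norm (g (linepath a b x)) \<le> B" using \<open>linepath a b x \<in> closed_segment a b\<close> by (rule B)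
      then have "norm (g (linepath a b x)) * (exp (- (d * L) * x) * norm (b - a)) \<le> B * (exp (- (d * L) * x) * norm (b - a))"
        by (intro mult_right_mono) auto
      then show ?thesis
        unfolding norm_mult E_def norm_exp_eq_Re using re by (simp add: mult_ac)
    qed
  qed
  also have "\<dots> = B * norm (b - a) / (d * L) * (1 - exp (- (d * L)))"
    unfolding integral_unique[OF E] by (simp add: right_diff_distrib)
  also have "\<dots> \<le> B * norm (b - a) / (d * L) * 1"
    using B0 d L by (intro mult_left_mono) auto
  finally show ?thesis using integral_unique[OF I] by simp
qed

lemma path_image_right_semicircle:
  assumes "R > 0" "z \<in> path_image (part_circlepath 0 R (- pi / 2) (pi / 2))"
  shows "norm z = R" "Re z \<ge> 0"
proof -
  obtain t where t: "- pi / 2 \<le> t" "t \<le> pi / 2" "z = of_real R * exp (\<i> * of_real t)"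
    using assms by (auto simp: path_image_part_circlepath)
  show "norm z = R" using t(3) assms(1) by (simp add: norm_mult)
  show "Re z \<ge> 0" using t assms(1) cos_ge_zero[of t] by (simp add: Re_exp)
qed

lemma path_image_left_semicircle:
  assumes "R > 0" "z \<in> path_image (part_circlepath 0 R (pi / 2) (3 * pi / 2))"
  shows "norm z = R" "Re z \<le> 0"
proof -
  obtain t where t: "pi / 2 \<le> t" "t \<le> 3 * pi / 2" "z = of_real R * exp (\<i> * of_real t)"
    using assms by (auto simp: path_image_part_circlepath)
  show "norm z = R" using t(3) assms(1) by (simp add: norm_mult)
  have "cos (t - pi) \<ge> 0" using t by (intro cos_ge_zero) auto
  then show "Re z \<le> 0" using t assms(1) by (simp add: Re_exp mult_nonneg_nonpos)
qed

text \<open>Only the compact part of the imaginary axis up to height |R| has to be thickened; to its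
  right everything already lies in \<open>U\<close>.\<close>

lemma open_halfplane_strip:
  assumes U: "open U" "{z. Re z \<ge> 0} \<subseteq> U"
  obtains e where "e > 0" "{z. Re z > - e \<and> \<bar>Im z\<bar> < R} \<subseteq> U"
proof -
  define K where "K = (\<lambda>t. of_real t * \<i>) ` {- \<bar>R\<bar>..\<bar>R\<bar>}"
  have "compact K" unfolding K_def by (intro compact_continuous_image continuous_intros) auto
  moreover have "K \<subseteq> U" using U(2) by (auto simp: K_def)
  ultimately obtain e where e: "e > 0" "(\<Union>x\<in>K. ball x e) \<subseteq> U"
    using compact_subset_open_imp_ball_epsilon_subset[OF _ U(1)] by metis
  have "z \<in> U" if z: "Re z > - e" "\<bar>Im z\<bar> < R" for z
  proof (cases "Re z \<ge> 0")
    case True then show ?thesis using U(2) by auto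
  next
    case False
    have "dist (of_real (Im z) * \<i>) z = norm (of_real (- Re z) :: complex)"
      unfolding dist_norm by (rule arg_cong[where f = norm]) (simp add: complex_eq_iff)
    then have "dist (of_real (Im z) * \<i>) z = \<bar>Re z\<bar>" by (simp only: norm_of_real abs_minus)
    then have "z \<in> ball (of_real (Im z) * \<i>) e" using z False by simp
    moreover have "of_real (Im z) * \<i> \<in> K" unfolding K_def using z by (intro imageI) auto
    ultimately show ?thesis using e(2) by blast
  qed
  then show ?thesis using that e(1) by blast
qed

text \<open>On the circle R^2 = z * cnj z. The resulting factor Re z cancels the 1 / Re z in the
  tail bounds, which blow up near the imaginary axis.\<close>

lemma newman_kernel_on_circle:
  fixes z :: complex
  assumes "norm z = R" "R > 0"
  shows "(1 + z\<^sup>2 / of_real (R\<^sup>2)) / z = of_real (2 * Re z / R\<^sup>2)"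
proof -
  have z0: "z \<noteq> 0" using assms by auto
  have "of_real (R\<^sup>2) = z * cnj z" using assms complex_norm_square[of z] by simp
  then have "of_real (R\<^sup>2) + z\<^sup>2 = z * (z + cnj z)" by (simp add: power2_eq_square algebra_simps)
  also have "z + cnj z = of_real (2 * Re z)" by (simp add: complex_add_cnj)
  finally have "of_real (R\<^sup>2) + z\<^sup>2 = z * of_real (2 * Re z)" .
  moreover have "(1 + z\<^sup>2 / of_real (R\<^sup>2)) / z = (of_real (R\<^sup>2) + z\<^sup>2) / (of_real (R\<^sup>2) * z)"
    using assms(2) z0 by (simp add: field_simps)
  ultimately show ?thesis using z0 by simp
qed

text \<open>The hypothesis \<open>bound\<close> is what holds for \<open>T n z\<close> equal to the integral of \<open>u(x) x\<^bsup>-z-1\<^esup>\<close> over \<open>[n+1, n+2]\<close> with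
  \<open>\<bar>u\<bar> \<le> C\<close>; its right-hand side telescopes. The partial sums \<open>S N\<close> are entire and are integrated over the
  full circle of radius \<open>R\<close>, whereas for \<open>G\<close> the left semicircle is replaced by the two segments
  \<open>iR \<rightarrow> -d \<rightarrow> -iR\<close>.\<close>

theorem newman_tauberian:
  fixes T :: "nat \<Rightarrow> complex \<Rightarrow> complex"
  assumes hol: "\<And>n. T n holomorphic_on UNIV" and C: "C \<ge> 0"
    and bound: "\<And>n z. Re z \<noteq> 0 \<Longrightarrow>
       norm (T n z) \<le> C * (real (n + 1) powr (- Re z) - real (n + 2) powr (- Re z)) / Re z"
    and sums: "\<And>z. Re z > 0 \<Longrightarrow> (\<lambda>n. T n z) sums G z"
    and U: "open U" "{z. Re z \<ge> 0} \<subseteq> U" and G: "G holomorphic_on U"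
  shows "(\<lambda>n. T n 0) sums G 0"
proof -
  define S where "S N z = (\<Sum>n<N. T n z)" for N z
  have holS: "S N holomorphic_on A" for N A
    unfolding S_def[abs_def] using hol holomorphic_on_subset by (intro holomorphic_intros) blast
  have tele: "norm (S M z - S N z) \<le> C * (real (N + 1) powr (- Re z) - real (M + 1) powr (- Re z)) / Re z"
    if "N \<le> M" "Re z \<noteq> 0" for M N z
    using that(1)
  proof (induction M rule: dec_induct)
    case base then show ?case by simp
  next
    case (step M)
    have "S (Suc M) z - S N z = (S M z - S N z) + T M z" by (simp add: S_def)
    then have "norm (S (Suc M) z - S N z) \<le> norm (S M z - S N z) + norm (T M z)"
      by (simp only: norm_triangle_ineq)
    also have "\<dots> \<le> C * (real (N + 1) powr (- Re z) - real (M + 1) powr (- Re z)) / Re z +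
       C * (real (M + 1) powr (- Re z) - real (M + 2) powr (- Re z)) / Re z"
      using step.IH bound[OF that(2)] by (intro add_mono) auto
    also have "\<dots> = C * (real (N + 1) powr (- Re z) - real (Suc M + 1) powr (- Re z)) / Re z"
      by (simp add: algebra_simps diff_divide_distrib add_divide_distrib)
    finally show ?case .
  qed
  have right: "norm (G z - S N z) \<le> C * real (N + 1) powr (- Re z) / Re z" if z: "Re z > 0" for N z
  proof (rule Lim_norm_ubound[OF sequentially_bot])
    show "(\<lambda>M. S M z - S N z) \<longlonglongrightarrow> G z - S N z"
      using sums[OF z] unfolding sums_def S_def by (intro tendsto_intros)
    show "\<forall>\<^sub>F M in sequentially. norm (S M z - S N z) \<le> C * real (N + 1) powr (- Re z) / Re z"
    proof (rule eventually_sequentiallyI)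
      fix M assume "N \<le> M"
      have "norm (S M z - S N z) \<le> C * (real (N + 1) powr (- Re z) - real (M + 1) powr (- Re z)) / Re z"
        using tele[OF \<open>N \<le> M\<close>] z by simp
      also have "\<dots> \<le> C * (real (N + 1) powr (- Re z)) / Re z"
        using z C by (intro divide_right_mono mult_left_mono) auto
      finally show "norm (S M z - S N z) \<le> C * real (N + 1) powr (- Re z) / Re z" .
    qed
  qed
  \<comment> \<open>To the left of the axis the partial sum itself, not the tail, is the small
    quantity: its telescoped bound is dominated by the upper end.\<close>
  have left: "norm (S N z) \<le> C * real (N + 1) powr (- Re z) / (- Re z)" if z: "Re z < 0" for N z
  proof -
    have "norm (S N z) \<le> C * (1 - real (N + 1) powr (- Re z)) / Re z"
      using tele[of 0 N z] z by (simp add: S_def)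
    also have "\<dots> = C * (real (N + 1) powr (- Re z) - 1) / (- Re z)"
      using z by (simp add: field_simps)
    also have "\<dots> \<le> C * (real (N + 1) powr (- Re z)) / (- Re z)"
      using z C by (intro divide_right_mono mult_left_mono) auto
    finally show ?thesis .
  qed
  \<comment> \<open>The semicircles cost 2 C / R uniformly in N. Only the two segments see the
    continuation of \<open>G\<close>; their contribution \<open>D\<close> may depend on R, but it is
    divided by ln (N + 1).\<close>
  have key: "\<exists>D. \<forall>N\<ge>1. norm (G 0 - S N 0) \<le> 2 * C / R + D / ln (real (N + 1))" if R: "R > 0" for R
  proof -
    obtain e where e: "e > 0" "{z. Re z > - e \<and> \<bar>Im z\<bar> < R + 1} \<subseteq> U"
      using open_halfplane_strip[OF U] by blast
    define d where "d = e / 2"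
    have d: "d > 0" "d < e" using e(1) by (auto simp: d_def)
    \<comment> \<open>A box is used because it is convex, as the Cauchy formula for two arcs
      requires, and contains the right half-disc and both segments.\<close>
    define V where "V = {z. Re z > - e \<and> \<bar>Im z\<bar> < R + 1}"
    have V: "V = {z. Re z > - e} \<inter> {z. Im z < R + 1} \<inter> {z. Im z > - (R + 1)}"
      by (auto simp: V_def)
    have oV: "open V" unfolding V by (intro open_Int open_halfspace_Re_gt open_halfspace_Im_gt open_halfspace_Im_lt)
    have cV: "convex V" unfolding V
      by (intro convex_Int convex_halfspace_Re_gt convex_halfspace_Im_gt convex_halfspace_Im_lt)
    have GV: "G holomorphic_on V" using G e(2) holomorphic_on_subset V_def by blast
    define g1 where "g1 = part_circlepath 0 R (- pi / 2) (pi / 2)"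
    define g2 where "g2 = part_circlepath 0 R (pi / 2) (3 * pi / 2)"
    define z1 z2 :: complex where "z1 = of_real R * \<i>" and "z2 = - of_real d"
    define g3 where "g3 = linepath z1 z2 +++ linepath z2 (- z1)"
    have exp_half: "exp (\<i> * (of_real pi / 2)) = \<i>" "exp (- (\<i> * of_real pi / 2)) = - \<i>"
      by (simp_all add: exp_eq_polar complex_eq_iff Re_exp Im_exp)
    have exp_3half: "exp (\<i> * (3 * of_real pi / 2)) = - \<i>"
    proof -
      have "exp (\<i> * (3 * of_real pi / 2)) = cis (3 / 2 * pi)" by (simp add: cis_conv_exp)
      also have "\<dots> = - \<i>"
        by (simp only: complex_eq_iff cis.sel cos_3over2_pi sin_3over2_pi) simp
      finally show ?thesis .
    qed
    have g1: "valid_path g1" "pathstart g1 = - z1" "pathfinish g1 = z1"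
      unfolding g1_def z1_def using exp_half by (simp_all add: mult.commute)
    have g2: "valid_path g2" "pathstart g2 = z1" "pathfinish g2 = - z1"
      unfolding g2_def z1_def using exp_half exp_3half by (simp_all add: mult.commute)
    have g3: "valid_path g3" "pathstart g3 = z1" "pathfinish g3 = - z1"
      unfolding g3_def by simp_all
    have p1: "norm z = R" "Re z \<ge> 0" if "z \<in> path_image g1" for z
      using path_image_right_semicircle[OF R] that unfolding g1_def by auto
    have p2: "norm z = R" "Re z \<le> 0" if "z \<in> path_image g2" for z
      using path_image_left_semicircle[OF R] that unfolding g2_def by auto
    have pg1: "path_image g1 \<subseteq> A - \<real>\<^sub>\<le>\<^sub>0" if "cball 0 R \<inter> {z. Re z \<ge> 0} \<subseteq> A" for A
    proof
      fix z assume z: "z \<in> path_image g1"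
      have "z \<notin> \<real>\<^sub>\<le>\<^sub>0"
      proof
        assume "z \<in> \<real>\<^sub>\<le>\<^sub>0"
        then have "z = 0" using p1[OF z] by (auto simp: complex_nonpos_Reals_iff complex_eq_iff)
        then show False using p1[OF z] R by simp
      qed
      then show "z \<in> A - \<real>\<^sub>\<le>\<^sub>0" using p1[OF z] that by auto
    qed
    have pg2: "path_image g2 \<subseteq> UNIV - \<real>\<^sub>\<ge>\<^sub>0"
    proof
      fix z assume z: "z \<in> path_image g2"
      have "z \<notin> \<real>\<^sub>\<ge>\<^sub>0"
      proof
        assume "z \<in> \<real>\<^sub>\<ge>\<^sub>0"
        then have "z = 0" using p2[OF z] by (auto simp: complex_nonneg_Reals_iff complex_eq_iff)
        then show False using p2[OF z] R by simp
      qed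
      then show "z \<in> UNIV - \<real>\<^sub>\<ge>\<^sub>0" by auto
    qed
    have half_in_V: "cball 0 R \<inter> {z. Re z \<ge> 0} \<subseteq> V"
    proof
      fix z assume "z \<in> cball 0 R \<inter> {z. Re z \<ge> 0}"
      then show "z \<in> V" using abs_Im_le_cmod[of z] e(1) by (auto simp: V_def)
    qed
    have zV: "z1 \<in> V" "- z1 \<in> V" "z2 \<in> V" using R d e by (auto simp: V_def z1_def z2_def)
    have seg1: "closed_segment z1 z2 \<subseteq> V" "closed_segment (- z1) z2 \<subseteq> V"
      using zV cV by (simp_all add: closed_segment_subset)
    have seg2: "z \<notin> \<real>\<^sub>\<ge>\<^sub>0" if z: "z \<in> closed_segment w z2" "w = z1 \<or> w = - z1" for z w
    proof
      assume zr: "z \<in> \<real>\<^sub>\<ge>\<^sub>0"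
      obtain u where u: "0 \<le> u" "u \<le> 1" "z = (1 - u) *\<^sub>R w + u *\<^sub>R z2"
        using z(1) by (auto simp: in_segment)
      have "Re z = - u * d" using u(3) z(2) by (elim disjE) (simp_all add: z1_def z2_def)
      moreover have "Im z = (1 - u) * R \<or> Im z = - ((1 - u) * R)"
        using u(3) z(2) by (elim disjE) (simp_all add: z1_def z2_def)
      ultimately have "u * d \<le> 0" "u = 1"
        using zr R by (auto simp: complex_nonneg_Reals_iff)
      then show False using d by simp
    qed
    have pg3: "path_image g3 \<subseteq> V - \<real>\<^sub>\<ge>\<^sub>0"
    proof -
      have "path_image g3 = closed_segment z1 z2 \<union> closed_segment (- z1) z2"
        unfolding g3_def by (simp add: path_image_join closed_segment_commute)
      then show ?thesis using seg1 seg2 by blast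
    qed
    define h where "h z = G z * (1 + z\<^sup>2 / of_real (R\<^sup>2)) / z" for z
    have conth: "continuous_on (closed_segment w z2) h" if "w = z1 \<or> w = - z1" for w
    proof -
      have "continuous_on (closed_segment w z2) G"
        using GV seg1 that holomorphic_on_imp_continuous_on continuous_on_subset by blast
      moreover have "\<forall>z\<in>closed_segment w z2. z \<noteq> 0" using seg2[OF _ that] by fastforce
      ultimately show ?thesis unfolding h_def using R by (intro continuous_intros) auto
    qed
    have "\<exists>B. \<forall>z\<in>closed_segment w z2. norm (h z) \<le> B" if "w = z1 \<or> w = - z1" for w
      using compact_imp_bounded[OF compact_continuous_image[OF conth[OF that] compact_segment]]
      unfolding bounded_iff by blast
    then obtain B1 B2 where B1: "\<And>z. z \<in> closed_segment z1 z2 \<Longrightarrow> norm (h z) \<le> B1"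
      and B2: "\<And>z. z \<in> closed_segment (- z1) z2 \<Longrightarrow> norm (h z) \<le> B2" by metis
    define D0 where "D0 = B1 * norm (z2 - z1) / d + B2 * norm (z2 - (- z1)) / d"
    have main: "norm (G 0 - S N 0) \<le> 2 * C / R + (D0 / (2 * pi)) / ln (real (N + 1))" if N: "N \<ge> 1" for N
    proof -
      \<comment> \<open>Then exp (z L) has modulus (N + 1)^(Re z), which exactly cancels the
        dependence on N in \<open>right\<close> and \<open>left\<close>.\<close>
      define L where "L = ln (real (N + 1))"
      have L: "L > 0" using N by (simp add: L_def)
      define k where "k z = exp (z * of_real L) * (1 + z\<^sup>2 / of_real (R\<^sup>2))" for z :: complex
      have kk: "k z / z = exp (z * of_real L) * of_real (2 * Re z / R\<^sup>2)" if "norm z = R" for z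
        unfolding k_def using newman_kernel_on_circle[OF that R] by (metis times_divide_eq_right)
      have nk: "norm (k z / z) = real (N + 1) powr (Re z) * (2 * \<bar>Re z\<bar> / R\<^sup>2)" if "norm z = R" for z
        unfolding kk[OF that] norm_mult norm_of_real
        by (simp add: L_def powr_def abs_mult abs_divide)
      have holk: "k holomorphic_on A" for A unfolding k_def[abs_def] using R by (intro holomorphic_intros) auto
      define HG where "HG z = G z * k z" for z
      define HS where "HS z = S N z * k z" for z
      have HG: "HG holomorphic_on V" unfolding HG_def[abs_def] by (intro holomorphic_intros GV holk)
      have HS: "HS holomorphic_on A" for A unfolding HS_def[abs_def] by (intro holomorphic_intros holS holk)
      have ci1: "(\<lambda>z. HG z / z) contour_integrable_on g1"
      proof -
        have "continuous_on (path_image g1) HG"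
          using HG pg1[OF half_in_V] holomorphic_on_imp_continuous_on continuous_on_subset by blast
        moreover have "\<forall>z\<in>path_image g1. z \<noteq> 0" using pg1[OF half_in_V] by fastforce
        ultimately have "continuous_on (path_image g1) (\<lambda>z. HG z / z)"
          by (intro continuous_intros) auto
        then show ?thesis unfolding g1_def by (rule contour_integrable_continuous_part_circlepath)
      qed
      have contHS: "continuous_on A (\<lambda>z. HS z / z)" if "0 \<notin> A" for A
        using that holomorphic_on_imp_continuous_on[OF HS] by (intro continuous_intros) auto
      have n0: "0 \<notin> path_image g1" "0 \<notin> path_image g2" using pg1[OF half_in_V] pg2 by fastforce+
      have ci2: "(\<lambda>z. HS z / z) contour_integrable_on g1"
        using contHS[OF n0(1)] unfolding g1_def by (rule contour_integrable_continuous_part_circlepath)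
      have ci3: "(\<lambda>z. HS z / z) contour_integrable_on g2"
        using contHS[OF n0(2)] unfolding g2_def by (rule contour_integrable_continuous_part_circlepath)
      have HGz: "HG z / z = h z * exp (z * of_real L)" for z
        by (simp add: HG_def h_def k_def)
      have contHG: "continuous_on (closed_segment w z2) (\<lambda>z. HG z / z)" if "w = z1 \<or> w = - z1" for w
        unfolding HGz using conth[OF that] by (intro continuous_intros)
      have ci4: "(\<lambda>z. HG z / z) contour_integrable_on linepath z1 z2"
        "(\<lambda>z. HG z / z) contour_integrable_on linepath z2 (- z1)"
        using contHG[of z1] contHG[of "- z1"] closed_segment_commute[of z2 "- z1"]
        by (intro contour_integrable_continuous_linepath; simp only: simp_thms)+
      define I1 where "I1 = contour_integral g1 (\<lambda>z. HG z / z)"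
      define I2 where "I2 = contour_integral g1 (\<lambda>z. HS z / z)"
      define I3 where "I3 = contour_integral g2 (\<lambda>z. HS z / z)"
      define J1 where "J1 = contour_integral (linepath z1 z2) (\<lambda>z. HG z / z)"
      define J2 where "J2 = contour_integral (linepath z2 (- z1)) (\<lambda>z. HG z / z)"
      have h1: "((\<lambda>z. HG z / z) has_contour_integral I1) g1"
        unfolding I1_def using ci1 has_contour_integral_integral by blast
      have h2: "((\<lambda>z. HS z / z) has_contour_integral I2) g1"
        unfolding I2_def using ci2 has_contour_integral_integral by blast
      have h3: "((\<lambda>z. HS z / z) has_contour_integral I3) g2"
        unfolding I3_def using ci3 has_contour_integral_integral by blast
      have h4: "((\<lambda>z. HG z / z) has_contour_integral (J1 + J2)) g3"
        unfolding J1_def J2_def g3_def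
        using ci4 by (intro has_contour_integral_join has_contour_integral_integral) auto
      have c1: "I1 + (J1 + J2) = 2 * pi * \<i> * HG 0"
        using Cauchy_two_arcs[OF HG oV cV R g1(1) _ _ pg1[OF half_in_V] g3(1) _ _ pg3 h1 h4] g1 g3
        by (simp add: z1_def)
      have c2: "I2 + I3 = 2 * pi * \<i> * HS 0"
        using Cauchy_two_arcs[OF HS open_UNIV convex_UNIV R g1(1) _ _ pg1[OF subset_UNIV] g2(1) _ _ pg2 h2 h3] g1 g2
        by (simp add: z1_def)
      have bound_arc: "C * real (N + 1) powr (- x) / y * (real (N + 1) powr x * (2 * y / R\<^sup>2)) \<le> 2 * C / R\<^sup>2"
        if "y > 0" for x y
      proof -
        have "real (N + 1) powr (- x) * real (N + 1) powr x = 1" by (simp flip: powr_add)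
        moreover have "C * real (N + 1) powr (- x) / y * (real (N + 1) powr x * (2 * y / R\<^sup>2))
          = C * (real (N + 1) powr (- x) * real (N + 1) powr x) * 2 / R\<^sup>2 * (y / y)" by simp
        ultimately have "C * real (N + 1) powr (- x) / y * (real (N + 1) powr x * (2 * y / R\<^sup>2))
          = C * 1 * 2 / R\<^sup>2 * (y / y)" by (simp only:)
        also have "\<dots> \<le> 2 * C / R\<^sup>2" using that by (simp add: mult.commute)
        finally show ?thesis .
      qed
      have b1: "norm (I1 - I2) \<le> 2 * C / R\<^sup>2 * R * (pi / 2 - - pi / 2)"
      proof (rule has_contour_integral_bound_part_circlepath)
        show "((\<lambda>z. HG z / z - HS z / z) has_contour_integral (I1 - I2)) (part_circlepath 0 R (- pi / 2) (pi / 2))"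
          using has_contour_integral_diff[OF h1 h2] unfolding g1_def .
        fix z assume "z \<in> path_image (part_circlepath 0 R (- pi / 2) (pi / 2))"
        then have z: "norm z = R" "Re z \<ge> 0" using p1 unfolding g1_def by auto
        have eq: "HG z / z - HS z / z = (G z - S N z) * (k z / z)"
          by (simp add: HG_def HS_def algebra_simps diff_divide_distrib)
        show "norm (HG z / z - HS z / z) \<le> 2 * C / R\<^sup>2"
        proof (cases "Re z = 0")
          case True
          have "k z / z = 0" using kk[OF z(1)] True by (simp only:) simp
          show ?thesis unfolding eq \<open>k z / z = 0\<close> using C by simp
        next
          case False
          then have "Re z > 0" using z by simp
          have "norm (HG z / z - HS z / z) \<le> C * real (N + 1) powr (- Re z) / Re z * norm (k z / z)"
            unfolding eq norm_mult by (intro mult_right_mono right \<open>Re z > 0\<close>) auto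
          also have "\<dots> \<le> 2 * C / R\<^sup>2"
            using bound_arc[OF \<open>Re z > 0\<close>, of "Re z"] \<open>Re z > 0\<close> unfolding nk[OF z(1)] by simp
          finally show ?thesis .
        qed
      qed (use R C in auto)
      have b2: "norm I3 \<le> 2 * C / R\<^sup>2 * R * (3 * pi / 2 - pi / 2)"
      proof (rule has_contour_integral_bound_part_circlepath)
        show "((\<lambda>z. HS z / z) has_contour_integral I3) (part_circlepath 0 R (pi / 2) (3 * pi / 2))"
          using h3 unfolding g2_def .
        fix z assume "z \<in> path_image (part_circlepath 0 R (pi / 2) (3 * pi / 2))"
        then have z: "norm z = R" "Re z \<le> 0" using p2 unfolding g2_def by auto
        have eq: "HS z / z = S N z * (k z / z)" by (simp add: HS_def)
        show "norm (HS z / z) \<le> 2 * C / R\<^sup>2"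
        proof (cases "Re z = 0")
          case True
          have "k z / z = 0" using kk[OF z(1)] True by (simp only:) simp
          show ?thesis unfolding eq \<open>k z / z = 0\<close> using C by simp
        next
          case False
          then have "Re z < 0" using z by simp
          have "norm (HS z / z) \<le> C * real (N + 1) powr (- Re z) / (- Re z) * norm (k z / z)"
            unfolding eq norm_mult by (intro mult_right_mono left \<open>Re z < 0\<close>) auto
          also have "\<dots> \<le> 2 * C / R\<^sup>2"
            using bound_arc[of "- Re z" "Re z"] \<open>Re z < 0\<close> unfolding nk[OF z(1)] by simp
          finally show ?thesis .
        qed
      qed (use R C in auto)
      have b3: "norm J1 \<le> B1 * norm (z2 - z1) / (d * L)"
        unfolding J1_def HGz
        by (rule contour_integral_exp_segment_bound[OF d(1) L _ _ conth B1]) (auto simp: z1_def z2_def)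
      have J2': "J2 = - contour_integral (linepath (- z1) z2) (\<lambda>z. HG z / z)"
        unfolding J2_def using contHG[of "- z1"]
        by (intro contour_integral_reverse_linepath) (simp add: closed_segment_commute)
      have "norm (contour_integral (linepath (- z1) z2) (\<lambda>z. HG z / z)) \<le> B2 * norm (z2 - - z1) / (d * L)"
        unfolding HGz
        by (rule contour_integral_exp_segment_bound[OF d(1) L _ _ conth B2]) (auto simp: z1_def z2_def)
      then have b4: "norm J2 \<le> B2 * norm (z2 - - z1) / (d * L)"
        unfolding J2' by simp
      have k0: "k 0 = 1" by (simp add: k_def)
      \<comment> \<open>The two Cauchy formulas are subtracted: the common right arc carries the
        tail G - S N, the segments carry \<open>G\<close> alone, the left arc carries S N
        alone.\<close>
      have "2 * pi * \<i> * (G 0 - S N 0) = (I1 - I2) + (J1 + J2) - I3"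
        using c1 c2 k0 by (simp add: HG_def HS_def algebra_simps)
      then have "2 * pi * norm (G 0 - S N 0) = norm ((I1 - I2) + (J1 + J2) - I3)"
        by (metis (no_types, lifting) abs_of_nonneg norm_ii norm_mult norm_numeral norm_of_real mult.right_neutral pi_ge_zero of_real_mult of_real_numeral)
      also have "\<dots> \<le> norm (I1 - I2) + (norm J1 + norm J2) + norm I3"
        by (meson add_mono norm_triangle_ineq norm_triangle_ineq4 order_trans order_refl)
      also have "\<dots> \<le> 2 * C / R\<^sup>2 * R * (pi / 2 - - pi / 2) +
          (B1 * norm (z2 - z1) / (d * L) + B2 * norm (z2 - - z1) / (d * L)) + 2 * C / R\<^sup>2 * R * (3 * pi / 2 - pi / 2)"
        using b1 b2 b3 b4 by (intro add_mono)
      also have "\<dots> = 2 * pi * (2 * C / R) + D0 / L"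
        using R d L unfolding D0_def by (simp add: field_simps power2_eq_square)
      also have "\<dots> = 2 * pi * (2 * C / R + (D0 / (2 * pi)) / L)"
        by (simp add: field_simps)
      finally show ?thesis unfolding L_def by simp
    qed
    then show ?thesis by blast
  qed
  have "(\<lambda>N. S N 0) \<longlonglongrightarrow> G 0"
  proof (rule LIMSEQ_I)
    fix \<epsilon> :: real assume eps: "\<epsilon> > 0"
    define R where "R = 4 * (C + 1) / \<epsilon>"
    have R: "R > 0" using eps C by (simp add: R_def)
    obtain D where D: "\<And>N. N \<ge> 1 \<Longrightarrow> norm (G 0 - S N 0) \<le> 2 * C / R + D / ln (real (N + 1))"
      using key[OF R] by blast
    have "2 * C / R = \<epsilon> / 2 * (C / (C + 1))" using C eps by (simp add: R_def field_simps)
    also have "\<dots> \<le> \<epsilon> / 2 * 1" using C eps by (intro mult_left_mono) auto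
    finally have small: "2 * C / R \<le> \<epsilon> / 2" by simp
    have "(\<lambda>N. D / ln (real (N + 1))) \<longlonglongrightarrow> 0" by real_asymp
    then have "\<forall>\<^sub>F N in sequentially. D / ln (real (N + 1)) < \<epsilon> / 2"
      using eps by (intro order_tendstoD(2)[where a = "\<epsilon> / 2"]) auto
    then have "\<forall>\<^sub>F N in sequentially. norm (S N 0 - G 0) < \<epsilon>"
      using eventually_ge_at_top[of 1]
    proof eventually_elim
      case (elim N)
      have "norm (S N 0 - G 0) = norm (G 0 - S N 0)" by (rule norm_minus_commute)
      also have "\<dots> \<le> 2 * C / R + D / ln (real (N + 1))" using elim by (intro D)
      also have "\<dots> < \<epsilon> / 2 + \<epsilon> / 2" by (intro add_le_less_mono small elim)
      finally show ?case by simp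
    qed
    then show "\<exists>no. \<forall>n\<ge>no. norm (S n 0 - G 0) < \<epsilon>" by (simp add: eventually_sequentially)
  qed
  then show ?thesis unfolding sums_def S_def .
qed

section \<open>Dirichlet series\<close>

text \<open>\<open>npw n s\<close> is \<open>n\<^bsup>-s\<^esup>\<close> for \<open>n > 0\<close>, but \<open>npw 0 s = 1\<close> because \<open>ln 0 = 0\<close>; hence the coefficient
  sequences below are required to vanish at \<open>0\<close>.\<close>

definition npw :: "nat \<Rightarrow> complex \<Rightarrow> complex" where
  "npw n s = exp (- s * of_real (ln (real n)))"

lemma npw_1 [simp]: "npw (Suc 0) s = 1"
  by (simp add: npw_def)

lemma norm_npw: "n > 0 \<Longrightarrow> norm (npw n s) = real n powr (- Re s)"
  by (simp add: npw_def powr_def)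

lemma npw_mult: "m > 0 \<Longrightarrow> n > 0 \<Longrightarrow> npw (m * n) s = npw m s * npw n s"
  by (simp add: npw_def ln_mult algebra_simps flip: exp_add)

lemma npw_add: "npw n (s + t) = npw n s * npw n t"
  by (simp add: npw_def algebra_simps flip: exp_add)

lemma npw_of_real: "n > 0 \<Longrightarrow> npw n (of_real x) = of_real (real n powr (- x))"
proof -
  assume "n > 0"
  have "npw n (of_real x) = exp (of_real (- x * ln (real n)))" by (simp add: npw_def)
  also have "\<dots> = of_real (exp (- x * ln (real n)))" by (rule exp_of_real)
  finally show ?thesis using \<open>n > 0\<close> by (simp add: powr_def)
qed

lemma has_field_derivative_npw [derivative_intros]:
  "(npw n has_field_derivative (- of_real (ln (real n)) * npw n s)) (at s within A)"
  unfolding npw_def[abs_def] by (auto intro!: derivative_eq_intros)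

text \<open>\<open>dterm X \<mu> n s\<close> is the integral of \<open>(X(n+1) - \<mu> x) x\<^bsup>-s-1\<^esup>\<close> over \<open>[n+1, n+2]\<close>. If \<open>X\<close> is the summatory function
  of \<open>f\<close>, the series of these terms is \<open>(\<Sum> f(n) n\<^bsup>-s\<^esup> - \<mu> s / (s - 1)) / s\<close>, which thereby continues
  to the left of \<open>Re s = 1\<close> without its pole.\<close>

definition dterm :: "(nat \<Rightarrow> complex) \<Rightarrow> complex \<Rightarrow> nat \<Rightarrow> complex \<Rightarrow> complex" where
  "dterm X \<mu> n s = kint (\<lambda>x. X (n + 1) - \<mu> * of_real x) (real (n + 1)) (real (n + 2)) s"

lemma kint_const_npw:
  assumes "m > 0" "m \<le> n" "s \<noteq> 0"
  shows "s * kint (\<lambda>_. c) (real m) (real n) s = c * (npw m s - npw n s)"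
  using assms by (simp add: kint_const npw_def)

text \<open>For \<open>\<mu> = 0\<close> the point s = 1 is included, since the quotient is then 0
  whatever the denominator; this serves nonprincipal characters at 1.\<close>

lemma dterm_eq:
  assumes "s \<noteq> 0" "s \<noteq> 1 \<or> \<mu> = 0"
  shows "s * dterm X \<mu> n s = X (n + 1) * (npw (n + 1) s - npw (n + 2) s) -
     \<mu> * s / (s - 1) * (npw (n + 1) (s - 1) - npw (n + 2) (s - 1))"
proof -
  have *: "kint (\<lambda>_. \<mu>) (real (n + 1)) (real (n + 2)) (s - 1) =
      \<mu> * (npw (n + 1) (s - 1) - npw (n + 2) (s - 1)) / (s - 1)"
  proof (cases "\<mu> = 0")
    case True
    then show ?thesis by (simp add: kint_const)
  next
    case False
    then have "(s - 1) * kint (\<lambda>_. \<mu>) (real (n + 1)) (real (n + 2)) (s - 1) =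
        \<mu> * (npw (n + 1) (s - 1) - npw (n + 2) (s - 1))"
      using assms by (intro kint_const_npw) auto
    then show ?thesis using assms(2) False by (simp add: field_simps)
  qed
  have "s * dterm X \<mu> n s = s * kint (\<lambda>_. X (n + 1)) (real (n + 1)) (real (n + 2)) s -
      s * kint (\<lambda>_. \<mu>) (real (n + 1)) (real (n + 2)) (s - 1)"
    unfolding dterm_def by (subst kint_linear) (auto simp: right_diff_distrib)
  also have "s * kint (\<lambda>_. X (n + 1)) (real (n + 1)) (real (n + 2)) s =
      X (n + 1) * (npw (n + 1) s - npw (n + 2) s)"
    using assms by (intro kint_const_npw) auto
  finally show ?thesis unfolding * by simp
qed

text \<open>Abel summation for the part with \<open>X\<close>, telescoping for the part with
  \<open>\<mu>\<close>.\<close>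

lemma sum_dterm:
  assumes "s \<noteq> 0" "s \<noteq> 1 \<or> \<mu> = 0" and f0: "f 0 = 0" and X: "\<And>n. X n = (\<Sum>k\<le>n. f k)"
  shows "(\<Sum>n<N. s * dterm X \<mu> n s) = (\<Sum>n\<le>N. f n * npw n s) - X N * npw (N + 1) s -
     \<mu> * s / (s - 1) * (1 - npw (N + 1) (s - 1))"
proof (induction N)
  case 0
  then show ?case using f0 by (simp add: X)
next
  case (Suc N)
  have XS: "X (Suc N) = X N + f (Suc N)" by (simp add: X)
  show ?case
    unfolding sum.lessThan_Suc sum.atMost_Suc Suc.IH unfolding dterm_eq[OF assms(1,2)]
    by (simp add: XS algebra_simps add_divide_distrib diff_divide_distrib)
qed

text \<open>For Re s > 1 linear growth of \<open>X\<close> makes the boundary term of Abel summation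
  tend to 0.\<close>

lemma dterm_sums:
  assumes s: "Re s > 1" and f0: "f 0 = 0" and X: "\<And>n. X n = (\<Sum>k\<le>n. f k)"
    and C: "\<And>n. norm (X n) \<le> C * real n" and D: "(\<lambda>n. f n * npw n s) sums D"
  shows "(\<lambda>n. s * dterm X \<mu> n s) sums (D - \<mu> * s / (s - 1))"
proof -
  have s01: "s \<noteq> 0" "s \<noteq> 1 \<or> \<mu> = 0" using s by auto
  have C0: "C \<ge> 0" using order_trans[OF norm_ge_zero C[of 1]] by simp
  have lim: "(\<lambda>N. real (N + 1) powr (- (Re s - 1))) \<longlonglongrightarrow> 0"
    using s by real_asymp
  have 1: "(\<lambda>N. npw (N + 1) (s - 1)) \<longlonglongrightarrow> 0"
    by (rule tendsto_norm_zero_cancel) (use lim in \<open>simp add: norm_npw\<close>)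
  have 2: "(\<lambda>N. X N * npw (N + 1) s) \<longlonglongrightarrow> 0"
  proof (rule Lim_null_comparison)
    show "(\<lambda>N. C * real (N + 1) powr (- (Re s - 1))) \<longlonglongrightarrow> 0"
      using tendsto_mult[OF tendsto_const[of C] lim] by simp
    have "norm (X N * npw (N + 1) s) \<le> C * real (N + 1) powr (- (Re s - 1))" for N
    proof -
      have "norm (X N * npw (N + 1) s) \<le> (C * real (N + 1)) * real (N + 1) powr (- Re s)"
        unfolding norm_mult using C[of N] C0
        by (intro mult_mono) (auto simp: norm_npw algebra_simps intro: order_trans)
      also have "\<dots> = C * (real (N + 1) powr 1 * real (N + 1) powr (- Re s))" by simp
      also have "\<dots> = C * real (N + 1) powr (- (Re s - 1))" unfolding powr_add[symmetric] by simp
      finally show ?thesis .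
    qed
    then show "\<forall>\<^sub>F N in sequentially. norm (X N * npw (N + 1) s) \<le> C * real (N + 1) powr (- (Re s - 1))"
      by simp
  qed
  have "(\<lambda>N. \<Sum>n\<le>N. f n * npw n s) \<longlonglongrightarrow> D"
    using D by (simp add: sums_def_le)
  then have "(\<lambda>N. (\<Sum>n\<le>N. f n * npw n s) - X N * npw (N + 1) s -
     \<mu> * s / (s - 1) * (1 - npw (N + 1) (s - 1))) \<longlonglongrightarrow> D - 0 - \<mu> * s / (s - 1) * (1 - 0)"
    by (intro tendsto_intros 1 2)
  then show ?thesis unfolding sums_def sum_dterm[OF s01 f0 X] by simp
qed

lemma telescoping_powr_sums:
  assumes "\<delta> > 0"
  shows "(\<lambda>n. C * (real (n + 1) powr (- \<delta>) - real (n + 2) powr (- \<delta>)) / \<delta>) sums (C / \<delta>)"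
proof -
  have "(\<lambda>n. real (n + 1) powr (- \<delta>)) \<longlonglongrightarrow> 0" using assms by real_asymp
  from telescope_sums'[OF this] have "(\<lambda>n. real (n + 1) powr (- \<delta>) - real (n + 2) powr (- \<delta>)) sums 1"
    by simp
  from sums_divide[OF sums_mult[OF this, of C], of \<delta>] show ?thesis by simp
qed

text \<open>A bounded deviation of \<open>X\<close> from its main term gives a telescoping majorant,
  summable as soon as Re s > 0.\<close>

lemma dterm_series_holomorphic:
  assumes B: "\<And>n x. real (n + 1) \<le> x \<Longrightarrow> x \<le> real (n + 2) \<Longrightarrow> norm (X (n + 1) - \<mu> * of_real x) \<le> B"
  shows "(\<lambda>s. \<Sum>n. dterm X \<mu> n s) holomorphic_on {s. Re s > 0}"
    and "Re s > 0 \<Longrightarrow> (\<lambda>n. dterm X \<mu> n s) sums (\<Sum>n. dterm X \<mu> n s)"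
proof -
  have bnd: "norm (dterm X \<mu> n s) \<le> B * (real (n + 1) powr (- \<delta>) - real (n + 2) powr (- \<delta>)) / \<delta>"
    if "\<delta> > 0" "Re s \<ge> \<delta>" for n s \<delta>
    unfolding dterm_def using that B[of n]
    by (intro norm_kint_le) (auto intro!: continuous_intros)
  show "(\<lambda>s. \<Sum>n. dterm X \<mu> n s) holomorphic_on {s. Re s > 0}"
  proof (rule holomorphic_uniform_sequence)
    show "open {s. Re s > 0}" by (rule open_halfspace_Re_gt)
    show "(\<lambda>s. \<Sum>i<n. dterm X \<mu> i s) holomorphic_on {s. Re s > 0}" for n
      unfolding dterm_def by (intro holomorphic_intros kint_holomorphic continuous_intros) auto
    fix s :: complex assume "s \<in> {s. Re s > 0}"
    then have s: "Re s > 0" by simp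
    \<comment> \<open>Half the real part, so that the closed disc of this radius keeps Re z >=
      \<open>\<delta>\<close> and one majorant serves all of it.\<close>
    define \<delta> where "\<delta> = Re s / 2"
    have d: "\<delta> > 0" using s by (simp add: \<delta>_def)
    have ge: "Re z \<ge> \<delta>" if "z \<in> cball s \<delta>" for z
    proof -
      have "\<bar>Re (s - z)\<bar> \<le> \<delta>" using abs_Re_le_cmod[of "s - z"] that by (simp add: dist_norm)
      then have "Re s - Re z \<le> \<delta>" by (simp add: abs_le_iff)
      then show ?thesis by (simp add: \<delta>_def)
    qed
    have "uniform_limit (cball s \<delta>) (\<lambda>n z. \<Sum>i<n. dterm X \<mu> i z) (\<lambda>z. \<Sum>n. dterm X \<mu> n z) sequentially"
    proof (rule Weierstrass_m_test)
      show "summable (\<lambda>n. B * (real (n + 1) powr (- \<delta>) - real (n + 2) powr (- \<delta>)) / \<delta>)"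
        using telescoping_powr_sums[OF d] sums_summable by blast
    qed (use bnd[OF d] ge in auto)
    moreover have "cball s \<delta> \<subseteq> {s. Re s > 0}"
      using ge d by (auto intro: less_le_trans)
    ultimately show "\<exists>d>0. cball s d \<subseteq> {s. 0 < Re s} \<and>
      uniform_limit (cball s d) (\<lambda>n z. \<Sum>i<n. dterm X \<mu> i z) (\<lambda>z. \<Sum>n. dterm X \<mu> n z) sequentially"
      using d by blast
  qed
  show "(\<lambda>n. dterm X \<mu> n s) sums (\<Sum>n. dterm X \<mu> n s)" if "Re s > 0"
  proof (rule summable_sums, rule summable_comparison_test')
    show "summable (\<lambda>n. B * (real (n + 1) powr (- Re s) - real (n + 2) powr (- Re s)) / Re s)"
      using telescoping_powr_sums[OF that] sums_summable by blast
    show "norm (dterm X \<mu> n s) \<le> B * (real (n + 1) powr (- Re s) - real (n + 2) powr (- Re s)) / Re s"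
      if "n \<ge> 0" for n
      using bnd[OF \<open>Re s > 0\<close>] by simp
  qed
qed

lemma summable_ln_powr:
  assumes "\<sigma> > (1::real)" shows "summable (\<lambda>n. (1 + ln (real n)) ^ k * real n powr (- \<sigma>))"
proof (rule summable_comparison_test_bigo)
  show "summable (\<lambda>n. norm (real n powr (- ((1 + \<sigma>) / 2))))"
    using assms by (simp add: summable_real_powr_iff)
  show "(\<lambda>n. (1 + ln (real n)) ^ k * real n powr (- \<sigma>)) \<in> O(\<lambda>n. real n powr (- ((1 + \<sigma>) / 2)))"
    using assms by real_asymp
qed

text \<open>Logarithmic growth covers characters as well as their products with
  \<open>mangoldt\<close>. Keeping \<open>\<sigma>\<close> apart from Re s makes the majorant
  uniform on a half-plane, as termwise differentiation requires.\<close>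

lemma dirichlet_summable:
  assumes f: "\<And>n. norm (f n) \<le> (1 + ln (real n)) ^ k" and f0: "f 0 = 0" and s: "Re s \<ge> \<sigma>" "\<sigma> > 1"
  shows "norm (f n * npw n s) \<le> (1 + ln (real n)) ^ k * real n powr (- \<sigma>)"
    and "summable (\<lambda>n. norm (f n * npw n s))"
proof -
  show le: "norm (f n * npw n s) \<le> (1 + ln (real n)) ^ k * real n powr (- \<sigma>)" for n
  proof (cases "n = 0")
    case False
    then have "norm (npw n s) \<le> real n powr (- \<sigma>)" using s by (simp add: norm_npw powr_mono)
    then show ?thesis unfolding norm_mult using f[of n] False by (intro mult_mono) auto
  qed (use f0 in auto)
  show "summable (\<lambda>n. norm (f n * npw n s))"
    by (rule summable_comparison_test'[OF summable_ln_powr[OF s(2), of k]]) (use le in auto)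
qed

lemma dirichlet_derivative:
  assumes f: "\<And>n. norm (f n) \<le> (1 + ln (real n)) ^ k" and f0: "f 0 = 0"
    and D: "\<And>s. Re s > 1 \<Longrightarrow> (\<lambda>n. f n * npw n s) sums D s" and s: "Re s > 1"
  shows "(\<lambda>n. f n * of_real (ln (real n)) * npw n s) sums (- deriv D s)"
proof -
  let ?S = "{s. Re s > 1}"
  have "\<exists>g g'. \<forall>x\<in>?S. ((\<lambda>n. f n * npw n x) sums g x) \<and>
     ((\<lambda>n. f n * (- of_real (ln (real n)) * npw n x)) sums g' x) \<and> (g has_field_derivative g' x) (at x)"
  proof (rule series_and_derivative_comparison_complex)
    show "open ?S" by (rule open_halfspace_Re_gt)
    show "((\<lambda>x. f n * npw n x) has_field_derivative f n * (- of_real (ln (real n)) * npw n x)) (at x)" for n x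
      by (intro DERIV_cmult has_field_derivative_npw)
    fix x assume x: "x \<in> ?S"
    define d where "d = (Re x - 1) / 2"
    define \<sigma> where "\<sigma> = 1 + d"
    have d: "d > 0" "\<sigma> > 1" using x by (auto simp: d_def \<sigma>_def)
    define h where "h n = (of_real ((1 + ln (real n)) ^ k * real n powr (- \<sigma>)) :: complex)" for n
    have h0: "(1 + ln (real n)) ^ k * real n powr (- \<sigma>) \<ge> 0" for n by (cases "n = 0") auto
    have "summable h" unfolding h_def using summable_ln_powr[OF d(2)] by (rule summable_of_real)
    moreover have "h n \<in> \<real>\<^sub>\<ge>\<^sub>0" for n unfolding h_def by (simp only: nonneg_Reals_of_real_iff h0)
    then have "range h \<subseteq> \<real>\<^sub>\<ge>\<^sub>0" by blast
    moreover have "\<forall>\<^sub>F n in sequentially. \<forall>y\<in>ball x d \<inter> ?S. norm (f n * npw n y) \<le> norm (h n)"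
    proof (intro always_eventually allI ballI)
      fix n y assume "y \<in> ball x d \<inter> ?S"
      then have "norm (x - y) < d" by (simp add: dist_norm)
      then have "Re (x - y) \<le> d" using complex_Re_le_cmod[of "x - y"] by linarith
      then have "Re y \<ge> \<sigma>" by (simp add: d_def \<sigma>_def field_simps)
      then have "norm (f n * npw n y) \<le> (1 + ln (real n)) ^ k * real n powr (- \<sigma>)"
        using dirichlet_summable(1)[OF f f0 _ d(2)] by blast
      also have "\<dots> = norm (h n)" unfolding h_def norm_of_real using h0[of n] by simp
      finally show "norm (f n * npw n y) \<le> norm (h n)" .
    qed
    ultimately show "\<exists>d (h::nat \<Rightarrow> complex). 0 < d \<and> summable h \<and> range h \<subseteq> \<real>\<^sub>\<ge>\<^sub>0 \<and>
         (\<forall>\<^sub>F n in sequentially. \<forall>y\<in>ball x d \<inter> ?S. norm (f n * npw n y) \<le> norm (h n))"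
      using d(1) by (intro exI[of _ d] exI[of _ h] conjI)
  qed
  then obtain g g' where g: "\<And>x. Re x > 1 \<Longrightarrow> (\<lambda>n. f n * npw n x) sums g x"
     "\<And>x. Re x > 1 \<Longrightarrow> (\<lambda>n. f n * (- of_real (ln (real n)) * npw n x)) sums g' x"
     "\<And>x. Re x > 1 \<Longrightarrow> (g has_field_derivative g' x) (at x)" by fastforce
  have gD: "g x = D x" if "x \<in> ?S" for x
    using g(1)[of x] D[of x] that by (auto dest: sums_unique2)
  have "(D has_field_derivative g' s) (at s)"
    by (rule has_field_derivative_transform_within_open[OF g(3)[OF s] open_halfspace_Re_gt[of 1]])
       (use s gD in auto)
  then have "deriv D s = g' s" by (rule DERIV_imp_deriv)
  with sums_minus[OF g(2)[OF s]] show ?thesis by (simp add: mult.assoc)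
qed

text \<open>Absolute convergence allows the pairs (d, e) to be regrouped by n = d e. The sums are
  moved to positive indices first, because 0 has infinitely many divisors.\<close>

lemma dirichlet_convolution:
  fixes f g h :: "nat \<Rightarrow> complex"
  assumes f: "summable (\<lambda>n. norm (f n * npw n s))" "(\<lambda>n. f n * npw n s) sums F" "f 0 = 0"
    and g: "summable (\<lambda>n. norm (g n * npw n s))" "(\<lambda>n. g n * npw n s) sums G" "g 0 = 0"
    and h: "\<And>n. n > 0 \<Longrightarrow> h n = (\<Sum>d | d dvd n. f d * g (n div d))" "h 0 = 0"
  shows "(\<lambda>n. h n * npw n s) sums (F * G)"
proof -
  define A where "A = {0::nat<..}"
  define a b where "a n = f n * npw n s" and "b n = g n * npw n s" for n
  have onA: "(u has_sum S) A" if "(u has_sum S) UNIV" "u 0 = 0" for u :: "nat \<Rightarrow> complex" and S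
  proof -
    have "(u has_sum S) UNIV \<longleftrightarrow> (u has_sum S) A"
      by (rule has_sum_cong_neutral) (use that(2) in \<open>auto simp: A_def\<close>)
    then show ?thesis using that(1) by simp
  qed
  have aS: "(a has_sum F) A" "(b has_sum G) A"
    using norm_summable_imp_has_sum[OF f(1,2)] norm_summable_imp_has_sum[OF g(1,2)] f(3) g(3)
    unfolding a_def[abs_def] b_def[abs_def] by (auto intro!: onA)
  have aN: "(\<lambda>n. norm (a n)) summable_on A" "(\<lambda>n. norm (b n)) summable_on A"
  proof -
    have "(\<lambda>n. norm (a n)) summable_on UNIV" "(\<lambda>n. norm (b n)) summable_on UNIV"
      using f(1) g(1) unfolding a_def b_def by (subst summable_on_UNIV_nonneg_real_iff; simp)+
    then show "(\<lambda>n. norm (a n)) summable_on A" "(\<lambda>n. norm (b n)) summable_on A"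
      using summable_on_subset_banach subset_UNIV by blast+
  qed
  define P where "P p = a (fst p) * b (snd p)" for p
  have "(\<lambda>p. norm (P p)) summable_on (SIGMA d:A. A)"
  proof (rule summable_on_SigmaI)
    fix d assume "d \<in> A"
    show "((\<lambda>e. norm (P (d, e))) has_sum (norm (a d) * infsum (\<lambda>n. norm (b n)) A)) A"
      unfolding P_def norm_mult fst_conv snd_conv using aN(2) by (intro has_sum_cmult_right has_sum_infsum)
  next
    show "(\<lambda>d. norm (a d) * infsum (\<lambda>n. norm (b n)) A) summable_on A"
      using aN(1) by (rule summable_on_cmult_left)
  qed auto
  then have Psum: "P summable_on (SIGMA d:A. A)" by (rule abs_summable_summable)
  have "(P has_sum (F * G)) (SIGMA d:A. A)"
  proof (rule has_sum_SigmaI[OF _ _ Psum])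
    show "((\<lambda>e. P (d, e)) has_sum (a d * G)) A" for d
      unfolding P_def fst_conv snd_conv using aS(2) by (rule has_sum_cmult_right)
    show "((\<lambda>d. a d * G) has_sum (F * G)) A" using aS(1) by (rule has_sum_cmult_left)
  qed
  also have "?this \<longleftrightarrow> ((\<lambda>(n, d). a d * b (n div d)) has_sum (F * G)) (SIGMA n:A. {d. d dvd n})"
    by (rule has_sum_reindex_bij_witness[where j = "\<lambda>(d, e). (d * e, d)" and i = "\<lambda>(n, d). (d, n div d)"])
       (auto simp: A_def P_def dvd_div_eq_0_iff elim: dvdE intro!: Nat.gr0I)
  finally have "((\<lambda>n. \<Sum>d | d dvd n. a d * b (n div d)) has_sum (F * G)) A"
    by (rule has_sum_SigmaD) (auto simp: A_def intro!: has_sum_finite)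
  moreover have "(\<Sum>d | d dvd n. a d * b (n div d)) = h n * npw n s" if "n \<in> A" for n
  proof -
    have n: "n > 0" using that by (simp add: A_def)
    have "a d * b (n div d) = f d * g (n div d) * npw n s" if "d dvd n" for d
    proof -
      have "npw (d * (n div d)) s = npw d s * npw (n div d) s"
        using that n by (intro npw_mult) (auto intro!: Nat.gr0I simp: dvd_div_eq_0_iff)
      then show ?thesis using that by (simp add: a_def b_def)
    qed
    then show ?thesis using h(1)[OF n] by (simp add: sum_distrib_right)
  qed
  then have "((\<lambda>n. \<Sum>d | d dvd n. a d * b (n div d)) has_sum (F * G)) A \<longleftrightarrow>
      ((\<lambda>n. h n * npw n s) has_sum (F * G)) A" by (rule has_sum_cong)
  ultimately have "((\<lambda>n. h n * npw n s) has_sum (F * G)) A" by blast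
  moreover have "((\<lambda>n. h n * npw n s) has_sum (F * G)) UNIV \<longleftrightarrow> ((\<lambda>n. h n * npw n s) has_sum (F * G)) A"
    by (rule has_sum_cong_neutral) (use h(2) in \<open>auto simp: A_def\<close>)
  ultimately have "((\<lambda>n. h n * npw n s) has_sum (F * G)) UNIV" by simp
  then show ?thesis by (rule has_sum_imp_sums)
qed

section \<open>Dirichlet L-functions\<close>

text \<open>Writing f(u) = g(u) (u - z)^k with g(z) nonzero gives eps f'/f = k + eps g'/g at z +
  eps. The order of vanishing thus becomes a limit along a horizontal ray.\<close>

lemma zero_order_log_deriv:
  fixes f :: "complex \<Rightarrow> complex"
  assumes f: "f holomorphic_on S" and S: "open S" "connected S" and z: "z \<in> S" and w: "w \<in> S" "f w \<noteq> 0"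
  shows "\<exists>k::nat. (k = 0 \<longleftrightarrow> f z \<noteq> 0) \<and> (\<forall>\<^sub>F \<epsilon> in at_right 0. f (z + of_real \<epsilon>) \<noteq> 0) \<and>
     ((\<lambda>\<epsilon>. of_real \<epsilon> * deriv f (z + of_real \<epsilon>) / f (z + of_real \<epsilon>)) \<longlongrightarrow> of_nat k) (at_right 0)"
proof -
  have "\<exists>w\<in>S. f w \<noteq> 0" using w by blast
  note zo = zorder_exist_zero[OF f S z this]
  define k where "k = nat (zorder f z)"
  define g where "g = zor_poly f z"
  obtain r where r: "r > 0" "cball z r \<subseteq> S" "g holomorphic_on cball z r"
    "\<And>w. w \<in> cball z r \<Longrightarrow> f w = g w * (w - z) ^ k" "\<And>w. w \<in> cball z r \<Longrightarrow> g w \<noteq> 0"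
    using conjunct2[OF zo] unfolding k_def g_def by blast
  have k0: "k = 0 \<longleftrightarrow> f z \<noteq> 0" using conjunct1[OF zo] by (auto simp: k_def split: if_splits)
  have gb: "g holomorphic_on ball z r" using r(3) by (rule holomorphic_on_subset) auto
  have lin: "((\<lambda>\<epsilon>. z + of_real \<epsilon>) \<longlongrightarrow> z) (at_right 0)"
  proof -
    have "((\<lambda>\<epsilon>. z + of_real \<epsilon>) \<longlongrightarrow> z + of_real 0) (at_right 0)" by (intro tendsto_intros)
    then show ?thesis by simp
  qed
  have gc: "continuous_on (ball z r) g" "continuous_on (ball z r) (deriv g)"
    using gb holomorphic_deriv[OF gb open_ball] by (auto intro: holomorphic_on_imp_continuous_on)
  then have "isCont g z" "isCont (deriv g) z"
    using r(1) by (auto simp: continuous_on_eq_continuous_at)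
  then have lim: "((\<lambda>\<epsilon>. g (z + of_real \<epsilon>)) \<longlongrightarrow> g z) (at_right 0)"
     "((\<lambda>\<epsilon>. deriv g (z + of_real \<epsilon>)) \<longlongrightarrow> deriv g z) (at_right 0)"
    using isCont_tendsto_compose[OF _ lin] by blast+
  have gz: "g z \<noteq> 0" using r by simp
  have lim2: "((\<lambda>\<epsilon>. of_nat k + of_real \<epsilon> * deriv g (z + of_real \<epsilon>) / g (z + of_real \<epsilon>)) \<longlongrightarrow>
      of_nat k + of_real 0 * deriv g z / g z) (at_right 0)"
    by (intro tendsto_intros lim gz)
  have ev: "\<forall>\<^sub>F \<epsilon>::real in at_right 0. 0 < \<epsilon> \<and> \<epsilon> < r"
    using r(1) by (intro eventually_conj eventually_at_right_less) (auto simp: eventually_at_right_field)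
  have pt: "f (z + of_real \<epsilon>) \<noteq> 0 \<and> of_real \<epsilon> * deriv f (z + of_real \<epsilon>) / f (z + of_real \<epsilon>) =
      of_nat k + of_real \<epsilon> * deriv g (z + of_real \<epsilon>) / g (z + of_real \<epsilon>)"
    if e: "0 < \<epsilon>" "\<epsilon> < r" for \<epsilon> :: real
  proof -
    define u where "u = z + of_real \<epsilon>"
    have u: "u \<in> ball z r" "u - z = of_real \<epsilon>" using e by (auto simp: u_def dist_norm)
    have fu: "f u = g u * of_real \<epsilon> ^ k" "g u \<noteq> 0" using r(4,5)[of u] u by auto
    have dg: "(g has_field_derivative deriv g u) (at u)"
      using holomorphic_derivI[OF gb open_ball u(1)] .
    have "((\<lambda>w. g w * (w - z) ^ k) has_field_derivative
        deriv g u * (u - z) ^ k + g u * (of_nat k * (u - z) ^ (k - 1))) (at u)"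
      using dg by (auto intro!: derivative_eq_intros)
    then have "(f has_field_derivative deriv g u * (u - z) ^ k + g u * (of_nat k * (u - z) ^ (k - 1))) (at u)"
      by (rule has_field_derivative_transform_within_open[OF _ open_ball u(1)]) (use r(4) in auto)
    then have df: "deriv f u = deriv g u * of_real \<epsilon> ^ k + g u * (of_nat k * of_real \<epsilon> ^ (k - 1))"
      using u(2) DERIV_imp_deriv by metis
    have "of_real \<epsilon> * (of_nat k * of_real \<epsilon> ^ (k - 1)) = of_nat k * (of_real \<epsilon> :: complex) ^ k"
      by (cases k) auto
    moreover have "of_real \<epsilon> * deriv f u = of_real \<epsilon> * (deriv g u * of_real \<epsilon> ^ k) +
        g u * (of_real \<epsilon> * (of_nat k * of_real \<epsilon> ^ (k - 1)))"
      unfolding df by (simp only: distrib_left mult_ac)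
    ultimately have "of_real \<epsilon> * deriv f u = of_real \<epsilon> * (deriv g u * of_real \<epsilon> ^ k) + g u * (of_nat k * of_real \<epsilon> ^ k)"
      by (simp only:)
    then have "of_real \<epsilon> * deriv f u = (of_nat k * g u + of_real \<epsilon> * deriv g u) * of_real \<epsilon> ^ k"
      by (simp add: algebra_simps)
    then have "of_real \<epsilon> * deriv f u / f u = (of_nat k * g u + of_real \<epsilon> * deriv g u) / g u"
      unfolding fu using e fu(2) by (simp add: field_simps)
    then have "of_real \<epsilon> * deriv f u / f u = of_nat k + of_real \<epsilon> * deriv g u / g u"
      using fu(2) by (simp add: add_divide_distrib)
    moreover have "f u \<noteq> 0" using fu e by simp
    ultimately show ?thesis unfolding u_def by (intro conjI)
  qed
  have ev2: "\<forall>\<^sub>F \<epsilon> in at_right 0. of_nat k + of_real \<epsilon> * deriv g (z + of_real \<epsilon>) / g (z + of_real \<epsilon>) =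
      of_real \<epsilon> * deriv f (z + of_real \<epsilon>) / f (z + of_real \<epsilon>)"
    using ev by eventually_elim (use pt in metis)
  have "((\<lambda>\<epsilon>. of_real \<epsilon> * deriv f (z + of_real \<epsilon>) / f (z + of_real \<epsilon>)) \<longlongrightarrow> of_nat k + of_real 0 * deriv g z / g z) (at_right 0)"
    by (rule Lim_transform_eventually[OF lim2 ev2])
  then have "((\<lambda>\<epsilon>. of_real \<epsilon> * deriv f (z + of_real \<epsilon>) / f (z + of_real \<epsilon>)) \<longlongrightarrow> of_nat k) (at_right 0)"
    by simp
  moreover have "\<forall>\<^sub>F \<epsilon> in at_right 0. f (z + of_real \<epsilon>) \<noteq> 0"
    using ev by eventually_elim (use pt in metis)
  ultimately show ?thesis using k0 by (intro exI[of _ k] conjI)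
qed

lemma three_four_one_real:
  fixes u :: complex assumes "norm u = 1"
  shows "3 + 4 * Re u + Re (u ^ 2) \<ge> 0"
proof -
  have "(Re u)\<^sup>2 + (Im u)\<^sup>2 = 1" using assms by (simp add: cmod_def)
  then have "3 + 4 * Re u + Re (u ^ 2) = 2 * (1 + Re u)\<^sup>2"
    by (simp add: power2_eq_square algebra_simps)
  then show ?thesis by simp
qed

locale modulus =
  fixes M :: nat assumes M: "M > 1"
begin

section \<open>Continuation of L-functions and their logarithmic derivatives\<close>

lemma M0: "M > 0" using M by simp

lemma chars0: "\<xi> \<in> dchars M \<Longrightarrow> \<xi> 0 = 0"
  using M by (simp add: dchars_zero_iff)

definition csum :: "(nat \<Rightarrow> complex) \<Rightarrow> nat \<Rightarrow> complex" where
  "csum \<xi> n = (\<Sum>k\<le>n. \<xi> k)"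

text \<open>The mean of the character over a period, which is the residue of its L-function at
  1.\<close>

definition cmean :: "(nat \<Rightarrow> complex) \<Rightarrow> complex" where
  "cmean \<xi> = (if \<xi> = dprincipal M then of_nat (totient M) / of_nat M else 0)"

text \<open>The order of the pole of the L-function at 1.\<close>

definition cdelta :: "(nat \<Rightarrow> complex) \<Rightarrow> complex" where
  "cdelta \<xi> = (if \<xi> = dprincipal M then 1 else 0)"

lemma norm_cmean: "norm (cmean \<xi>) \<le> 1"
  using totient_le[of M] M by (simp add: cmean_def norm_divide)

lemma norm_csum_le:
  assumes "\<xi> \<in> dchars M" shows "norm (csum \<xi> n) \<le> 1 * real n"
proof (induction n)
  case (Suc n)
  have "norm (csum \<xi> (Suc n)) \<le> norm (csum \<xi> n) + norm (\<xi> (Suc n))"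
    unfolding csum_def by (simp add: norm_triangle_ineq)
  then show ?case using Suc norm_dchars_le[OF assms M0, of "Suc n"] by simp
qed (use assms chars0 in \<open>simp add: csum_def\<close>)

text \<open>After subtraction of the mean the sum over a period is 0, so the partial sums are
  periodic. The real variable \<open>x\<close> is there because \<open>dterm\<close> integrates over
  intervals of length 1.\<close>

lemma csum_bounded:
  assumes xi: "\<xi> \<in> dchars M" and x: "real n \<le> x" "x \<le> real (n + 1)"
  shows "norm (csum \<xi> n - cmean \<xi> * of_real x) \<le> 2 * real M + 1"
proof -
  define g where "g k = \<xi> k - cmean \<xi>" for k
  define h where "h n = (\<Sum>k<n. g k)" for n
  have gp: "g (n + M) = g n" for n
    using dchars_mod[OF xi, of "n + M"] dchars_mod[OF xi, of n] by (simp add: g_def)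
  have hM: "h M = 0"
    using sum_dchars_residues[OF xi M] M by (simp add: h_def g_def sum_subtractf cmean_def)
  have hp: "h (n + M) = h n" for n
    by (induction n) (use hM gp in \<open>auto simp: h_def\<close>)
  have gb: "norm (g k) \<le> 2" for k
    using norm_triangle_ineq4[of "\<xi> k" "cmean \<xi>"] norm_cmean[of \<xi>] norm_dchars_le[OF xi M0, of k]
    by (simp add: g_def)
  have hb: "norm (h n) \<le> 2 * real M" for n
  proof (induction n rule: less_induct)
    case (less n)
    show ?case
    proof (cases "n < M")
      case True
      have "norm (h n) \<le> (\<Sum>k<n. 2)" unfolding h_def by (intro sum_norm_le gb)
      then show ?thesis using True by simp
    next
      case False
      then have "h n = h (n - M)" using hp[of "n - M"] by simp
      then show ?thesis using less.IH[of "n - M"] False M by simp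
    qed
  qed
  have "csum \<xi> n = h (n + 1) + cmean \<xi> * of_nat (n + 1)"
    by (simp add: csum_def h_def g_def sum_subtractf lessThan_Suc_atMost algebra_simps)
  then have "csum \<xi> n - cmean \<xi> * of_real x = h (n + 1) + cmean \<xi> * of_real (real (n + 1) - x)"
    by (simp add: algebra_simps)
  also have "norm \<dots> \<le> norm (h (n + 1)) + norm (cmean \<xi> * of_real (real (n + 1) - x))"
    by (rule norm_triangle_ineq)
  also have "norm (cmean \<xi> * of_real (real (n + 1) - x)) \<le> 1 * 1"
    unfolding norm_mult norm_of_real using x by (intro mult_mono norm_cmean) auto
  finally show ?thesis using hb[of "n + 1"] by simp
qed

definition Lser :: "(nat \<Rightarrow> complex) \<Rightarrow> complex \<Rightarrow> complex" where
  "Lser \<xi> s = (\<Sum>n. \<xi> n * npw n s)"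

definition Vser :: "(nat \<Rightarrow> complex) \<Rightarrow> complex \<Rightarrow> complex" where
  "Vser \<xi> s = (\<Sum>n. \<xi> n * mangoldt n * npw n s)"

definition Eser :: "(nat \<Rightarrow> complex) \<Rightarrow> complex \<Rightarrow> complex" where
  "Eser \<xi> s = (\<Sum>n. dterm (csum \<xi>) (cmean \<xi>) n s)"

text \<open>The function \<open>L(s, \<xi>)\<close>, multiplied by \<open>s - 1\<close> for the principal character so that it
  is holomorphic on \<open>Re s > 0\<close>.\<close>

definition Lreg :: "(nat \<Rightarrow> complex) \<Rightarrow> complex \<Rightarrow> complex" where
  "Lreg \<xi> s = (if \<xi> = dprincipal M then cmean \<xi> * s + (s - 1) * (s * Eser \<xi> s) else s * Eser \<xi> s)"

lemma norm_dchars_ln: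
  assumes "\<xi> \<in> dchars M"
  shows "norm (\<xi> n) \<le> (1 + ln (real n)) ^ 1" "norm (\<xi> n * mangoldt n) \<le> (1 + ln (real n)) ^ 1"
proof -
  have l: "ln (real n) \<ge> 0" by (cases "n = 0") auto
  show "norm (\<xi> n) \<le> (1 + ln (real n)) ^ 1"
    using norm_dchars_le[OF assms M0, of n] l by simp
  show "norm (\<xi> n * mangoldt n) \<le> (1 + ln (real n)) ^ 1"
  proof (cases "n = 0")
    case False
    have "norm (\<xi> n * mangoldt n) \<le> 1 * ln (real n)"
      unfolding norm_mult using norm_dchars_le[OF assms M0, of n] mangoldt_le[of n] False mangoldt_nonneg[of n]
      by (intro mult_mono) auto
    then show ?thesis by simp
  qed simp
qed

lemma Lser_sums:
  assumes "\<xi> \<in> dchars M" "Re s > 1" shows "(\<lambda>n. \<xi> n * npw n s) sums Lser \<xi> s"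
    and "summable (\<lambda>n. norm (\<xi> n * npw n s))"
  using dirichlet_summable(2)[OF norm_dchars_ln(1)[OF assms(1)] chars0[OF assms(1)], of "Re s" s] assms(2)
  by (auto simp: Lser_def intro!: summable_sums summable_norm_cancel)

lemma Vser_sums:
  assumes "\<xi> \<in> dchars M" "Re s > 1" shows "(\<lambda>n. \<xi> n * mangoldt n * npw n s) sums Vser \<xi> s"
    and "summable (\<lambda>n. norm (\<xi> n * mangoldt n * npw n s))"
  using dirichlet_summable(2)[OF norm_dchars_ln(2)[OF assms(1)] _, of "Re s" s] assms(2)
  by (auto simp: Vser_def intro!: summable_sums summable_norm_cancel)

text \<open>By complete multiplicativity the character times ln is the convolution of the character
  times \<open>mangoldt\<close> with the character.\<close>

lemma Lser_deriv:
  assumes xi: "\<xi> \<in> dchars M" and s: "Re s > 1"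
  shows "- deriv (Lser \<xi>) s = Vser \<xi> s * Lser \<xi> s"
proof -
  have "(\<lambda>n. \<xi> n * of_real (ln (real n)) * npw n s) sums (- deriv (Lser \<xi>) s)"
    by (rule dirichlet_derivative[OF norm_dchars_ln(1)[OF xi] chars0[OF xi] Lser_sums(1)[OF xi] s])
  moreover have "(\<lambda>n. \<xi> n * of_real (ln (real n)) * npw n s) sums (Vser \<xi> s * Lser \<xi> s)"
  proof (rule dirichlet_convolution[OF Vser_sums(2,1)[OF xi s] _ Lser_sums(2,1)[OF xi s]])
    fix n :: nat assume n: "n > 0"
    have "(\<Sum>d | d dvd n. \<xi> d * mangoldt d * \<xi> (n div d)) = (\<Sum>d | d dvd n. \<xi> n * mangoldt d)"
      by (rule sum.cong) (auto simp: mult_ac simp flip: dchars_mult[OF xi])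
    also have "\<dots> = \<xi> n * (\<Sum>d | d dvd n. mangoldt d)" by (simp add: sum_distrib_left)
    also have "\<dots> = \<xi> n * of_real (ln (real n))" using n by (simp add: mangoldt_sum)
    finally show "\<xi> n * of_real (ln (real n)) = (\<Sum>d | d dvd n. \<xi> d * mangoldt d * \<xi> (n div d))" by simp
  qed (use chars0[OF xi] in auto)
  ultimately show ?thesis using sums_unique2 by blast
qed

lemma Eser_holomorphic:
  assumes "\<xi> \<in> dchars M" shows "Eser \<xi> holomorphic_on {s. Re s > 0}"
  unfolding Eser_def[abs_def]
  by (rule dterm_series_holomorphic(1)[where B = "2 * real M + 1"]) (use csum_bounded[OF assms] in auto)

lemma Eser_sums:
  assumes "\<xi> \<in> dchars M" "Re s > 0"
  shows "(\<lambda>n. dterm (csum \<xi>) (cmean \<xi>) n s) sums Eser \<xi> s"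
  unfolding Eser_def
  by (rule dterm_series_holomorphic(2)[where B = "2 * real M + 1"]) (use csum_bounded[OF assms(1)] assms(2) in auto)

lemma Lreg_holomorphic:
  assumes "\<xi> \<in> dchars M" shows "Lreg \<xi> holomorphic_on {s. Re s > 0}"
proof (cases "\<xi> = dprincipal M")
  case True
  then show ?thesis unfolding Lreg_def[abs_def]
    by simp (intro holomorphic_intros Eser_holomorphic[OF assms, unfolded True])
next
  case False
  then show ?thesis unfolding Lreg_def[abs_def]
    by simp (intro holomorphic_intros Eser_holomorphic[OF assms])
qed

lemma Lreg_eq_Lser:
  assumes xi: "\<xi> \<in> dchars M" and s: "Re s > 1"
  shows "Lreg \<xi> s = (if \<xi> = dprincipal M then (s - 1) * Lser \<xi> s else Lser \<xi> s)"
proof -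
  have "(\<lambda>n. s * dterm (csum \<xi>) (cmean \<xi>) n s) sums (Lser \<xi> s - cmean \<xi> * s / (s - 1))"
    using chars0[OF xi] Lser_sums[OF xi s] norm_csum_le[OF xi]
    by (intro dterm_sums[OF s, where f = \<xi> and C = 1]) (auto simp: csum_def)
  moreover have "(\<lambda>n. s * dterm (csum \<xi>) (cmean \<xi>) n s) sums (s * Eser \<xi> s)"
    using s by (intro sums_mult Eser_sums xi) auto
  ultimately have "s * Eser \<xi> s = Lser \<xi> s - cmean \<xi> * s / (s - 1)" using sums_unique2 by blast
  moreover have "s \<noteq> 1" using s by auto
  ultimately show ?thesis by (cases "\<xi> = dprincipal M") (simp_all add: Lreg_def right_diff_distrib cmean_def[of \<xi>])
qed

text \<open>The factor s - 1 in the principal case shifts the logarithmic derivative by 1 / (s - 1).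
  The identity is kept free of division by \<open>Lreg\<close>, whose nonvanishing is only proved
  with its help.\<close>

lemma Lreg_deriv:
  assumes xi: "\<xi> \<in> dchars M" and s: "Re s > 1"
  shows "- deriv (Lreg \<xi>) s = Lreg \<xi> s * (Vser \<xi> s - cdelta \<xi> / (s - 1))"
proof -
  have op: "open {s. Re s > 1}" by (rule open_halfspace_Re_gt)
  have s1: "s \<noteq> 1" using s by auto
  have "Lreg \<xi> holomorphic_on {s. Re s > 1}"
    using Lreg_holomorphic[OF xi] by (rule holomorphic_on_subset) auto
  moreover have "Lser \<xi> w = (if \<xi> = dprincipal M then Lreg \<xi> w / (w - 1) else Lreg \<xi> w)"
    if "w \<in> {s. Re s > 1}" for w
  proof -
    have "w \<noteq> 1" using that by auto
    then show ?thesis using Lreg_eq_Lser[OF xi, of w] that by (cases "\<xi> = dprincipal M") auto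
  qed
  ultimately have "Lser \<xi> holomorphic_on {s. Re s > 1}"
    by (subst holomorphic_cong[OF refl, of _ _ "\<lambda>w. if \<xi> = dprincipal M then Lreg \<xi> w / (w - 1) else Lreg \<xi> w"])
       (cases "\<xi> = dprincipal M"; auto intro!: holomorphic_intros)+
  then have d: "(Lser \<xi> has_field_derivative deriv (Lser \<xi>) s) (at s)"
    using holomorphic_derivI[OF _ op] s by simp
  show ?thesis
  proof (cases "\<xi> = dprincipal M")
    case True
    have "((\<lambda>s. (s - 1) * Lser \<xi> s) has_field_derivative (Lser \<xi> s + (s - 1) * deriv (Lser \<xi>) s)) (at s)"
      using d by (auto intro!: derivative_eq_intros)
    then have "(Lreg \<xi> has_field_derivative (Lser \<xi> s + (s - 1) * deriv (Lser \<xi>) s)) (at s)"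
      by (rule has_field_derivative_transform_within_open[OF _ op]) (use s True Lreg_eq_Lser[OF xi] in auto)
    then have "deriv (Lreg \<xi>) s = Lser \<xi> s + (s - 1) * deriv (Lser \<xi>) s" by (rule DERIV_imp_deriv)
    moreover have "deriv (Lser \<xi>) s = - (Vser \<xi> s * Lser \<xi> s)" using Lser_deriv[OF xi s] by (metis minus_minus)
    moreover have "Lreg \<xi> s = (s - 1) * Lser \<xi> s" using Lreg_eq_Lser[OF xi s] True by simp
    moreover have "(s - 1) * Lser \<xi> s * (1 / (s - 1)) = Lser \<xi> s" using s1 by simp
    moreover have "cdelta \<xi> = 1" using True by (simp add: cdelta_def)
    ultimately show ?thesis by (simp only: right_diff_distrib) (simp add: algebra_simps)
  next
    case False
    have "(Lreg \<xi> has_field_derivative deriv (Lser \<xi>) s) (at s)"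
      by (rule has_field_derivative_transform_within_open[OF d op]) (use s False Lreg_eq_Lser[OF xi] in auto)
    then have "deriv (Lreg \<xi>) s = deriv (Lser \<xi>) s" by (rule DERIV_imp_deriv)
    then show ?thesis using Lser_deriv[OF xi s] Lreg_eq_Lser[OF xi s] False
      by (simp add: cdelta_def mult.commute)
  qed
qed

text \<open>A point of nonvanishing ensures that all zeros have finite order. At s = 3 the terms
  with n >= 2 add up to at most 1/2, by comparison with a telescoping series, while the first term
  is 1.\<close>

lemma Lreg_3_nonzero:
  assumes xi: "\<xi> \<in> dchars M" shows "Lreg \<xi> 3 \<noteq> 0"
proof -
  have s: "Re 3 > 1" by simp
  have "(\<lambda>n. \<xi> (n + 2) * npw (n + 2) 3) sums (Lser \<xi> 3 - (\<Sum>n<2. \<xi> n * npw n 3))"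
    using Lser_sums(1)[OF xi s] by (rule sums_split_initial_segment)
  then have L: "(\<lambda>n. \<xi> (n + 2) * npw (n + 2) 3) sums (Lser \<xi> 3 - 1)"
    using chars0[OF xi] dchars_1[OF xi] by (simp add: numeral_2_eq_2)
  define h where "h n = 1 / 2 * (1 / real (n + 1) - 1 / real (Suc n + 1))" for n
  have "(\<lambda>n. 1 / real (n + 1)) \<longlonglongrightarrow> 0" by real_asymp
  from sums_mult[OF telescope_sums'[OF this], of "1 / 2"] have hs: "h sums (1 / 2)"
    by (simp add: h_def[abs_def])
  have le: "norm (\<xi> (n + 2) * npw (n + 2) 3) \<le> h n" for n
  proof -
    have "norm (\<xi> (n + 2) * npw (n + 2) 3) \<le> 1 * real (n + 2) powr (- 3)"
      unfolding norm_mult using norm_dchars_le[OF xi M0, of "n + 2"]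
      by (intro mult_mono) (auto simp: norm_npw)
    also have "\<dots> = 1 / real (n + 2) ^ 3" by (simp add: powr_minus_divide)
    also have "\<dots> \<le> 1 / (2 * (real (n + 1) * real (n + 2)))"
    proof (rule divide_left_mono)
      have "2 * real (n + 1) \<le> real (n + 2) * real (n + 2)" by (simp add: algebra_simps)
      then have "2 * real (n + 1) * real (n + 2) \<le> real (n + 2) * real (n + 2) * real (n + 2)"
        by (rule mult_right_mono) simp
      then show "2 * (real (n + 1) * real (n + 2)) \<le> real (n + 2) ^ 3"
        by (simp add: power3_eq_cube mult.assoc)
    qed simp_all
    also have "\<dots> = h n" by (simp add: h_def field_simps)
    finally show ?thesis .
  qed
  have "norm (Lser \<xi> 3 - 1) \<le> 1 / 2"
    using norm_suminf_le[OF le sums_summable[OF hs]] L hs by (simp add: sums_iff)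
  then have "Lser \<xi> 3 \<noteq> 0" by auto
  then show ?thesis unfolding Lreg_eq_Lser[OF xi s] by (cases "\<xi> = dprincipal M") auto
qed

text \<open>Since \<open>Vser\<close> is -L'/L, eps * V(z + eps) tends to the pole order at z minus
  the order of the zero of \<open>Lreg\<close>.\<close>

lemma Lreg_order:
  assumes xi: "\<xi> \<in> dchars M" and z: "Re z \<ge> 1"
  shows "\<exists>k::nat. (k = 0 \<longleftrightarrow> Lreg \<xi> z \<noteq> 0) \<and>
     ((\<lambda>\<epsilon>. of_real \<epsilon> * Vser \<xi> (z + of_real \<epsilon>)) \<longlongrightarrow> (if z = 1 then cdelta \<xi> else 0) - of_nat k) (at_right 0)"
proof -
  have "connected {s. Re s > 0}" by (intro convex_connected convex_halfspace_Re_gt)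
  note lim = zero_order_log_deriv[OF Lreg_holomorphic[OF xi] open_halfspace_Re_gt this, of z 3]
  have "z \<in> {s. 0 < Re s}" "3 \<in> {s. 0 < Re s}" using z by auto
  from lim[OF this Lreg_3_nonzero[OF xi]]
  obtain k :: nat where k: "k = 0 \<longleftrightarrow> Lreg \<xi> z \<noteq> 0" "\<forall>\<^sub>F \<epsilon> in at_right 0. Lreg \<xi> (z + of_real \<epsilon>) \<noteq> 0"
     "((\<lambda>\<epsilon>. of_real \<epsilon> * deriv (Lreg \<xi>) (z + of_real \<epsilon>) / Lreg \<xi> (z + of_real \<epsilon>)) \<longlongrightarrow> of_nat k) (at_right 0)"
    by (elim exE conjE)
  have pole: "((\<lambda>\<epsilon>. of_real \<epsilon> * (cdelta \<xi> / (z + of_real \<epsilon> - 1))) \<longlongrightarrow> (if z = 1 then cdelta \<xi> else 0)) (at_right 0)"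
  proof (cases "z = 1")
    case True
    have "\<forall>\<^sub>F \<epsilon> in at_right 0. cdelta \<xi> = of_real \<epsilon> * (cdelta \<xi> / (z + of_real \<epsilon> - 1))"
      using eventually_at_right_less[of 0] by eventually_elim (simp add: True)
    from Lim_transform_eventually[OF tendsto_const this] show ?thesis using True by simp
  next
    case False
    have "((\<lambda>\<epsilon>. of_real \<epsilon> * (cdelta \<xi> / (z + of_real \<epsilon> - 1))) \<longlongrightarrow> of_real 0 * (cdelta \<xi> / (z + of_real 0 - 1))) (at_right 0)"
      by (intro tendsto_intros) (use False in auto)
    then show ?thesis using False by simp
  qed
  have "((\<lambda>\<epsilon>. of_real \<epsilon> * (cdelta \<xi> / (z + of_real \<epsilon> - 1)) - of_real \<epsilon> * deriv (Lreg \<xi>) (z + of_real \<epsilon>) / Lreg \<xi> (z + of_real \<epsilon>))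
     \<longlongrightarrow> (if z = 1 then cdelta \<xi> else 0) - of_nat k) (at_right 0)"
    by (intro tendsto_diff pole k)
  moreover have "\<forall>\<^sub>F \<epsilon> in at_right 0. of_real \<epsilon> * (cdelta \<xi> / (z + of_real \<epsilon> - 1)) -
      of_real \<epsilon> * deriv (Lreg \<xi>) (z + of_real \<epsilon>) / Lreg \<xi> (z + of_real \<epsilon>) = of_real \<epsilon> * Vser \<xi> (z + of_real \<epsilon>)"
    using k(2) eventually_at_right_less[of 0]
  proof eventually_elim
    case (elim \<epsilon>)
    have "- deriv (Lreg \<xi>) (z + of_real \<epsilon>) = Lreg \<xi> (z + of_real \<epsilon>) * (Vser \<xi> (z + of_real \<epsilon>) - cdelta \<xi> / (z + of_real \<epsilon> - 1))"
      using elim z by (intro Lreg_deriv[OF xi]) auto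
    then have d: "deriv (Lreg \<xi>) (z + of_real \<epsilon>) = - (Lreg \<xi> (z + of_real \<epsilon>) * (Vser \<xi> (z + of_real \<epsilon>) - cdelta \<xi> / (z + of_real \<epsilon> - 1)))"
      by (metis minus_minus)
    have "of_real \<epsilon> * deriv (Lreg \<xi>) (z + of_real \<epsilon>) / Lreg \<xi> (z + of_real \<epsilon>) =
       - (of_real \<epsilon> * (Vser \<xi> (z + of_real \<epsilon>) - cdelta \<xi> / (z + of_real \<epsilon> - 1)))"
    proof -
      have "a * (- (l * x)) / l = - (a * x)" if "l \<noteq> 0" for a l x :: complex using that by simp
      from this[OF elim(1)] show ?thesis unfolding d .
    qed
    then show ?case by (simp add: algebra_simps)
  qed
  ultimately have "((\<lambda>\<epsilon>. of_real \<epsilon> * Vser \<xi> (z + of_real \<epsilon>)) \<longlongrightarrow> (if z = 1 then cdelta \<xi> else 0) - of_nat k) (at_right 0)"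
    by (rule Lim_transform_eventually)
  with k(1) show ?thesis by (intro exI[of _ k] conjI)
qed

text \<open>\<open>Vser\<close> stays bounded along z + eps by absolute convergence at Re z, so eps
  * V tends to 0 and the zero order must be 0.\<close>

lemma Lreg_nonzero_Re_gt_1:
  assumes xi: "\<xi> \<in> dchars M" and z: "Re z > 1"
  shows "Lreg \<xi> z \<noteq> 0"
proof -
  from z have "Re z \<ge> 1" by simp
  from Lreg_order[OF xi this] obtain k :: nat where k: "k = 0 \<longleftrightarrow> Lreg \<xi> z \<noteq> 0"
    "((\<lambda>\<epsilon>. of_real \<epsilon> * Vser \<xi> (z + of_real \<epsilon>)) \<longlongrightarrow> (if z = 1 then cdelta \<xi> else 0) - of_nat k) (at_right 0)"
    by (elim exE conjE)
  have z1: "z \<noteq> 1" using z by auto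
  define K where "K = (\<Sum>n. (1 + ln (real n)) ^ 1 * real n powr (- Re z))"
  have VK: "norm (Vser \<xi> (z + of_real \<epsilon>)) \<le> K" if "\<epsilon> > 0" for \<epsilon>
    unfolding Vser_def K_def
    by (rule norm_suminf_le[OF dirichlet_summable(1)[OF norm_dchars_ln(2)[OF xi]] summable_ln_powr[OF z]])
       (use that z in auto)
  have "((\<lambda>\<epsilon>. of_real \<epsilon> * Vser \<xi> (z + of_real \<epsilon>)) \<longlongrightarrow> 0) (at_right 0)"
  proof (rule Lim_null_comparison)
    show "((\<lambda>\<epsilon>::real. \<epsilon> * K) \<longlongrightarrow> 0) (at_right 0)"
      by (rule tendsto_eq_intros refl | simp)+
    show "\<forall>\<^sub>F \<epsilon> in at_right 0. norm (of_real \<epsilon> * Vser \<xi> (z + of_real \<epsilon>)) \<le> \<epsilon> * K"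
      using eventually_at_right_less[of 0]
      by eventually_elim (auto simp: norm_mult intro!: mult_left_mono VK)
  qed
  then have "- of_nat k = (0::complex)"
    using tendsto_unique[OF _ k(2)] z1 by force
  then show ?thesis using k(1) by simp
qed

text \<open>The n-th terms combine to a nonnegative multiple of 3 + 4 Re v + Re (v^2), where v is
  \<open>\<xi> n\<close> times n^(-it) and has modulus 1.\<close>

lemma three_four_one:
  assumes xi: "\<xi> \<in> dchars M" and e: "\<epsilon> > 0"
  shows "Re (3 * Vser (dprincipal M) (1 + of_real \<epsilon>) + 4 * Vser \<xi> (1 + \<i> * of_real t + of_real \<epsilon>) +
     Vser (\<lambda>n. \<xi> n * \<xi> n) (1 + \<i> * of_real (2 * t) + of_real \<epsilon>)) \<ge> 0"
proof -
  let ?s = "1 + of_real \<epsilon> :: complex"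
  define T where "T n = 3 * (dprincipal M n * mangoldt n * npw n ?s) + 4 * (\<xi> n * mangoldt n * npw n (1 + \<i> * of_real t + of_real \<epsilon>)) +
     (\<xi> n * \<xi> n) * mangoldt n * npw n (1 + \<i> * of_real (2 * t) + of_real \<epsilon>)" for n
  have "T sums (3 * Vser (dprincipal M) ?s + 4 * Vser \<xi> (1 + \<i> * of_real t + of_real \<epsilon>) +
     Vser (\<lambda>n. \<xi> n * \<xi> n) (1 + \<i> * of_real (2 * t) + of_real \<epsilon>))"
    unfolding T_def using e xi
    by (intro sums_add sums_mult Vser_sums dprincipal_dchars M0 dchars_times) auto
  then have "(\<lambda>n. Re (T n)) sums Re (3 * Vser (dprincipal M) ?s + 4 * Vser \<xi> (1 + \<i> * of_real t + of_real \<epsilon>) +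
     Vser (\<lambda>n. \<xi> n * \<xi> n) (1 + \<i> * of_real (2 * t) + of_real \<epsilon>))"
    by (rule sums_Re)
  moreover have "Re (T n) \<ge> 0" for n
  proof (cases "coprime n M \<and> n > 0")
    case False
    then have "\<xi> n = 0" "dprincipal M n = 0"
      using dchars_zero_iff[OF xi, of n] M by (auto simp: dprincipal_def)
    then have "T n = 0" by (simp add: T_def)
    then show ?thesis by simp
  next
    case True
    define v where "v = \<xi> n * npw n (\<i> * of_real t)"
    have v: "norm v = 1" using norm_dchars[OF xi M0, of n] True by (simp add: v_def norm_mult norm_npw)
    have p1: "npw n (1 + \<i> * of_real t + of_real \<epsilon>) = npw n ?s * npw n (\<i> * of_real t)"
      by (simp add: add_ac flip: npw_add)
    have p2: "npw n (1 + \<i> * of_real (2 * t) + of_real \<epsilon>) = npw n ?s * npw n (\<i> * of_real t) ^ 2"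
      by (simp add: add_ac power2_eq_square algebra_simps flip: npw_add)
    have ps: "npw n ?s = of_real (real n powr (- (1 + \<epsilon>)))"
      using npw_of_real[of n "1 + \<epsilon>"] True by simp
    have md: "mangoldt n = (of_real (mangoldt n) :: complex)" by simp
    have "T n = of_real (mangoldt n * real n powr (- (1 + \<epsilon>))) * (3 + 4 * v + v ^ 2)"
      unfolding T_def p1 p2 ps v_def using True md
      by (simp add: dprincipal_def power2_eq_square algebra_simps)
    then have "Re (T n) = mangoldt n * real n powr (- (1 + \<epsilon>)) * (3 + 4 * Re v + Re (v ^ 2))"
      by (simp only: Re_complex_of_real Im_complex_of_real times_complex.sel) simp
    then show ?thesis using three_four_one_real[OF v] mangoldt_nonneg[of n] by simp
  qed
  ultimately show ?thesis using sums_le[of "\<lambda>_. 0" "\<lambda>n. Re (T n)" 0] sums_zero by blast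
qed

text \<open>The hypothesis excludes a pole at 1 + it for the character and at 1 + 2it for its
  square. The limits then give 3 (1 - k0) - 4 k - k2 >= 0, so 4 k <= 3 and k = 0.\<close>

lemma Lreg_nonzero_line:
  assumes xi: "\<xi> \<in> dchars M" and t: "t \<noteq> 0 \<or> (\<lambda>n. \<xi> n * \<xi> n) \<noteq> dprincipal M"
  shows "Lreg \<xi> (1 + \<i> * of_real t) \<noteq> 0"
proof -
  have re: "Re 1 \<ge> 1" "Re (1 + \<i> * of_real t) \<ge> 1" "Re (1 + \<i> * of_real (2 * t)) \<ge> 1" by auto
  from Lreg_order[OF dprincipal_dchars[OF M0] re(1)] obtain k0 :: nat where k0':
    "((\<lambda>\<epsilon>. of_real \<epsilon> * Vser (dprincipal M) (1 + of_real \<epsilon>)) \<longlongrightarrow>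
       (if 1 = (1::complex) then cdelta (dprincipal M) else 0) - of_nat k0) (at_right 0)"
    by (elim exE conjE)
  have k0: "((\<lambda>\<epsilon>. of_real \<epsilon> * Vser (dprincipal M) (1 + of_real \<epsilon>)) \<longlongrightarrow> 1 - of_nat k0) (at_right 0)"
    using k0' by (simp add: cdelta_def)
  from Lreg_order[OF xi re(2)] obtain k :: nat where k: "k = 0 \<longleftrightarrow> Lreg \<xi> (1 + \<i> * of_real t) \<noteq> 0"
    "((\<lambda>\<epsilon>. of_real \<epsilon> * Vser \<xi> (1 + \<i> * of_real t + of_real \<epsilon>)) \<longlongrightarrow> (if 1 + \<i> * of_real t = 1 then cdelta \<xi> else 0) - of_nat k) (at_right 0)"
    by (elim exE conjE)
  from Lreg_order[OF dchars_times[OF xi xi] re(3)] obtain k2 :: nat where k2: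
    "((\<lambda>\<epsilon>. of_real \<epsilon> * Vser (\<lambda>n. \<xi> n * \<xi> n) (1 + \<i> * of_real (2 * t) + of_real \<epsilon>)) \<longlongrightarrow>
      (if 1 + \<i> * of_real (2 * t) = 1 then cdelta (\<lambda>n. \<xi> n * \<xi> n) else 0) - of_nat k2) (at_right 0)"
    by (elim exE conjE)
  have c2: "(if 1 + \<i> * of_real (2 * t) = 1 then cdelta (\<lambda>n. \<xi> n * \<xi> n) else 0) = 0"
    using t by (auto simp: cdelta_def)
  have c1: "Re (if 1 + \<i> * of_real t = 1 then cdelta \<xi> else 0) = 0"
  proof -
    have "(\<lambda>n. \<xi> n * \<xi> n) = dprincipal M" if "\<xi> = dprincipal M"
      using that by (auto simp: dprincipal_def)
    then show ?thesis using t by (auto simp: cdelta_def)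
  qed
  have "((\<lambda>\<epsilon>. Re (3 * (of_real \<epsilon> * Vser (dprincipal M) (1 + of_real \<epsilon>)) + 4 * (of_real \<epsilon> * Vser \<xi> (1 + \<i> * of_real t + of_real \<epsilon>)) +
     of_real \<epsilon> * Vser (\<lambda>n. \<xi> n * \<xi> n) (1 + \<i> * of_real (2 * t) + of_real \<epsilon>))) \<longlongrightarrow>
     Re (3 * (1 - of_nat k0) + 4 * ((if 1 + \<i> * of_real t = 1 then cdelta \<xi> else 0) - of_nat k) + (0 - of_nat k2))) (at_right 0)"
    using k2 unfolding c2 by (intro tendsto_intros k0 k(2))
  moreover have "\<forall>\<^sub>F \<epsilon> in at_right 0. Re (3 * (of_real \<epsilon> * Vser (dprincipal M) (1 + of_real \<epsilon>)) + 4 * (of_real \<epsilon> * Vser \<xi> (1 + \<i> * of_real t + of_real \<epsilon>)) +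
     of_real \<epsilon> * Vser (\<lambda>n. \<xi> n * \<xi> n) (1 + \<i> * of_real (2 * t) + of_real \<epsilon>)) \<ge> 0"
    using eventually_at_right_less[of 0]
  proof eventually_elim
    case (elim \<epsilon>)
    have "Re (of_real \<epsilon> * (3 * Vser (dprincipal M) (1 + of_real \<epsilon>) + 4 * Vser \<xi> (1 + \<i> * of_real t + of_real \<epsilon>) +
     Vser (\<lambda>n. \<xi> n * \<xi> n) (1 + \<i> * of_real (2 * t) + of_real \<epsilon>))) \<ge> 0"
      using three_four_one[OF xi elim, of t] elim by (simp only: Re_complex_of_real Im_complex_of_real times_complex.sel) simp
    then show ?case by (simp only: algebra_simps)
  qed
  ultimately have "Re (3 * (1 - of_nat k0) + 4 * ((if 1 + \<i> * of_real t = 1 then cdelta \<xi> else 0) - of_nat k) + (0 - of_nat k2)) \<ge> 0"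
    by (rule tendsto_lowerbound) simp
  then have "3 * (1 - real k0) - 4 * real k - real k2 \<ge> 0"
    using c1 by (simp add: algebra_simps)
  then have "4 * real k \<le> 3" by (simp add: algebra_simps)
  then have "k = 0" by simp
  then show ?thesis using k(1) by simp
qed

end

section \<open>Nonvanishing on the line of absolute convergence\<close>

lemma gcd_mult_coprime_divisors:
  fixes a b x y :: nat
  assumes "coprime a b" "x dvd a" "y dvd b"
  shows "gcd (x * y) a = x"
proof -
  have "coprime a y" using assms(1,3) by (meson coprime_commute coprime_divisors dvd_refl)
  then have "gcd a (x * y) = gcd a x" by (rule gcd_mult_right_right_cancel)
  then show ?thesis using assms(2) by (simp add: gcd.commute gcd_proj2_if_dvd_nat)
qed

lemma divisor_sum_coprime_mult:
  fixes c :: "nat \<Rightarrow> real"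
  assumes c: "\<And>m n. c (m * n) = c m * c n" and ab: "coprime a b"
  shows "(\<Sum>d | d dvd a * b. c d) = (\<Sum>d | d dvd a. c d) * (\<Sum>d | d dvd b. c d)"
proof -
  let ?P = "{d. d dvd a} \<times> {d. d dvd b}"
  have inj: "inj_on (\<lambda>(x, y). x * y) ?P"
  proof (intro inj_onI, clarsimp)
    fix x y x' y' assume *: "x dvd a" "y dvd b" "x' dvd a" "y' dvd b" "x * y = x' * y'"
    have "x = x'" using gcd_mult_coprime_divisors[OF ab *(1,2)] gcd_mult_coprime_divisors[OF ab *(3,4)] *(5) by simp
    moreover have "y = y'"
      using gcd_mult_coprime_divisors[OF ab[THEN coprime_commute[THEN iffD1]] *(2,1)]
        gcd_mult_coprime_divisors[OF ab[THEN coprime_commute[THEN iffD1]] *(4,3)] *(5) by (simp add: mult.commute)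
    ultimately show "x = x' \<and> y = y'" by simp
  qed
  have img: "(\<lambda>(x, y). x * y) ` ?P = {d. d dvd a * b}"
    by (auto simp: image_iff intro: mult_dvd_mono dest!: division_decomp)
  have "(\<Sum>d | d dvd a. c d) * (\<Sum>d | d dvd b. c d) = (\<Sum>p\<in>?P. c (fst p) * c (snd p))"
    by (simp add: sum_product sum.cartesian_product case_prod_unfold)
  also have "\<dots> = (\<Sum>p\<in>?P. c ((\<lambda>(x, y). x * y) p))" by (intro sum.cong) (auto simp: c)
  also have "\<dots> = (\<Sum>d\<in>(\<lambda>(x, y). x * y) ` ?P. c d)" by (simp only: sum.reindex[OF inj] o_def)
  finally show ?thesis unfolding img by simp
qed

lemma prime_power_split:
  fixes n :: nat assumes "n > 1"
  obtains p k m where "prime p" "k > 0" "n = p ^ k * m" "\<not> p dvd m" "m < n" "m > 0"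
proof -
  obtain p where p: "prime p" "p dvd n" using assms prime_factor_nat[of n] by auto
  define k where "k = multiplicity p n"
  have n0: "n \<noteq> 0" and pu: "\<not> is_unit p" using assms p by auto
  obtain m where m: "n = p ^ k * m" "\<not> p dvd m"
    using multiplicity_decompose'[OF n0 pu] unfolding k_def by metis
  have k: "k > 0" unfolding k_def using p n0 pu by (simp add: multiplicity_gt_zero_iff)
  have m0: "m > 0" using m(2) by (auto intro!: Nat.gr0I)
  have "1 < p ^ k" by (rule one_less_power[OF prime_gt_1_nat[OF p(1)] k])
  then have "m < n" using m(1) m0 by simp
  then show ?thesis using that p k m m0 by blast
qed

text \<open>Pair the i-th term with the (n-1-i)-th and apply the inequality of arithmetic and
  geometric means; the base u^2 makes the geometric mean u^(n-1) a plain power.\<close>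

lemma geometric_sum_am_gm:
  fixes u :: real assumes "u \<ge> 0"
  shows "(\<Sum>i<n. (u ^ 2) ^ i) \<ge> real n * u ^ (n - 1)"
proof -
  have "2 * (\<Sum>i<n. (u ^ 2) ^ i) = (\<Sum>i<n. (u ^ 2) ^ i) + (\<Sum>i<n. (u ^ 2) ^ (n - Suc i))"
    by (simp add: sum.nat_diff_reindex[of "\<lambda>i. (u ^ 2) ^ i" n])
  also have "\<dots> = (\<Sum>i<n. (u ^ i) ^ 2 + (u ^ (n - Suc i)) ^ 2)"
    by (simp add: sum.distrib power_mult[symmetric] mult.commute)
  also have "\<dots> \<ge> (\<Sum>i<n. 2 * u ^ (n - 1))"
  proof (rule sum_mono)
    fix i assume "i \<in> {..<n}"
    then have e: "u ^ (n - 1) = u ^ i * u ^ (n - Suc i)" by (simp flip: power_add)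
    show "2 * u ^ (n - 1) \<le> (u ^ i) ^ 2 + (u ^ (n - Suc i)) ^ 2"
      unfolding e using sum_squares_bound[of "u ^ i" "u ^ (n - Suc i)"] by (simp add: mult.assoc)
  qed
  finally show ?thesis by simp
qed

text \<open>With g(n) = 1 + t + ... + t^(n-1), (1 - t) b(n) = 1/n - t^n / g(n). Monotonicity amounts
  to n (n+1) t^n <= g(n) g(n+1), which follows from the lower bound for geometric sums with u = sqrt
  t.\<close>

lemma lambert_weights_antimono:
  fixes t :: real assumes t: "0 < t" "t < 1" and n: "n \<ge> 1"
  defines "b \<equiv> \<lambda>n. 1 / (real n * (1 - t)) - t ^ n / (1 - t ^ n)"
  shows "b (Suc n) \<le> b n" "b n \<ge> 0"
proof -
  define g where "g n = (\<Sum>i<n. t ^ i)" for n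
  have g1: "1 - t ^ k = (1 - t) * g k" for k unfolding g_def by (simp add: one_diff_power_eq)
  have gpos: "g k > 0" if "k \<ge> 1" for k
  proof -
    have "0 \<in> {..<k}" using that by simp
    then have "{..<k} \<noteq> {}" by blast
    then show ?thesis unfolding g_def using t by (intro sum_pos) auto
  qed
  have b: "b k = (1 / real k - t ^ k / g k) / (1 - t)" for k
    unfolding b_def g1 using t by (simp add: diff_divide_distrib mult.commute)
  have "real n * t ^ n \<le> g n"
  proof -
    have "(\<Sum>i<n. t ^ n) \<le> g n" unfolding g_def using t by (intro sum_mono power_decreasing) auto
    then show ?thesis by simp
  qed
  then have "t ^ n / g n \<le> 1 / real n" using gpos[OF n] n by (simp add: field_simps)
  then show "b n \<ge> 0" unfolding b using t by simp
  define u where "u = sqrt t"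
  have u: "0 \<le> u" "u \<le> 1" "u ^ 2 = t" using t by (auto simp: u_def)
  have ga: "g n \<ge> real n * u ^ (n - 1)" "g (Suc n) \<ge> real (Suc n) * u ^ n"
    unfolding g_def using geometric_sum_am_gm[OF u(1), of n] geometric_sum_am_gm[OF u(1), of "Suc n"] u(3) by auto
  have "t ^ n = u ^ (2 * n)" using u(3) by (simp add: power_mult)
  also have "\<dots> \<le> u ^ (n - 1 + n)" using u by (intro power_decreasing) auto
  finally have "real n * real (Suc n) * t ^ n \<le> real n * real (Suc n) * (u ^ (n - 1) * u ^ n)"
    by (intro mult_left_mono) (auto simp: power_add)
  also have "\<dots> = (real n * u ^ (n - 1)) * (real (Suc n) * u ^ n)" by simp
  also have "\<dots> \<le> g n * g (Suc n)" using ga u gpos[OF n] by (intro mult_mono) auto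
  finally have key: "real n * real (Suc n) * t ^ n \<le> g n * g (Suc n)" .
  have gS: "g (Suc n) = 1 + t * g n"
    unfolding g_def by (subst sum.lessThan_Suc_shift) (simp add: sum_distrib_left)
  have "t ^ n / g n - t ^ Suc n / g (Suc n) = t ^ n * (g (Suc n) - t * g n) / (g n * g (Suc n))"
    using gpos[of n] gpos[of "Suc n"] n by (simp add: field_simps)
  also have "\<dots> = t ^ n / (g n * g (Suc n))" by (simp add: gS)
  also have "\<dots> \<le> 1 / (real n * real (Suc n))"
    using key gpos[of n] gpos[of "Suc n"] n by (simp add: field_simps del: of_nat_Suc)
  also have "\<dots> = 1 / real n - 1 / real (Suc n)" using n by (simp add: field_simps)
  finally have "1 / real (Suc n) - t ^ Suc n / g (Suc n) \<le> 1 / real n - t ^ n / g n" by simp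
  then show "b (Suc n) \<le> b n" unfolding b using t by (intro divide_right_mono) auto
qed

locale real_multiplicative =
  fixes c :: "nat \<Rightarrow> real"
  assumes c0: "c 0 = 0" and c1: "c 1 = 1" and cm: "\<And>m n. c (m * n) = c m * c n"
    and cv: "\<And>n. c n \<in> {-1, 0, 1}"
begin

text \<open>The convolution of \<open>c\<close> with 1: for a real character, the coefficients of
  zeta(s) L(s).\<close>

definition r :: "nat \<Rightarrow> real" where "r n = (\<Sum>d | d dvd n. c d)"

lemma c_power: "c (p ^ k) = c p ^ k"
  using c1 by (induction k) (auto simp: cm)

text \<open>A geometric sum in \<open>c p\<close>; for the value -1 it alternates between 1 and 0,
  which is why even exponents are singled out.\<close>

lemma r_prime_power:
  assumes "prime p" shows "r (p ^ k) \<ge> 0 \<and> (even k \<longrightarrow> r (p ^ k) \<ge> 1)"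
proof -
  have img: "{d. d dvd p ^ k} = (\<lambda>i. p ^ i) ` {..k}"
    using divides_primepow_nat[OF assms] by auto
  have "inj_on (\<lambda>i. p ^ i) {..k}"
    using prime_gt_1_nat[OF assms] by (auto intro!: inj_onI simp: power_inject_exp)
  then have r: "r (p ^ k) = (\<Sum>i\<le>k. c p ^ i)"
    unfolding r_def img by (simp add: sum.reindex c_power)
  show ?thesis
  proof -
    consider "c p = 0" | "c p = 1" | "c p = -1" using cv[of p] by auto
    then show ?thesis
    proof cases
      case 1 then show ?thesis unfolding r by (induction k) (auto simp: power_0_left)
    next
      case 2 then show ?thesis unfolding r by simp
    next
      case 3
      have "(\<Sum>i\<le>k. (-1::real) ^ i) = (if even k then 1 else 0)" by (induction k) auto
      then show ?thesis unfolding r 3 by auto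
    qed
  qed
qed

lemma r_coprime: "coprime a b \<Longrightarrow> r (a * b) = r a * r b"
  unfolding r_def by (rule divisor_sum_coprime_mult[OF cm])

lemma r_1: "r (Suc 0) = 1" using c1 by (simp add: r_def)

lemma r_nonneg: "n > 0 \<Longrightarrow> r n \<ge> 0"
proof (induction n rule: less_induct)
  case (less n)
  show ?case
  proof (cases "n = 1")
    case False
    then obtain p k m where pk: "prime p" "k > 0" "n = p ^ k * m" "\<not> p dvd m" "m < n" "m > 0"
      using prime_power_split[of n] less.prems by auto
    have "coprime (p ^ k) m" using pk by (simp add: prime_imp_coprime)
    then show ?thesis using r_coprime r_prime_power[OF pk(1), of k] less.IH[OF pk(5,6)] pk(3) by simp
  qed (simp add: r_1)
qed

lemma r_square: "n > 0 \<Longrightarrow> r (n ^ 2) \<ge> 1"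
proof (induction n rule: less_induct)
  case (less n)
  show ?case
  proof (cases "n = 1")
    case False
    then obtain p k m where pk: "prime p" "k > 0" "n = p ^ k * m" "\<not> p dvd m" "m < n" "m > 0"
      using prime_power_split[of n] less.prems by auto
    have "coprime (p ^ (k * 2)) (m ^ 2)" using pk by (simp add: prime_imp_coprime)
    moreover have "n ^ 2 = p ^ (k * 2) * m ^ 2" using pk(3) by (simp add: power_mult_distrib power_mult)
    ultimately have "r (n ^ 2) = r (p ^ (k * 2)) * r (m ^ 2)" using r_coprime by simp
    moreover have "r (p ^ (k * 2)) \<ge> 1" using r_prime_power[OF pk(1), of "k * 2"] by simp
    ultimately show ?thesis using less.IH[OF pk(5,6)] mult_mono[of 1 "r (p ^ (k * 2))" 1 "r (m ^ 2)"] by simp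
  qed (simp add: r_1)
qed

text \<open>Expand t^d / (1 - t^d) as the sum of t^(d e) over e >= 1 and regroup the pairs by n = d
  e.\<close>

lemma lambert_series:
  fixes t :: real assumes t: "0 < t" "t < 1"
  obtains F where "(\<lambda>d. c d * (t ^ d / (1 - t ^ d))) sums F" "((\<lambda>n. r n * t ^ n) has_sum F) {1..}"
proof -
  define b where "b d = c d * (t ^ d / (1 - t ^ d))" for d
  have td: "t ^ d < 1" if "d \<ge> 1" for d using that t by (simp add: power_less_one_iff)
  have cb: "\<bar>c d\<bar> \<le> 1" for d using cv[of d] by auto
  have babs: "\<bar>b d\<bar> \<le> t ^ d / (1 - t)" for d
  proof (cases "d = 0")
    case False
    have "t ^ d \<le> t ^ 1" using False t by (intro power_decreasing) auto
    then have "t ^ d / (1 - t ^ d) \<le> t ^ d / (1 - t)" using t td[of d] False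
      by (intro divide_left_mono) auto
    moreover have "\<bar>b d\<bar> \<le> 1 * (t ^ d / (1 - t ^ d))"
      unfolding b_def abs_mult using cb[of d] td[of d] False t by (intro mult_mono) auto
    ultimately show ?thesis by simp
  qed (use t c0 in \<open>simp add: b_def\<close>)
  have sumb: "summable (\<lambda>d. \<bar>b d\<bar>)"
  proof (rule summable_comparison_test')
    show "summable (\<lambda>d. t ^ d / (1 - t))" using t by (intro summable_divide summable_geometric) auto
  qed (use babs in auto)
  define F where "F = suminf b"
  have bF: "b sums F" unfolding F_def using sumb by (intro summable_sums) (rule summable_rabs_cancel)
  have bU: "(b has_sum F) UNIV" using norm_summable_imp_has_sum[OF _ bF] sumb by simp
  have bA: "(b has_sum F) {1..}"
    using bU has_sum_cong_neutral[of UNIV "{1..}" b b F] c0 by (auto simp: b_def not_le less_Suc0)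
  define P where "P p = c (fst p) * t ^ (fst p * snd p)" for p :: "nat \<times> nat"
  have inner: "((\<lambda>e. c d * t ^ (d * e)) has_sum b d) {1..}" if "d \<in> {1..}" for d
    unfolding b_def power_mult using td[of d] that t
    by (intro has_sum_cmult_right has_sum_geometric_from_1) auto
  have inner_abs: "((\<lambda>e. \<bar>c d\<bar> * t ^ (d * e)) has_sum \<bar>b d\<bar>) {1..}" if "d \<in> {1..}" for d
  proof -
    have "\<bar>b d\<bar> = \<bar>c d\<bar> * (t ^ d / (1 - t ^ d))"
      unfolding b_def abs_mult using td[of d] that t by simp
    then show ?thesis unfolding power_mult using td[of d] that t
      by (simp only:) (intro has_sum_cmult_right has_sum_geometric_from_1, auto)
  qed
  have "(\<lambda>p. norm (P p)) summable_on (SIGMA d:{1..}. {1..})"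
  proof (rule summable_on_SigmaI)
    show "((\<lambda>e. norm (P (d, e))) has_sum \<bar>b d\<bar>) {1..}" if "d \<in> {1..}" for d
      using inner_abs[OF that] t by (simp add: P_def abs_mult)
    have "(\<lambda>d. \<bar>b d\<bar>) summable_on UNIV" using sumb by (subst summable_on_UNIV_nonneg_real_iff) auto
    then show "(\<lambda>d. \<bar>b d\<bar>) summable_on {1..}" by (rule summable_on_subset_banach) auto
  qed auto
  then have Psum: "P summable_on (SIGMA d:{1..}. {1..})" by (rule abs_summable_summable)
  have "(P has_sum F) (SIGMA d:{1..}. {1..})"
    by (rule has_sum_SigmaI[OF _ bA Psum]) (use inner in \<open>simp add: P_def\<close>)
  also have "?this \<longleftrightarrow> ((\<lambda>(n, d). c d * t ^ n) has_sum F) (SIGMA n:{1..}. {d. d dvd n})"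
    by (rule has_sum_reindex_bij_witness[where j = "\<lambda>(d, e). (d * e, d)" and i = "\<lambda>(n, d). (d, n div d)"])
       (auto simp: P_def Suc_le_eq elim: dvdE intro!: Nat.gr0I)
  finally have "((\<lambda>n. \<Sum>d | d dvd n. c d * t ^ n) has_sum F) {1..}"
    by (rule has_sum_SigmaD) (auto intro!: has_sum_finite)
  then have "((\<lambda>n. r n * t ^ n) has_sum F) {1..}"
    by (simp add: r_def sum_distrib_right)
  then show ?thesis using that bF by (simp add: b_def[abs_def])
qed

text \<open>Monsky's argument: with \<open>t \<rightarrow> 1\<close> the Lambert series \<open>\<Sum> c(n) t^n / (1 - t^n) = \<Sum> r(n) t^n\<close> is
  unbounded because \<open>r(n\<^sup>2) \<ge> 1\<close>, whereas comparing its weights with \<open>1 / (n (1 - t))\<close> bounds it if \<open>\<Sum> c(n) / n = 0\<close>.\<close>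

lemma monsky:
  assumes B: "\<And>n. \<bar>\<Sum>k\<le>n. c k\<bar> \<le> B" and s0: "(\<lambda>n. c n / real n) sums 0"
  shows False
proof -
  \<comment> \<open>The left side is a lower bound for the contribution of the squares 1, 4, ...,
    K^2 to the Lambert series.\<close>
  have bound: "real K * t ^ (K ^ 2) \<le> B" if t: "0 < t" "t < 1" for t K
  proof -
    define b where "b = (\<lambda>n. 1 / (real n * (1 - t)) - t ^ n / (1 - t ^ n))"
    define X where "X n = (\<Sum>k\<le>n. c k)" for n
    obtain F where F: "(\<lambda>d. c d * (t ^ d / (1 - t ^ d))) sums F" "((\<lambda>n. r n * t ^ n) has_sum F) {1..}"
      using lambert_series[OF t] by blast
    have B0: "B \<ge> 0" using B[of 0] by linarith
    have bd: "b (Suc n) \<le> b n" "b n \<ge> 0" if "n \<ge> 1" for n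
      using lambert_weights_antimono[OF t that] by (simp_all add: b_def)
    \<comment> \<open>Summation by parts against the decreasing weights \<open>b\<close>; as b(1) =
      1, the weighted sums of \<open>c\<close> are bounded by \<open>B\<close> independently of
      t.\<close>
    have abel: "\<bar>(\<Sum>n\<le>N. c n * b n) - X N * b (Suc N)\<bar> \<le> B * (b 1 - b (Suc N))" for N
    proof (induction N)
      case 0 then show ?case using c0 by (simp add: X_def)
    next
      case (Suc N)
      have "(\<Sum>n\<le>Suc N. c n * b n) - X (Suc N) * b (Suc (Suc N)) =
        ((\<Sum>n\<le>N. c n * b n) - X N * b (Suc N)) + X (Suc N) * (b (Suc N) - b (Suc (Suc N)))"
        by (simp add: X_def algebra_simps)
      then have "\<bar>(\<Sum>n\<le>Suc N. c n * b n) - X (Suc N) * b (Suc (Suc N))\<bar> \<le>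
         B * (b 1 - b (Suc N)) + \<bar>X (Suc N) * (b (Suc N) - b (Suc (Suc N)))\<bar>"
        using Suc.IH by linarith
      also have "\<bar>X (Suc N) * (b (Suc N) - b (Suc (Suc N)))\<bar> \<le> B * (b (Suc N) - b (Suc (Suc N)))"
        unfolding abs_mult using B[of "Suc N"] bd(1)[of "Suc N"] B0 by (intro mult_mono) (auto simp: X_def)
      finally show ?case by (simp add: algebra_simps)
    qed
    have S: "\<bar>\<Sum>n\<le>N. c n * b n\<bar> \<le> B" for N
    proof -
      have "\<bar>X N * b (Suc N)\<bar> \<le> B * b (Suc N)"
        unfolding abs_mult using B[of N] bd(2)[of "Suc N"] B0 by (intro mult_mono) (auto simp: X_def)
      moreover have "b 1 = 1" using t by (simp add: b_def field_simps)
      ultimately show ?thesis using abel[of N] by (simp add: algebra_simps)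
    qed
    \<comment> \<open>Because the sum of c(n)/n is 0, replacing the Lambert weights by
      \<open>b\<close> only changes the sign of the value \<open>F\<close>.\<close>
    have "(\<lambda>n. c n / real n * (1 / (1 - t)) - c n * (t ^ n / (1 - t ^ n))) sums (0 * (1 / (1 - t)) - F)"
      by (intro sums_diff sums_mult2 s0 F)
    then have "(\<lambda>n. c n * b n) sums (- F)" by (simp add: b_def right_diff_distrib)
    then have "(\<lambda>N. \<bar>\<Sum>n\<le>N. c n * b n\<bar>) \<longlonglongrightarrow> \<bar>- F\<bar>"
      unfolding sums_def_le by (rule tendsto_rabs)
    then have "\<bar>- F\<bar> \<le> B" using S by (intro LIMSEQ_le_const2) auto
    then have FB: "F \<le> B" by simp
    have "real K * t ^ (K ^ 2) = (\<Sum>k\<in>{1..K}. t ^ (K ^ 2))" by simp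
    also have "\<dots> \<le> (\<Sum>k\<in>{1..K}. r (k ^ 2) * t ^ (k ^ 2))"
    proof (rule sum_mono)
      fix k assume k: "k \<in> {1..K}"
      have "t ^ (K ^ 2) \<le> t ^ (k ^ 2)" using t k by (intro power_decreasing) (auto intro: power_mono)
      moreover have "1 * t ^ (k ^ 2) \<le> r (k ^ 2) * t ^ (k ^ 2)"
        using r_square[of k] k t by (intro mult_right_mono) auto
      ultimately show "t ^ (K ^ 2) \<le> r (k ^ 2) * t ^ (k ^ 2)" by simp
    qed
    also have "\<dots> = (\<Sum>n\<in>(\<lambda>k. k ^ 2) ` {1..K}. r n * t ^ n)"
      by (subst sum.reindex) (auto intro!: inj_onI simp: power2_eq_iff_nonneg)
    also have "\<dots> \<le> F"
      by (rule finite_sum_le_has_sum[OF F(2)]) (use t r_nonneg in \<open>auto simp: Suc_le_eq\<close>)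
    finally show ?thesis using FB by simp
  qed
  \<comment> \<open>Let t tend to 1 from the left with K fixed.\<close>
  have "real K \<le> B" for K :: nat
  proof -
    have "((\<lambda>t::real. real K * t ^ (K ^ 2)) \<longlongrightarrow> real K * 1 ^ (K ^ 2)) (at_left 1)"
      by (intro tendsto_intros)
    moreover have "\<forall>\<^sub>F t::real in at_left 1. real K * t ^ (K ^ 2) \<le> B"
      using eventually_at_left_real[of 0 1] by (auto elim!: eventually_mono intro: bound)
    ultimately show ?thesis using tendsto_upperbound by fastforce
  qed
  then show False using reals_Archimedean2[of B] by (meson not_le)
qed

end

section \<open>Nonvanishing for all characters, including real ones at 1\<close>

context modulus
begin

text \<open>A zero at 1 would mean that the sum of \<open>\<xi>\<close>(n)/n is 0, contradicting
  Monsky's argument. Convergence of that series at 1 comes from summation by parts with the bounded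
  sums \<open>csum\<close>.\<close>

lemma Lreg_nonzero_1_real:
  assumes xi: "\<xi> \<in> dchars M" and np: "\<xi> \<noteq> dprincipal M" and sq: "(\<lambda>n. \<xi> n * \<xi> n) = dprincipal M"
  shows "Lreg \<xi> 1 \<noteq> 0"
proof
  assume L0: "Lreg \<xi> 1 = 0"
  define c where "c n = Re (\<xi> n)" for n
  have v: "\<xi> n \<in> {-1, 0, 1}" for n
  proof -
    have "\<xi> n * \<xi> n = dprincipal M n" using sq by metis
    then have "\<xi> n * \<xi> n = 0 \<or> \<xi> n * \<xi> n = 1" by (auto simp: dprincipal_def)
    then show ?thesis by (auto simp: square_eq_1_iff)
  qed
  have xc: "\<xi> n = of_real (c n)" for n using v[of n] by (auto simp: c_def)
  interpret real_multiplicative c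
  proof
    show "c 0 = 0" "c 1 = 1" using chars0[OF xi] dchars_1[OF xi] by (simp_all add: c_def)
    show "c n \<in> {-1, 0, 1}" for n using v[of n] by (auto simp: c_def)
    have "of_real (c (m * n)) = (of_real (c m * c n) :: complex)" for m n
      using dchars_mult[OF xi, of m n] by (simp flip: xc)
    then show "c (m * n) = c m * c n" for m n using of_real_eq_iff by blast
  qed
  have m0: "cmean \<xi> = 0" using np by (simp add: cmean_def)
  have cs: "csum \<xi> n = of_real (\<Sum>k\<le>n. c k)" for n by (simp add: csum_def xc)
  have X: "norm (csum \<xi> n) \<le> 2 * real M + 1" for n
    using csum_bounded[OF xi, of n "real n"] m0 by simp
  have "(\<lambda>N. \<Sum>n<N. dterm (csum \<xi>) (cmean \<xi>) n 1) \<longlonglongrightarrow> Eser \<xi> 1"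
    using Eser_sums[OF xi, of 1] by (simp add: sums_def)
  then have l1: "(\<lambda>N. \<Sum>n<N. 1 * dterm (csum \<xi>) (cmean \<xi>) n 1) \<longlonglongrightarrow> 0"
    using L0 np by (simp add: Lreg_def)
  have l2: "(\<lambda>N. csum \<xi> N * npw (N + 1) 1) \<longlonglongrightarrow> 0"
  proof (rule Lim_null_comparison)
    show "(\<lambda>N. (2 * real M + 1) * (1 / real (N + 1))) \<longlonglongrightarrow> 0" by real_asymp
    have "norm (csum \<xi> N * npw (N + 1) 1) \<le> (2 * real M + 1) * (1 / real (N + 1))" for N
      unfolding norm_mult using X[of N]
      by (intro mult_mono) (auto simp: norm_npw powr_minus_divide)
    then show "\<forall>\<^sub>F N in sequentially. norm (csum \<xi> N * npw (N + 1) 1) \<le> (2 * real M + 1) * (1 / real (N + 1))"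
      by simp
  qed
  have "(\<Sum>n<N. 1 * dterm (csum \<xi>) (cmean \<xi>) n 1) + csum \<xi> N * npw (N + 1) 1 = (\<Sum>n\<le>N. \<xi> n * npw n 1)" for N
    using sum_dterm[of 1 "cmean \<xi>" \<xi> "csum \<xi>" N] m0 chars0[OF xi] by (simp add: csum_def)
  moreover have "\<xi> n * npw n 1 = of_real (c n / real n)" for n
    using npw_of_real[of n 1] by (cases "n = 0") (auto simp: xc c0 powr_minus_divide)
  ultimately have e: "(\<Sum>n<N. 1 * dterm (csum \<xi>) (cmean \<xi>) n 1) + csum \<xi> N * npw (N + 1) 1 =
      of_real (\<Sum>n\<le>N. c n / real n)" for N
    by (simp only: of_real_sum)
  have "(\<lambda>N. complex_of_real (\<Sum>n\<le>N. c n / real n)) \<longlonglongrightarrow> 0"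
    using tendsto_add[OF l1 l2] unfolding e by simp
  then have "(\<lambda>N. \<Sum>n\<le>N. c n / real n) \<longlonglongrightarrow> 0"
    using tendsto_of_real_iff[where c = 0 and 'a = complex] by fastforce
  then have "(\<lambda>n. c n / real n) sums 0" by (simp add: sums_def_le)
  moreover have "\<bar>\<Sum>k\<le>n. c k\<bar> \<le> 2 * real M + 1" for n
    using X[of n] unfolding cs norm_of_real .
  ultimately show False using monsky by blast
qed

theorem Lreg_nonzero:
  assumes xi: "\<xi> \<in> dchars M" and z: "Re z \<ge> 1"
  shows "Lreg \<xi> z \<noteq> 0"
proof (cases "Re z > 1")
  case True then show ?thesis using Lreg_nonzero_Re_gt_1[OF xi] by simp
next
  case False
  then have z': "z = 1 + \<i> * of_real (Im z)" using z by (simp add: complex_eq_iff)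
  show ?thesis
  proof (cases "Im z \<noteq> 0 \<or> (\<lambda>n. \<xi> n * \<xi> n) \<noteq> dprincipal M")
    case True
    then show ?thesis using Lreg_nonzero_line[OF xi True] z' by simp
  next
    case False
    then have z1: "z = 1" and sq: "(\<lambda>n. \<xi> n * \<xi> n) = dprincipal M" using z' by auto
    show ?thesis
    proof (cases "\<xi> = dprincipal M")
      case True
      \<comment> \<open>At s = 1 only the residue \<open>totient M\<close> / \<open>M\<close> is
        left.\<close>
      then show ?thesis using M totient_gt_0_iff[of M] by (simp add: z1 Lreg_def cmean_def)
    next
      case False
      then show ?thesis using Lreg_nonzero_1_real[OF xi False sq] z1 by simp
    qed
  qed
qed

end

section \<open>The prime number theorem in arithmetic progressions\<close>

text \<open>Passing from n to n + 1 raises the floor of n/d exactly for the divisors d of n + 1, so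
  the sum grows by ln (n + 1). The separate bound \<open>N\<close> lets n and 2n share one index
  range below.\<close>

lemma sum_mangoldt_floor:
  assumes "n \<le> N"
  shows "(\<Sum>d=1..N. mangoldt d * real (n div d)) = ln (fact n)"
  using assms
proof (induction n)
  case (Suc n)
  have "(\<Sum>d=1..N. mangoldt d * real (Suc n div d)) =
     (\<Sum>d=1..N. mangoldt d * real (n div d) + (if d dvd Suc n then mangoldt d else 0))"
    by (intro sum.cong refl) (auto simp: div_Suc dvd_eq_mod_eq_0 algebra_simps)
  also have "\<dots> = ln (fact n) + (\<Sum>d\<in>{1..N} \<inter> {d. d dvd Suc n}. mangoldt d)"
    using Suc by (simp add: sum.distrib sum.inter_restrict)
  also have "{1..N} \<inter> {d. d dvd Suc n} = {d. d dvd Suc n}"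
  proof -
    have "1 \<le> d \<and> d \<le> N" if "d dvd Suc n" for d
      using dvd_imp_le[OF that] dvd_pos_nat[OF _ that] Suc.prems by auto
    then show ?thesis by auto
  qed
  also have "(\<Sum>d | d dvd Suc n. mangoldt d) = ln (real (Suc n))"
    using mangoldt_sum[of "Suc n", where 'a = real] by simp
  also have "ln (fact n) + ln (real (Suc n)) = ln (fact (Suc n))"
    by (subst fact_Suc) (simp add: ln_mult del: of_nat_Suc)
  finally show ?case .
qed simp

text \<open>The difference of floors is nonnegative and equals 1 on the dyadic block; the full sum
  is the logarithm of the central binomial coefficient.\<close>

lemma sum_mangoldt_dyadic: "(\<Sum>d\<in>{n<..2 * n}. mangoldt d) \<le> 2 * real n * ln 2"
proof -
  have "(\<Sum>d\<in>{n<..2 * n}. mangoldt d) = (\<Sum>d\<in>{n<..2 * n}. mangoldt d * (real (2 * n div d) - 2 * real (n div d)))"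
  proof (rule sum.cong[OF refl])
    fix d assume d: "d \<in> {n<..2 * n}"
    then have "2 * n div d = 1" by (intro div_nat_eqI) auto
    moreover have "n div d = 0" using d by simp
    ultimately show "mangoldt d = mangoldt d * (real (2 * n div d) - 2 * real (n div d))" by simp
  qed
  also have "\<dots> \<le> (\<Sum>d=1..2 * n. mangoldt d * (real (2 * n div d) - 2 * real (n div d)))"
  proof (rule sum_mono2)
    fix d assume "d \<in> {1..2 * n} - {n<..2 * n}"
    then have d: "d > 0" by auto
    have "2 * (n div d) \<le> 2 * n div d"
      using d by (simp add: less_eq_div_iff_mult_less_eq mult.assoc)
    then show "0 \<le> mangoldt d * (real (2 * n div d) - 2 * real (n div d))"
      using mangoldt_nonneg[of d] by (intro mult_nonneg_nonneg) auto
  qed auto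
  also have "\<dots> = (\<Sum>d=1..2 * n. mangoldt d * real (2 * n div d)) - 2 * (\<Sum>d=1..2 * n. mangoldt d * real (n div d))"
    by (simp add: right_diff_distrib sum_subtractf sum_distrib_left mult_ac)
  also have "\<dots> = ln (fact (2 * n)) - 2 * ln (fact n)"
    using sum_mangoldt_floor[of "2 * n" "2 * n"] sum_mangoldt_floor[of n "2 * n"] by simp
  also have "\<dots> = ln (real (2 * n choose n))"
    by (simp add: binomial_fact ln_div ln_mult)
  also have "\<dots> \<le> ln (2 ^ (2 * n))"
  proof (subst ln_le_cancel_iff)
    show "real (2 * n choose n) \<le> 2 ^ (2 * n)"
      using binomial_le_pow2[of "2 * n" n] by (metis of_nat_le_iff of_nat_numeral of_nat_power)
  qed (auto simp: zero_less_binomial_iff)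
  also have "\<dots> = 2 * real n * ln 2" by (simp add: ln_realpow)
  finally show ?thesis .
qed

text \<open>Halving, with k = n div 2: the block adds at most 2 k to 4 k, and for odd n the last
  term is at most ln (1 + 2 k) <= 2 k. The total 8 k explains the constant 4.\<close>

lemma chebyshev_psi: "(\<Sum>d\<le>n. mangoldt d) \<le> 4 * real n"
proof (induction n rule: less_induct)
  case (less n)
  show ?case
  proof (cases "n = 0")
    case False
    define k where "k = n div 2"
    have k: "k < n" using False by (simp add: k_def)
    have "(\<Sum>d\<le>2 * k. mangoldt d) = (\<Sum>d\<le>k. mangoldt d) + (\<Sum>d\<in>{k<..2 * k}. mangoldt d)"
      by (subst sum.union_disjoint[symmetric]) (auto intro!: sum.cong)
    also have "\<dots> \<le> 4 * real k + 2 * real k * ln 2"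
      by (intro add_mono less.IH k sum_mangoldt_dyadic)
    also have "\<dots> \<le> 4 * real k + 2 * real k * 1"
      using ln_le_minus_one[of "2::real"] by (intro add_left_mono mult_left_mono) auto
    finally have e: "(\<Sum>d\<le>2 * k. mangoldt d) \<le> 6 * real k" by simp
    show ?thesis
    proof (cases "even n")
      case True
      then have "n = 2 * k" by (simp add: k_def)
      then show ?thesis using e by simp
    next
      case False
      then have n: "n = Suc (2 * k)" by (simp add: k_def)
      have "mangoldt n \<le> ln (1 + 2 * real k)" using mangoldt_le[of n] n by simp
      also have "\<dots> \<le> 2 * real k" by (rule ln_add_one_self_le_self) simp
      finally show ?thesis using e n by simp
    qed
  qed simp
qed

text \<open>If \<open>P\<close> exceeds c N by a proportion \<delta> at N, monotonicity keeps it too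
  large on an interval of length proportional to N, and the tail of the series there is bounded
  below by a fixed amount. A deficit is treated in the same way to the left of N.\<close>

lemma tauberian_monotone:
  fixes P :: "nat \<Rightarrow> real"
  assumes P: "mono P" and c: "c > 0"
    and summ: "summable (\<lambda>m. P (m + 1) / (real (m + 1) * real (m + 2)) - c * (ln (real (m + 2)) - ln (real (m + 1))))"
  shows "(\<lambda>n. P n / real n) \<longlonglongrightarrow> c"
proof (rule LIMSEQ_I)
  \<comment> \<open>For m >= 1 this is the integral of (P(m) - c x) / x^2 over [m, m + 1].\<close>
  define \<tau> where "\<tau> m = P m / (real m * real (m + 1)) - c * (ln (real (m + 1)) - ln (real m))" for m
  have "summable \<tau>"
    using summ summable_Suc_iff[of \<tau>] by (simp add: \<tau>_def add.commute)
  have lnb: "1 / real (m + 1) \<le> ln (real (m + 1)) - ln (real m)" "ln (real (m + 1)) - ln (real m) \<le> 1 / real m"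
    if "m \<ge> 1" for m
  proof -
    have "ln (real m / real (m + 1)) \<le> real m / real (m + 1) - 1" using that by (intro ln_le_minus_one) auto
    then show "1 / real (m + 1) \<le> ln (real (m + 1)) - ln (real m)" using that by (simp add: ln_div field_simps)
    have "ln (real (m + 1) / real m) \<le> real (m + 1) / real m - 1" using that by (intro ln_le_minus_one) auto
    then show "ln (real (m + 1)) - ln (real m) \<le> 1 / real m" using that by (simp add: ln_div field_simps)
  qed
  have alg: "(p - c * y) / (x * y) = p / (x * y) - c * (1 / x)" "(p - c * x) / (x * y) = p / (x * y) - c * (1 / y)"
    if "x > 0" "y > 0" for p x y :: real
    using that by (simp_all add: field_simps)
  have lo: "\<tau> m \<ge> (P m - c * real (m + 1)) / (real m * real (m + 1))" if "m \<ge> 1" for m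
  proof -
    have "(P m - c * real (m + 1)) / (real m * real (m + 1)) = P m / (real m * real (m + 1)) - c * (1 / real m)"
      using that by (intro alg) auto
    also have "\<dots> \<le> \<tau> m" unfolding \<tau>_def using lnb[OF that] c by (intro diff_left_mono mult_left_mono) auto
    finally show ?thesis .
  qed
  have hi: "\<tau> m \<le> (P m - c * real m) / (real m * real (m + 1))" if "m \<ge> 1" for m
  proof -
    have "\<tau> m \<le> P m / (real m * real (m + 1)) - c * (1 / real (m + 1))"
      unfolding \<tau>_def using lnb[OF that] c by (intro diff_left_mono mult_left_mono) auto
    also have "\<dots> = (P m - c * real m) / (real m * real (m + 1))"
      using that by (intro alg(2)[symmetric]) auto
    finally show ?thesis .
  qed
  fix \<epsilon>0 :: real assume "\<epsilon>0 > 0"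
  define \<delta> where "\<delta> = min (1 / 2) (\<epsilon>0 / (2 * c))"
  have d: "0 < \<delta>" "\<delta> < 1" "\<delta> * c < \<epsilon>0"
  proof -
    show "0 < \<delta>" "\<delta> < 1" using \<open>\<epsilon>0 > 0\<close> c by (auto simp: \<delta>_def)
    have "\<delta> * c \<le> \<epsilon>0 / (2 * c) * c" using c by (intro mult_right_mono) (auto simp: \<delta>_def)
    then show "\<delta> * c < \<epsilon>0" using c \<open>\<epsilon>0 > 0\<close> by simp
  qed
  \<comment> \<open>At least \<open>\<delta>\<close> N / 4 terms, each at least c
    \<open>\<delta>\<close> / (8 N), have exactly this total; the deficit case yields four times as
    much.\<close>
  define \<eta> where "\<eta> = c * \<delta>\<^sup>2 / 32"
  have eta: "\<eta> > 0" using c d by (simp add: \<eta>_def)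
  obtain N0 where N0: "\<And>m n. m \<ge> N0 \<Longrightarrow> \<bar>sum \<tau> {m..<n}\<bar> < \<eta>"
    using \<open>summable \<tau>\<close> eta unfolding summable_Cauchy real_norm_def by blast
  \<comment> \<open>The first bound keeps N - j above \<open>N0\<close> because j <= N/2; the second
    gives \<open>\<delta>\<close> N >= 4, so rounding loses at most half of \<open>\<delta>\<close>
    N / 2.\<close>
  define N1 where "N1 = max (2 * N0 + 2) (nat \<lceil>4 / \<delta>\<rceil> + 1)"
  have main: "\<bar>P N - c * real N\<bar> \<le> \<delta> * c * real N" if N: "N \<ge> N1" for N
  proof -
    have "nat \<lceil>4 / \<delta>\<rceil> + 1 \<le> N1" unfolding N1_def by (rule max.cobounded2)
    then have "real (nat \<lceil>4 / \<delta>\<rceil>) \<le> real N" using N by linarith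
    then have N4: "4 / \<delta> \<le> real N" using real_nat_ceiling_ge[of "4 / \<delta>"] by linarith
    have Npos: "real N > 0" and N1: "N \<ge> 1" and NN0: "N \<ge> 2 * N0 + 2" using N by (auto simp: N1_def)
    define j where "j = nat \<lfloor>\<delta> * real N / 2\<rfloor>"
    have dN: "\<delta> * real N \<ge> 4" using N4 d by (simp add: field_simps)
    have j: "real j \<le> \<delta> * real N / 2" "real j \<ge> \<delta> * real N / 4" using dN by (auto simp: j_def) linarith+
    have "\<delta> * real N \<le> 1 * real N" using d by (intro mult_right_mono) auto
    then have jN: "real j \<le> real N / 2" using j by simp
    have "\<not> P N > (1 + \<delta>) * c * real N"
    proof
      assume A: "P N > (1 + \<delta>) * c * real N"
      have "sum \<tau> {N..<N + j} \<ge> (\<Sum>m\<in>{N..<N + j}. c * \<delta> / (8 * real N))"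
      proof (rule sum_mono)
        fix m assume m: "m \<in> {N..<N + j}"
        have "P m \<ge> P N" using P m by (auto dest: monoD)
        have m1: "real (m + 1) \<le> real N + real j" using m by simp
        have "c * real (m + 1) \<le> c * (real N + \<delta> * real N / 2)" using m1 j c by (intro mult_left_mono) auto
        then have num: "P m - c * real (m + 1) \<ge> c * \<delta> * real N / 2"
          using \<open>P m \<ge> P N\<close> A by (simp add: algebra_simps)
        have mm: "real m * real (m + 1) \<le> (2 * real N) * (2 * real N)"
          using m1 jN by (intro mult_mono) auto
        have "c * \<delta> / (8 * real N) = (c * \<delta> * real N / 2) / ((2 * real N) * (2 * real N))"
          using Npos by (simp add: field_simps)
        also have "\<dots> \<le> (c * \<delta> * real N / 2) / (real m * real (m + 1))"
          using mm c d Npos m N1 by (intro divide_left_mono) auto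
        also have "\<dots> \<le> (P m - c * real (m + 1)) / (real m * real (m + 1))"
          using num by (intro divide_right_mono) auto
        also have "\<dots> \<le> \<tau> m" using m N1 by (intro lo) auto
        finally show "c * \<delta> / (8 * real N) \<le> \<tau> m" .
      qed
      moreover have "(\<Sum>m\<in>{N..<N + j}. c * \<delta> / (8 * real N)) = real j * (c * \<delta> / (8 * real N))" by simp
      moreover have "real j * (c * \<delta> / (8 * real N)) \<ge> (\<delta> * real N / 4) * (c * \<delta> / (8 * real N))"
        using j c d Npos by (intro mult_right_mono) auto
      moreover have "(\<delta> * real N / 4) * (c * \<delta> / (8 * real N)) = \<eta>"
        using Npos by (simp add: \<eta>_def power2_eq_square field_simps)
      moreover have "\<bar>sum \<tau> {N..<N + j}\<bar> < \<eta>" using NN0 by (intro N0) auto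
      ultimately show False by linarith
    qed
    moreover have "\<not> P N < (1 - \<delta>) * c * real N"
    proof
      assume A: "P N < (1 - \<delta>) * c * real N"
      have jle: "j \<le> N" using jN by linarith
      have "sum \<tau> {N - j..<N} \<le> (\<Sum>m\<in>{N - j..<N}. - (c * \<delta> / (2 * real N)))"
      proof (rule sum_mono)
        fix m assume m: "m \<in> {N - j..<N}"
        have mr: "real m \<ge> real N - real j" using m jle by auto
        then have "real m > 0" using jN Npos by linarith
        then have m1: "m \<ge> 1" by simp
        have "P m \<le> P N" using m by (intro monoD[OF P]) auto
        have "c * real m \<ge> c * (real N - \<delta> * real N / 2)" using mr j c by (intro mult_left_mono) auto
        then have num: "P m - c * real m \<le> - (c * \<delta> * real N / 2)"
          using \<open>P m \<le> P N\<close> A by (simp add: algebra_simps)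
        have mm: "real m * real (m + 1) \<le> real N * real N"
          using m by (intro mult_mono) auto
        have "\<tau> m \<le> (P m - c * real m) / (real m * real (m + 1))" by (rule hi[OF m1])
        also have "\<dots> \<le> - (c * \<delta> * real N / 2) / (real m * real (m + 1))"
          using num by (intro divide_right_mono) auto
        also have "\<dots> = - ((c * \<delta> * real N / 2) / (real m * real (m + 1)))" by simp
        also have "\<dots> \<le> - ((c * \<delta> * real N / 2) / (real N * real N))"
          using mm c d Npos m1 by (intro le_imp_neg_le divide_left_mono) auto
        also have "\<dots> = - (c * \<delta> / (2 * real N))" using Npos by (simp add: field_simps)
        finally show "\<tau> m \<le> - (c * \<delta> / (2 * real N))" .
      qed
      moreover have "(\<Sum>m\<in>{N - j..<N}. - (c * \<delta> / (2 * real N))) = - (real j * (c * \<delta> / (2 * real N)))"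
        using jle by simp
      moreover have "real j * (c * \<delta> / (2 * real N)) \<ge> (\<delta> * real N / 4) * (c * \<delta> / (2 * real N))"
        using j c d Npos by (intro mult_right_mono) auto
      moreover have "(\<delta> * real N / 4) * (c * \<delta> / (2 * real N)) = 4 * \<eta>"
        using Npos by (simp add: \<eta>_def power2_eq_square field_simps)
      moreover have "N - j \<ge> N0" using jN NN0 by linarith
      then have "\<bar>sum \<tau> {N - j..<N}\<bar> < \<eta>" by (rule N0)
      ultimately show False using eta by linarith
    qed
    ultimately show ?thesis by (simp add: abs_le_iff algebra_simps)
  qed
  show "\<exists>no. \<forall>n\<ge>no. norm (P n / real n - c) < \<epsilon>0"
  proof (intro exI[of _ N1] allI impI)
    fix n assume n: "n \<ge> N1"
    then have n0: "real n > 0" by (auto simp: N1_def)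
    have "norm (P n / real n - c) = \<bar>P n - c * real n\<bar> / real n"
      using n0 by (simp add: field_simps)
    also have "\<dots> \<le> \<delta> * c * real n / real n" using main[OF n] n0 by (intro divide_right_mono) auto
    also have "\<dots> = \<delta> * c" using n0 by simp
    finally show "norm (P n / real n - c) < \<epsilon>0" using d by linarith
  qed
qed

text \<open>A prime power p^j with j >= 2 up to n has p <= sqrt n and j <= log_2 n; counting the
  pairs (p, j) suffices.\<close>

lemma sum_mangoldt_nonprime:
  "(\<Sum>k\<in>{k. k \<le> n \<and> \<not> prime k}. mangoldt k) \<le> ln (real n) * ((sqrt (real n) + 1) * (ln (real n) / ln 2 + 1))"
proof (cases "n = 0")
  case True
  then have "{k. k \<le> n \<and> \<not> prime k} = {0}" by auto
  then show ?thesis using True by simp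
next
  case False
  define S where "S = {k. k \<le> n \<and> \<not> prime k \<and> primepow k}"
  define J where "J = {..nat \<lfloor>sqrt (real n)\<rfloor>} \<times> {..nat \<lfloor>ln (real n) / ln 2\<rfloor>}"
  have fin: "finite S" unfolding S_def by (rule finite_subset[of _ "{..n}"]) auto
  have "S \<subseteq> (\<lambda>(p, j). p ^ j) ` J"
  proof
    fix k assume "k \<in> S"
    then have k: "k \<le> n" "\<not> prime k" "primepow k" by (auto simp: S_def)
    obtain p j where pj: "prime p" "j > 0" "k = p ^ j" using k(3) by (auto simp: primepow_def)
    have "j \<noteq> 1" using k(2) pj by auto
    then have j2: "j \<ge> 2" using pj by simp
    have p2: "p \<ge> 2" using pj(1) by (rule prime_ge_2_nat)
    have "p ^ 2 \<le> p ^ j" using j2 p2 by (intro power_increasing) auto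
    then have "p ^ 2 \<le> n" using k pj by simp
    then have "real p ^ 2 \<le> real n" by (metis of_nat_le_iff of_nat_power)
    then have "real p \<le> sqrt (real n)" by (rule real_le_rsqrt)
    then have "int p \<le> \<lfloor>sqrt (real n)\<rfloor>" by (simp add: le_floor_iff)
    then have 1: "p \<le> nat \<lfloor>sqrt (real n)\<rfloor>" by linarith
    have "2 ^ j \<le> p ^ j" using p2 by (intro power_mono) auto
    also have "\<dots> \<le> n" using k pj by simp
    finally have "2 ^ j \<le> n" .
    then have "(2::real) ^ j \<le> real n" by (metis of_nat_le_iff of_nat_numeral of_nat_power)
    then have "ln ((2::real) ^ j) \<le> ln (real n)" using False by (subst ln_le_cancel_iff) auto
    then have "real j \<le> ln (real n) / ln 2" by (simp add: ln_realpow field_simps)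
    then have "int j \<le> \<lfloor>ln (real n) / ln 2\<rfloor>" by (simp add: le_floor_iff)
    then have 2: "j \<le> nat \<lfloor>ln (real n) / ln 2\<rfloor>" by linarith
    have "(p, j) \<in> J" unfolding J_def using 1 2 by blast
    then show "k \<in> (\<lambda>(p, j). p ^ j) ` J" using pj(3) by force
  qed
  then have "card S \<le> card ((\<lambda>(p, j). p ^ j) ` J)" by (intro card_mono) (auto simp: J_def)
  also have "\<dots> \<le> card J" by (intro card_image_le) (auto simp: J_def)
  also have "card J = (nat \<lfloor>sqrt (real n)\<rfloor> + 1) * (nat \<lfloor>ln (real n) / ln 2\<rfloor> + 1)"
    by (simp add: J_def card_cartesian_product)
  finally have "real (card S) \<le> real ((nat \<lfloor>sqrt (real n)\<rfloor> + 1) * (nat \<lfloor>ln (real n) / ln 2\<rfloor> + 1))"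
    by (simp only: of_nat_le_iff)
  also have "\<dots> = (real (nat \<lfloor>sqrt (real n)\<rfloor>) + 1) * (real (nat \<lfloor>ln (real n) / ln 2\<rfloor>) + 1)"
    by (simp only: of_nat_mult of_nat_add of_nat_1)
  also have "\<dots> \<le> (sqrt (real n) + 1) * (ln (real n) / ln 2 + 1)"
    using False by (intro mult_mono add_right_mono) auto
  finally have card: "real (card S) \<le> (sqrt (real n) + 1) * (ln (real n) / ln 2 + 1)" .
  have "(\<Sum>k\<in>{k. k \<le> n \<and> \<not> prime k}. mangoldt k) = (\<Sum>k\<in>S. mangoldt k)"
    by (rule sum.mono_neutral_right) (auto simp: S_def mangoldt_def)
  also have "\<dots> \<le> (\<Sum>k\<in>S. ln (real n))"
  proof (rule sum_mono)
    fix k assume k: "k \<in> S"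
    then have "k > 0" by (auto simp: S_def intro!: Nat.gr0I)
    then have "mangoldt k \<le> ln (real k)" by (rule mangoldt_le)
    also have "\<dots> \<le> ln (real n)" using \<open>k > 0\<close> k by (subst ln_le_cancel_iff) (auto simp: S_def)
    finally show "mangoldt k \<le> ln (real n)" .
  qed
  also have "\<dots> = ln (real n) * real (card S)" by simp
  also have "\<dots> \<le> ln (real n) * ((sqrt (real n) + 1) * (ln (real n) / ln 2 + 1))"
    using card False by (intro mult_left_mono) auto
  finally show ?thesis .
qed

context modulus
begin

theorem psi_AP:
  assumes a: "coprime a M"
  shows "(\<lambda>n. (\<Sum>k\<le>n. if [k = a] (mod M) then mangoldt k else 0) / real n) \<longlonglongrightarrow> 1 / real (totient M)"
proof -
  define \<phi> where "\<phi> = real (totient M)"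
  have phi: "\<phi> \<ge> 1" using M by (simp add: \<phi>_def Suc_le_eq)
  define g where "g k = (if [k = a] (mod M) then mangoldt k else 0 :: real)" for k
  define f where "f k = (of_real (g k) :: complex)" for k
  define P where "P n = (\<Sum>k\<le>n. g k)" for n
  define X where "X n = (of_real (P n) :: complex)" for n
  define \<mu> where "\<mu> = (of_real (1 / \<phi>) :: complex)"
  have g0: "g k \<ge> 0" for k using mangoldt_nonneg by (auto simp: g_def)
  have f0: "f 0 = 0" by (simp add: f_def g_def)
  have Xf: "X n = (\<Sum>k\<le>n. f k)" for n by (simp add: X_def P_def f_def)
  have Pnn: "P n \<ge> 0" for n unfolding P_def using g0 by (intro sum_nonneg) auto
  have Pb: "P n \<le> 4 * real n" for n
  proof -
    have "P n \<le> (\<Sum>k\<le>n. mangoldt k)" unfolding P_def g_def using mangoldt_nonneg by (intro sum_mono) auto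
    then show ?thesis using chebyshev_psi[of n] by linarith
  qed
  have Xb: "norm (X n) \<le> 4 * real n" for n using Pb[of n] Pnn[of n] by (simp add: X_def)
  have f_chars: "f n = \<mu> * (\<Sum>\<xi>\<in>dchars M. cnj (\<xi> a) * (\<xi> n * mangoldt n))" for n
  proof -
    have "(\<Sum>\<xi>\<in>dchars M. cnj (\<xi> a) * (\<xi> n * mangoldt n)) = (\<Sum>\<xi>\<in>dchars M. cnj (\<xi> a) * \<xi> n) * mangoldt n"
      by (simp add: sum_distrib_right mult.assoc)
    also have "\<dots> = (if [n = a] (mod M) then of_real \<phi> else 0) * mangoldt n"
      unfolding dchars_orthogonality[OF M a] by (simp add: \<phi>_def)
    finally show ?thesis using phi by (simp add: \<mu>_def f_def g_def)
  qed
  \<comment> \<open>The combination of the -L'/L that singles out the residue class, with its pole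
    at s = 1 removed and defined wherever no \<open>Lreg\<close> vanishes.\<close>
  define S where "S s = (\<Sum>\<xi>\<in>dchars M. cnj (\<xi> a) * (- (deriv (Lreg \<xi>) s / Lreg \<xi> s)))" for s
  \<comment> \<open>The variable is shifted so that s = 1 becomes z = 0. The denominator undoes the
    factor s of the Dirichlet series identity, and the -1 is what remains of 1/(s-1) -
    s/(s-1).\<close>
  define G where "G z = \<mu> * (S (1 + z) - 1) / (1 + z)" for z
  have sumsG: "(\<lambda>n. dterm X \<mu> n (1 + z)) sums G z" if z: "Re z > 0" for z
  proof -
    define s where "s = 1 + z"
    have s: "Re s > 1" "s \<noteq> 0" "s \<noteq> 1" using z by (auto simp: s_def complex_eq_iff)
    have "(\<lambda>n. \<mu> * (\<Sum>\<xi>\<in>dchars M. cnj (\<xi> a) * (\<xi> n * mangoldt n * npw n s))) sums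
       (\<mu> * (\<Sum>\<xi>\<in>dchars M. cnj (\<xi> a) * Vser \<xi> s))"
      by (intro sums_mult sums_sum Vser_sums s)
    then have fs: "(\<lambda>n. f n * npw n s) sums (\<mu> * (\<Sum>\<xi>\<in>dchars M. cnj (\<xi> a) * Vser \<xi> s))"
      by (simp add: f_chars sum_distrib_right mult.assoc)
    have V: "Vser \<xi> s = - (deriv (Lreg \<xi>) s / Lreg \<xi> s) + cdelta \<xi> / (s - 1)" if "\<xi> \<in> dchars M" for \<xi>
    proof -
      have nz: "Lreg \<xi> s \<noteq> 0" using Lreg_nonzero[OF that] s by simp
      have "- (deriv (Lreg \<xi>) s / Lreg \<xi> s) = (- deriv (Lreg \<xi>) s) / Lreg \<xi> s" by simp
      also have "\<dots> = Vser \<xi> s - cdelta \<xi> / (s - 1)"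
        unfolding Lreg_deriv[OF that s(1)] using nz by simp
      finally show ?thesis by simp
    qed
    have "(\<Sum>\<xi>\<in>dchars M. cnj (\<xi> a) * (cdelta \<xi> / (s - 1))) = (\<Sum>\<xi>\<in>dchars M. if \<xi> = dprincipal M then 1 / (s - 1) else 0)"
      using a by (intro sum.cong) (auto simp: cdelta_def dprincipal_def)
    also have "\<dots> = 1 / (s - 1)" using finite_dchars[OF M0] dprincipal_dchars[OF M0] by simp
    finally have pole: "(\<Sum>\<xi>\<in>dchars M. cnj (\<xi> a) * (cdelta \<xi> / (s - 1))) = 1 / (s - 1)" .
    have "(\<Sum>\<xi>\<in>dchars M. cnj (\<xi> a) * Vser \<xi> s) =
       (\<Sum>\<xi>\<in>dchars M. cnj (\<xi> a) * (- (deriv (Lreg \<xi>) s / Lreg \<xi> s)) + cnj (\<xi> a) * (cdelta \<xi> / (s - 1)))"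
      by (intro sum.cong refl) (simp only: V distrib_left)
    then have "(\<Sum>\<xi>\<in>dchars M. cnj (\<xi> a) * Vser \<xi> s) = S s + 1 / (s - 1)"
      unfolding sum.distrib pole S_def .
    with fs have "(\<lambda>n. f n * npw n s) sums (\<mu> * (S s + 1 / (s - 1)))" by simp
    from dterm_sums[OF s(1) f0 Xf Xb this, of \<mu>]
    have "(\<lambda>n. s * dterm X \<mu> n s) sums (\<mu> * (S s + 1 / (s - 1)) - \<mu> * s / (s - 1))" .
    also have "\<mu> * (S s + 1 / (s - 1)) - \<mu> * s / (s - 1) = \<mu> * (S s + (1 / (s - 1) - s / (s - 1)))"
      by (simp add: algebra_simps)
    also have "1 / (s - 1) - s / (s - 1) = -1" using s(3) by (simp add: diff_divide_distrib[symmetric] minus_divide_left[symmetric] divide_eq_minus_1_iff)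
    finally have "(\<lambda>n. s * dterm X \<mu> n s / s) sums (\<mu> * (S s + -1) / s)" by (rule sums_divide)
    then show ?thesis using s(2) by (simp add: G_def s_def)
  qed
  \<comment> \<open>Openness uses that there are finitely many characters; that \<open>U\<close>
    contains the closed half-plane is the nonvanishing theorem.\<close>
  define U where "U = {z. Re z > -1} \<inter> (\<Inter>\<xi>\<in>dchars M. {z. Re z > -1} \<inter> (\<lambda>z. Lreg \<xi> (1 + z)) -` (- {0}))"
  have shift: "(\<lambda>z. 1 + z) holomorphic_on A" for A :: "complex set" by (intro holomorphic_intros)
  have Lh: "(\<lambda>z. Lreg \<xi> (1 + z)) holomorphic_on {z. Re z > -1}" if "\<xi> \<in> dchars M" for \<xi>
    by (rule holomorphic_on_compose_gen[OF shift Lreg_holomorphic[OF that], unfolded o_def]) auto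
  have Lh': "(\<lambda>z. deriv (Lreg \<xi>) (1 + z)) holomorphic_on {z. Re z > -1}" if "\<xi> \<in> dchars M" for \<xi>
    by (rule holomorphic_on_compose_gen[OF shift holomorphic_deriv[OF Lreg_holomorphic[OF that] open_halfspace_Re_gt], unfolded o_def]) auto
  have "open U"
    unfolding U_def
    by (intro open_Int open_halfspace_Re_gt open_INT finite_dchars M0 ballI
          continuous_open_preimage holomorphic_on_imp_continuous_on[OF Lh]) auto
  moreover have "{z. Re z \<ge> 0} \<subseteq> U" using Lreg_nonzero by (auto simp: U_def)
  moreover have "G holomorphic_on U"
  proof -
    have "1 + z \<noteq> 0" if "z \<in> U" for z using that by (auto simp: U_def complex_eq_iff)
    moreover have "(\<lambda>z. - (deriv (Lreg \<xi>) (1 + z) / Lreg \<xi> (1 + z))) holomorphic_on U" if "\<xi> \<in> dchars M" for \<xi>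
    proof -
      have "(\<lambda>z. Lreg \<xi> (1 + z)) holomorphic_on U" "(\<lambda>z. deriv (Lreg \<xi>) (1 + z)) holomorphic_on U"
      proof -
        have sub: "U \<subseteq> {z. Re z > -1}" unfolding U_def by blast
        show "(\<lambda>z. Lreg \<xi> (1 + z)) holomorphic_on U" by (rule holomorphic_on_subset[OF Lh[OF that] sub])
        show "(\<lambda>z. deriv (Lreg \<xi>) (1 + z)) holomorphic_on U" by (rule holomorphic_on_subset[OF Lh'[OF that] sub])
      qed
      moreover have "\<forall>z\<in>U. Lreg \<xi> (1 + z) \<noteq> 0" using that unfolding U_def by blast
      ultimately show ?thesis by (intro holomorphic_intros) auto
    qed
    then have "(\<lambda>z. S (1 + z)) holomorphic_on U"
      unfolding S_def by (intro holomorphic_on_sum holomorphic_on_mult[OF holomorphic_on_const])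
    ultimately show ?thesis unfolding G_def[abs_def] by (intro holomorphic_intros) auto
  qed
  moreover have "(\<lambda>z. dterm X \<mu> n (1 + z)) holomorphic_on UNIV" for n
  proof -
    have "dterm X \<mu> n holomorphic_on UNIV"
      unfolding dterm_def[abs_def] by (intro kint_holomorphic continuous_intros) auto
    then show ?thesis
      by (rule holomorphic_on_compose_gen[OF shift, unfolded o_def]) auto
  qed
  moreover have "norm (dterm X \<mu> n (1 + z)) \<le> 5 * (real (n + 1) powr (- Re z) - real (n + 2) powr (- Re z)) / Re z"
    if "Re z \<noteq> 0" for n z
  proof -
    \<comment> \<open>Dividing by x turns the integral at 1 + z into one at z with a bounded weight.
      The bound 5 is 4 from Chebyshev's estimate plus 1 from \<open>\<mu>\<close>.\<close>
    define v where "v x = (X (n + 1) - \<mu> * of_real x) / of_real x" for x :: real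
    have "dterm X \<mu> n (1 + z) = kint (\<lambda>x. v x * of_real x) (real (n + 1)) (real (n + 2)) (1 + z)"
      unfolding dterm_def kint_def by (rule integral_cong) (auto simp: v_def)
    also have "\<dots> = kint v (real (n + 1)) (real (n + 2)) (1 + z - 1)" by (rule kint_shift) simp
    also have "1 + z - 1 = z" by simp
    also have "norm (kint v (real (n + 1)) (real (n + 2)) z) \<le> 5 * (real (n + 1) powr (- Re z) - real (n + 2) powr (- Re z)) / Re z"
    proof (rule norm_kint_le)
      show "continuous_on {real (n + 1)..real (n + 2)} v"
        unfolding v_def by (intro continuous_intros) auto
      fix x assume x: "x \<in> {real (n + 1)..real (n + 2)}"
      then have x0: "x \<ge> 1" by auto
      have "norm (X (n + 1) - \<mu> * of_real x) \<le> norm (X (n + 1)) + norm (\<mu> * of_real x)" by (rule norm_triangle_ineq4)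
      also have "\<dots> \<le> 4 * real (n + 1) + 1 * x"
      proof (intro add_mono Xb)
        have "norm \<mu> \<le> 1" using phi by (simp add: \<mu>_def norm_divide)
        then show "norm (\<mu> * of_real x) \<le> 1 * x"
          unfolding norm_mult norm_of_real using x0 by (intro mult_mono) auto
      qed
      also have "\<dots> \<le> 5 * x" using x by simp
      finally show "norm (v x) \<le> 5" using x0 by (simp add: v_def norm_divide divide_simps)
    qed (use that in auto)
    finally show ?thesis .
  qed
  ultimately have "(\<lambda>n. dterm X \<mu> n (1 + 0)) sums G 0"
    using sumsG by (intro newman_tauberian[where C = 5 and U = U and T = "\<lambda>n z. dterm X \<mu> n (1 + z)"]) auto
  then have "(\<lambda>n. Re (dterm X \<mu> n (1 + 0))) sums Re (G 0)" by (rule sums_Re)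
  then have "summable (\<lambda>n. Re (dterm X \<mu> n 1))" by (simp add: sums_iff)
  \<comment> \<open>The kernel at s = 1 is x^(-2), so these are the terms to which the monotone
    Tauberian lemma applies.\<close>
  moreover have "Re (dterm X \<mu> n 1) = P (n + 1) / (real (n + 1) * real (n + 2)) - 1 / \<phi> * (ln (real (n + 2)) - ln (real (n + 1)))" for n
  proof -
    have "dterm X \<mu> n 1 = kint (\<lambda>_. X (n + 1)) (real (n + 1)) (real (n + 2)) 1 - kint (\<lambda>_. \<mu>) (real (n + 1)) (real (n + 2)) (1 - 1)"
      unfolding dterm_def by (rule kint_linear) auto
    also have "kint (\<lambda>_. \<mu>) (real (n + 1)) (real (n + 2)) (1 - 1) = of_real (1 / \<phi> * (ln (real (n + 2)) - ln (real (n + 1))))"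
      by (simp add: kint_const \<mu>_def)
    also have "kint (\<lambda>_. X (n + 1)) (real (n + 1)) (real (n + 2)) 1 = X (n + 1) * (npw (n + 1) 1 - npw (n + 2) 1)"
      using kint_const_npw[of "n + 1" "n + 2" 1 "X (n + 1)"] by simp
    also have "\<dots> = of_real (P (n + 1) * (1 / real (n + 1) - 1 / real (n + 2)))"
      using npw_of_real[of "n + 1" 1] npw_of_real[of "n + 2" 1] by (simp add: X_def powr_minus_divide)
    finally have "Re (dterm X \<mu> n 1) = P (n + 1) * (1 / real (n + 1) - 1 / real (n + 2)) - 1 / \<phi> * (ln (real (n + 2)) - ln (real (n + 1)))"
      by (simp only: Re_complex_of_real minus_complex.sel)
    also have "1 / real (n + 1) - 1 / real (n + 2) = 1 / (real (n + 1) * real (n + 2))"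
      by (simp add: field_simps)
    finally show ?thesis by simp
  qed
  ultimately have "summable (\<lambda>n. P (n + 1) / (real (n + 1) * real (n + 2)) - 1 / \<phi> * (ln (real (n + 2)) - ln (real (n + 1))))"
    by (simp only:)
  moreover have "mono P" unfolding P_def using g0 by (intro monoI sum_mono2) auto
  ultimately have "(\<lambda>n. P n / real n) \<longlonglongrightarrow> 1 / \<phi>"
    using phi by (intro tauberian_monotone) auto
  then show ?thesis by (simp add: P_def g_def \<phi>_def)
qed

definition theta :: "nat \<Rightarrow> nat \<Rightarrow> real" where
  "theta a n = (\<Sum>p | prime p \<and> p \<le> n \<and> [p = a] (mod M). ln (real p))"

text \<open>Proper prime powers contribute O(sqrt n (ln n)^2), hence o(n).\<close>

theorem theta_AP:
  assumes a: "coprime a M"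
  shows "(\<lambda>n. theta a n / real n) \<longlonglongrightarrow> 1 / real (totient M)"
proof -
  define \<psi> where "\<psi> n = (\<Sum>k\<le>n. if [k = a] (mod M) then mangoldt k else 0 :: real)" for n
  define R where "R n = ln (real n) * ((sqrt (real n) + 1) * (ln (real n) / ln 2 + 1))" for n :: nat
  have split: "\<psi> n = theta a n + (\<Sum>k\<in>{k. k \<le> n \<and> \<not> prime k \<and> [k = a] (mod M)}. mangoldt k)" for n
  proof -
    have "\<psi> n = (\<Sum>k | k \<le> n \<and> [k = a] (mod M). mangoldt k)"
      unfolding \<psi>_def by (rule sum.mono_neutral_cong_right) auto
    also have "\<dots> = (\<Sum>k | prime k \<and> k \<le> n \<and> [k = a] (mod M). mangoldt k) + (\<Sum>k\<in>{k. k \<le> n \<and> \<not> prime k \<and> [k = a] (mod M)}. mangoldt k)"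
      by (subst sum.union_disjoint[symmetric]) (auto intro!: sum.cong intro: finite_subset[of _ "{..n}"])
    finally show ?thesis by (simp add: theta_def)
  qed
  have bnd: "\<bar>\<psi> n - theta a n\<bar> \<le> R n" for n
  proof -
    have "(\<Sum>k\<in>{k. k \<le> n \<and> \<not> prime k \<and> [k = a] (mod M)}. mangoldt k) \<le> (\<Sum>k\<in>{k. k \<le> n \<and> \<not> prime k}. mangoldt k :: real)"
      by (rule sum_mono2) (auto simp: mangoldt_nonneg)
    moreover have "(\<Sum>k\<in>{k. k \<le> n \<and> \<not> prime k \<and> [k = a] (mod M)}. mangoldt k :: real) \<ge> 0"
      by (intro sum_nonneg mangoldt_nonneg)
    ultimately show ?thesis using split[of n] sum_mangoldt_nonprime[of n] by (simp add: R_def)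
  qed
  have "(\<lambda>n. (\<psi> n - theta a n) / real n) \<longlonglongrightarrow> 0"
  proof (rule Lim_null_comparison)
    show "(\<lambda>n. R n / real n) \<longlonglongrightarrow> 0" unfolding R_def by real_asymp
    show "\<forall>\<^sub>F n in sequentially. norm ((\<psi> n - theta a n) / real n) \<le> R n / real n"
      using bnd by (auto intro!: always_eventually divide_right_mono)
  qed
  from tendsto_diff[OF psi_AP[OF a] this] show ?thesis
    by (simp add: \<psi>_def diff_divide_distrib[symmetric])
qed

end

section \<open>Reciprocals of primes in arithmetic progressions\<close>

text \<open>Past \<open>N0\<close> the increments of A - L B are at most \<epsilon>/2 times those of
  \<open>B\<close>; the constant left over from \<open>N0\<close> is absorbed because
  \<open>B\<close> diverges.\<close>

lemma stolz_cesaro: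
  fixes A B :: "nat \<Rightarrow> real"
  assumes B: "filterlim B at_top sequentially" and inc: "\<forall>\<^sub>F n in sequentially. B n < B (Suc n)"
    and lim: "(\<lambda>n. (A (Suc n) - A n) / (B (Suc n) - B n)) \<longlonglongrightarrow> L"
  shows "(\<lambda>n. A n / B n) \<longlonglongrightarrow> L"
proof (rule LIMSEQ_I)
  fix \<epsilon> :: real assume e: "\<epsilon> > 0"
  have "\<forall>\<^sub>F n in sequentially. \<bar>(A (Suc n) - A n) / (B (Suc n) - B n) - L\<bar> < \<epsilon> / 2"
    using tendstoD[OF lim, of "\<epsilon> / 2"] e by (simp add: dist_real_def)
  from eventually_conj[OF inc this] obtain N0 where
    N0: "\<And>n. n \<ge> N0 \<Longrightarrow> B n < B (Suc n)"
      "\<And>n. n \<ge> N0 \<Longrightarrow> \<bar>(A (Suc n) - A n) / (B (Suc n) - B n) - L\<bar> < \<epsilon> / 2"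
    unfolding eventually_sequentially by blast
  define K where "K = \<bar>A N0 - L * B N0\<bar> + \<epsilon> / 2 * \<bar>B N0\<bar>"
  have tele: "\<bar>(A n - L * B n) - (A N0 - L * B N0)\<bar> \<le> \<epsilon> / 2 * (B n - B N0)" if "n \<ge> N0" for n
    using that
  proof (induction n rule: dec_induct)
    case (step n)
    define dB where "dB = B (Suc n) - B n"
    have dB: "dB > 0" using N0(1)[of n] step by (simp add: dB_def)
    have "\<bar>(A (Suc n) - A n) / dB - L\<bar> * dB \<le> \<epsilon> / 2 * dB"
      using N0(2)[of n] step dB by (intro mult_right_mono) (auto simp: dB_def)
    also have "\<bar>(A (Suc n) - A n) / dB - L\<bar> * dB = \<bar>((A (Suc n) - A n) / dB - L) * dB\<bar>"
      using dB by (simp add: abs_mult)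
    also have "((A (Suc n) - A n) / dB - L) * dB = (A (Suc n) - A n) - L * dB"
      using dB by (simp add: field_simps)
    finally have "\<bar>(A (Suc n) - A n) - L * dB\<bar> \<le> \<epsilon> / 2 * dB" .
    moreover have "(A (Suc n) - L * B (Suc n)) - (A N0 - L * B N0) =
        ((A n - L * B n) - (A N0 - L * B N0)) + ((A (Suc n) - A n) - L * dB)"
      by (simp add: dB_def algebra_simps)
    moreover have "\<epsilon> / 2 * (B (Suc n) - B N0) = \<epsilon> / 2 * (B n - B N0) + \<epsilon> / 2 * dB"
      by (simp add: dB_def field_simps)
    ultimately show ?case using step.IH by linarith
  qed simp
  have "\<forall>\<^sub>F n in sequentially. B n > 2 * K / \<epsilon> + 1"
    using B by (auto simp: filterlim_at_top_dense)
  then have "\<forall>\<^sub>F n in sequentially. norm (A n / B n - L) < \<epsilon>"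
    using eventually_ge_at_top[of N0]
  proof eventually_elim
    case (elim n)
    have K0: "K \<ge> 0" using e by (simp add: K_def)
    then have Bn: "B n > 0" using elim e by (smt (verit) divide_nonneg_pos)
    have "\<bar>A n - L * B n\<bar> \<le> K + \<epsilon> / 2 * B n"
      using tele[OF elim(2)] e unfolding K_def right_diff_distrib
      by (smt (verit) mult_left_mono divide_pos_pos mult_minus_right)
    moreover have "K < \<epsilon> / 2 * B n" using elim(1) e by (simp add: field_simps)
    ultimately have "\<bar>A n - L * B n\<bar> < \<epsilon> * B n" by (simp add: field_simps)
    moreover have "A n / B n - L = (A n - L * B n) / B n" using Bn by (simp add: field_simps)
    ultimately show ?case using Bn by (simp add: abs_divide field_simps)
  qed
  then show "\<exists>no. \<forall>n\<ge>no. norm (A n / B n - L) < \<epsilon>" by (simp add: eventually_sequentially)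
qed

lemma filterlim_nat_floor: "filterlim (\<lambda>x::real. nat \<lfloor>x\<rfloor>) sequentially at_top"
  by real_asymp

context modulus
begin

definition recip_sum :: "nat \<Rightarrow> nat \<Rightarrow> real" where
  "recip_sum a n = (\<Sum>p | prime p \<and> p \<le> n \<and> [p = a] (mod M). 1 / real p)"

lemma sum_primes_Suc:
  "(\<Sum>p | prime p \<and> p \<le> Suc n \<and> [p = a] (mod M). f p) =
   (\<Sum>p | prime p \<and> p \<le> n \<and> [p = a] (mod M). f p) + (if prime (Suc n) \<and> [Suc n = a] (mod M) then f (Suc n) else (0::real))"
proof -
  have "{p. prime p \<and> p \<le> Suc n \<and> [p = a] (mod M)} =
    {p. prime p \<and> p \<le> n \<and> [p = a] (mod M)} \<union> (if prime (Suc n) \<and> [Suc n = a] (mod M) then {Suc n} else {})"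
    by (auto simp: le_Suc_eq)
  then show ?thesis by (cases "prime (Suc n) \<and> [Suc n = a] (mod M)") auto
qed

lemma recip_sum_asymp_nat:
  assumes a: "coprime a M"
  shows "(\<lambda>n. recip_sum a n / ln (ln (real n))) \<longlonglongrightarrow> 1 / real (totient M)"
proof -
  \<comment> \<open>Chosen so that 1/p = ln p * g(p) at primes, which makes the reciprocal sum an
    Abel transform of \<open>theta\<close>.\<close>
  define g where "g n = 1 / (real n * ln (real n))" for n
  define A where "A n = (\<Sum>k\<le>n. theta a k * (g k - g (Suc k)))" for n
  have step: "recip_sum a (Suc n) - recip_sum a n = (theta a (Suc n) - theta a n) * g (Suc n)" for n
  proof -
    have "ln (real (Suc n)) \<noteq> 0" if "prime (Suc n)" using prime_gt_1_nat[OF that] by simp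
    then show ?thesis unfolding recip_sum_def theta_def sum_primes_Suc by (auto simp: g_def)
  qed
  have "recip_sum a n = A n + theta a n * g (Suc n)" for n
  proof (induction n)
    case 0
    have e: "{p. prime p \<and> p \<le> 0 \<and> [p = a] (mod M)} = {}" by auto
    show ?case unfolding recip_sum_def theta_def A_def e by simp
  next
    case (Suc n)
    have "A (Suc n) = A n + theta a (Suc n) * (g (Suc n) - g (Suc (Suc n)))" by (simp add: A_def)
    then show ?case using step[of n] Suc by (simp add: algebra_simps)
  qed
  then have split: "recip_sum a n / ln (ln (real n)) = A n / ln (ln (real n)) +
      theta a n / real n * (real n * g (Suc n) / ln (ln (real n)))" for n
    by (cases "n = 0") (auto simp: add_divide_distrib theta_def)
  have lA: "(\<lambda>n. A n / ln (ln (real n))) \<longlonglongrightarrow> 1 / real (totient M)"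
  proof (rule stolz_cesaro)
    show "filterlim (\<lambda>n. ln (ln (real n))) at_top sequentially" by real_asymp
    show "\<forall>\<^sub>F n in sequentially. ln (ln (real n)) < ln (ln (real (Suc n)))"
      using eventually_gt_at_top[of 1] by eventually_elim simp
    have th: "(\<lambda>n. theta a (Suc n) / real (Suc n)) \<longlonglongrightarrow> 1 / real (totient M)"
      using theta_AP[OF a] by (rule LIMSEQ_Suc)
    have "(\<lambda>n. real (Suc n) * (g (Suc n) - g (Suc (Suc n))) / (ln (ln (real (Suc n))) - ln (ln (real n)))) \<longlonglongrightarrow> 1"
      unfolding g_def by real_asymp
    from tendsto_mult[OF th this]
    have "(\<lambda>n. theta a (Suc n) / real (Suc n) * (real (Suc n) * (g (Suc n) - g (Suc (Suc n))) / (ln (ln (real (Suc n))) - ln (ln (real n))))) \<longlonglongrightarrow> 1 / real (totient M)"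
      by simp
    moreover have "theta a (Suc n) / real (Suc n) * (real (Suc n) * (g (Suc n) - g (Suc (Suc n))) / (ln (ln (real (Suc n))) - ln (ln (real n)))) =
        (A (Suc n) - A n) / (ln (ln (real (Suc n))) - ln (ln (real n)))" for n
      by (simp add: A_def)
    ultimately show "(\<lambda>n. (A (Suc n) - A n) / (ln (ln (real (Suc n))) - ln (ln (real n)))) \<longlonglongrightarrow> 1 / real (totient M)"
      by (simp only:)
  qed
  have "(\<lambda>n. real n * g (Suc n) / ln (ln (real n))) \<longlonglongrightarrow> 0" unfolding g_def by real_asymp
  from tendsto_add[OF lA tendsto_mult[OF theta_AP[OF a] this]] show ?thesis unfolding split by simp
qed

lemma recip_sum_asymp:
  assumes a: "coprime a M"
  shows "((\<lambda>x. recip_sum a (nat \<lfloor>x\<rfloor>) / ln (ln x)) \<longlongrightarrow> 1 / real (totient M)) at_top"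
proof -
  have 1: "((\<lambda>x::real. recip_sum a (nat \<lfloor>x\<rfloor>) / ln (ln (real (nat \<lfloor>x\<rfloor>)))) \<longlongrightarrow> 1 / real (totient M)) at_top"
    using filterlim_compose[OF recip_sum_asymp_nat[OF a] filterlim_nat_floor] .
  have 2: "((\<lambda>x. ln (ln (real (nat \<lfloor>x\<rfloor>))) / ln (ln x)) \<longlongrightarrow> 1) at_top" by real_asymp
  have "\<forall>\<^sub>F x in at_top. recip_sum a (nat \<lfloor>x\<rfloor>) / ln (ln (real (nat \<lfloor>x\<rfloor>))) * (ln (ln (real (nat \<lfloor>x\<rfloor>))) / ln (ln x)) =
      recip_sum a (nat \<lfloor>x\<rfloor>) / ln (ln x)"
  proof -
    have "\<forall>\<^sub>F x in at_top. ln (ln (real (nat \<lfloor>x::real\<rfloor>))) > 0" by real_asymp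
    then show ?thesis by eventually_elim simp
  qed
  from Lim_transform_eventually[OF tendsto_mult[OF 1 2] this] show ?thesis by simp
qed

text \<open>Unlike the limit, this bound also holds for small x, where the finitely many early
  values go into \<open>K\<close>.\<close>

lemma theta_error:
  assumes a: "coprime a M" and e: "\<epsilon> > 0"
  obtains K where "\<And>x. x \<ge> 1 \<Longrightarrow> \<bar>theta a (nat \<lfloor>x\<rfloor>) - x / real (totient M)\<bar> \<le> \<epsilon> * x + K"
proof -
  define \<phi> where "\<phi> = real (totient M)"
  have phi: "\<phi> \<ge> 1" using M by (simp add: \<phi>_def Suc_le_eq)
  have "\<forall>\<^sub>F n in sequentially. \<bar>theta a n / real n - 1 / \<phi>\<bar> < \<epsilon>"
    using tendstoD[OF theta_AP[OF a] e] by (simp add: dist_real_def \<phi>_def)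
  then obtain N0 where N0: "\<And>n. n \<ge> N0 \<Longrightarrow> \<bar>theta a n / real n - 1 / \<phi>\<bar> < \<epsilon>"
    by (auto simp: eventually_sequentially)
  \<comment> \<open>The extra 1 pays for replacing x by its integer part in the main term.\<close>
  define K where "K = (\<Sum>n\<le>N0. \<bar>theta a n - real n / \<phi>\<bar>) + 1"
  have nat: "\<bar>theta a n - real n / \<phi>\<bar> \<le> \<epsilon> * real n + (K - 1)" for n
  proof (cases "n \<ge> N0 \<and> n > 0")
    case True
    have "\<bar>theta a n - real n / \<phi>\<bar> = \<bar>(theta a n / real n - 1 / \<phi>) * real n\<bar>"
      using True by (simp add: algebra_simps)
    also have "\<dots> = \<bar>theta a n / real n - 1 / \<phi>\<bar> * real n" by (simp add: abs_mult)
    also have "\<dots> \<le> \<epsilon> * real n" using N0[of n] True by (intro mult_right_mono) auto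
    also have "\<dots> \<le> \<epsilon> * real n + (K - 1)" unfolding K_def by (simp add: sum_nonneg)
    finally show ?thesis .
  next
    case False
    then have "\<bar>theta a n - real n / \<phi>\<bar> \<le> (\<Sum>n\<le>N0. \<bar>theta a n - real n / \<phi>\<bar>)"
      by (intro member_le_sum) auto
    then show ?thesis using e unfolding K_def by (simp add: add_increasing)
  qed
  have "\<bar>theta a (nat \<lfloor>x\<rfloor>) - x / \<phi>\<bar> \<le> \<epsilon> * x + K" if x: "x \<ge> 1" for x
  proof -
    define n where "n = nat \<lfloor>x\<rfloor>"
    have n: "real n \<le> x" "x - 1 \<le> real n" using x by (auto simp: n_def)
    have "\<bar>real n / \<phi> - x / \<phi>\<bar> = \<bar>x - real n\<bar> / \<phi>"
      using phi by (simp add: diff_divide_distrib[symmetric] abs_minus_commute)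
    also have "\<dots> \<le> 1 / 1" using n phi by (intro frac_le) auto
    finally have "\<bar>real n / \<phi> - x / \<phi>\<bar> \<le> 1" by simp
    moreover have "\<epsilon> * real n \<le> \<epsilon> * x" using n e by (intro mult_left_mono) auto
    ultimately show ?thesis using nat[of n] unfolding n_def by linarith
  qed
  then show ?thesis using that unfolding \<phi>_def by blast
qed

end

section \<open>Squarefree numbers with a prescribed pattern\<close>

lemma ln_squarefree:
  fixes N :: nat assumes N: "N > 0" "squarefree N"
  shows "ln (real N) = (\<Sum>p | prime p \<and> p dvd N. ln (real p))"
proof -
  have pf: "{p. prime p \<and> p dvd N} = prime_factors N" using N by (auto simp: prime_factors_dvd)
  have "(\<Prod>p\<in>prime_factors N. p) = (\<Prod>p\<in>prime_factors N. p ^ multiplicity p N)"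
  proof (rule prod.cong[OF refl])
    fix p assume p: "p \<in> prime_factors N"
    then have "multiplicity p N \<le> 1" using N by (auto simp: squarefree_factorial_semiring'')
    moreover have "multiplicity p N > 0" using p by (simp add: prime_factors_multiplicity)
    ultimately have "multiplicity p N = 1" by simp
    then show "p = p ^ multiplicity p N" by simp
  qed
  also have "\<dots> = N" using prod_prime_factors[of N] N by simp
  finally have "(\<Prod>p\<in>prime_factors N. p) = N" .
  then have "real N = (\<Prod>p\<in>prime_factors N. real p)"
    using of_nat_prod[of "\<lambda>p. p" "prime_factors N", where 'a = real] by simp
  then have "ln (real N) = ln (\<Prod>p\<in>prime_factors N. real p)" by simp
  also have "\<dots> = (\<Sum>p\<in>prime_factors N. ln (real p))"
    by (intro ln_prod) (auto intro: prime_gt_0_nat)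
  finally show ?thesis unfolding pf .
qed

lemma ln_le_eps:
  fixes y :: real assumes "y \<ge> 1" "e > 0" shows "ln y \<le> e * y + \<bar>ln e\<bar>"
proof -
  have "ln (e * y) \<le> e * y - 1" using assms by (intro ln_le_minus_one) auto
  then show ?thesis using assms by (simp add: ln_mult)
qed

locale residue_reps =
  fixes M :: nat and r :: "nat \<Rightarrow> int"
  assumes M3: "M \<ge> 3" and reps: "unit_representatives M r"

sublocale residue_reps \<subseteq> modulus M
  by unfold_locales (use M3 in simp)

context residue_reps
begin

definition cls :: "nat \<Rightarrow> nat \<Rightarrow> bool" where
  "cls i p \<longleftrightarrow> prime p \<and> [int p = r i] (mod int M)"

text \<open>A natural representative, needed because \<open>r i\<close> may be negative while the
  theorems above speak of natural residues.\<close>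

definition rep :: "nat \<Rightarrow> nat" where "rep i = nat (r i mod int M)"

lemma cls_iff: "cls i p \<longleftrightarrow> prime p \<and> [p = rep i] (mod M)"
proof -
  have "int (rep i) = r i mod int M" using M0 by (simp add: rep_def)
  then have "[int p = int (rep i)] (mod int M) \<longleftrightarrow> [int p = r i] (mod int M)" by (simp add: cong_def)
  then show ?thesis by (simp add: cls_def cong_int_iff)
qed

lemma coprime_rep:
  assumes "i \<in> {1..totient M}" shows "coprime (rep i) M"
proof -
  have "coprime (r i) (int M)" using reps assms by (simp add: unit_representatives_def)
  then have "coprime (r i mod int M) (int M)" using M0 by simp
  then have "coprime (int (rep i)) (int M)" using M0 by (simp add: rep_def)
  then show ?thesis by (simp only: coprime_int_iff)
qed

lemma cls_coprime: "i \<in> {1..totient M} \<Longrightarrow> cls i p \<Longrightarrow> coprime p M"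
  using coprime_rep cong_imp_coprime cong_sym unfolding cls_iff by blast

lemma cls_ex1:
  assumes "prime p" "coprime p M" shows "\<exists>!i. i \<in> {1..totient M} \<and> cls i p"
proof -
  have "coprime (int p) (int M)" using assms by simp
  then have "\<exists>!i. i \<in> {1..totient M} \<and> [r i = int p] (mod int M)"
    using reps unfolding unit_representatives_def by blast
  then show ?thesis using assms(1) by (simp add: cls_def cong_sym_eq[of "int p"])
qed

lemma cls_unique:
  assumes "i \<in> {1..totient M}" "j \<in> {1..totient M}" "cls i p" "cls j p" shows "i = j"
  using cls_ex1[of p] cls_coprime[OF assms(1,3)] assms by (auto simp: cls_def)

section \<open>Patterns and the removal of one prime\<close>

definition pdiv :: "nat \<Rightarrow> nat \<Rightarrow> nat set" where "pdiv i N = {p. cls i p \<and> p dvd N}"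

definition pat :: "(nat \<Rightarrow> nat) \<Rightarrow> nat set" where
  "pat a = {N. N > 0 \<and> squarefree N \<and> coprime N M \<and> (\<forall>i\<in>{1..totient M}. card (pdiv i N) = a i)}"

definition spat :: "(nat \<Rightarrow> nat) \<Rightarrow> real \<Rightarrow> nat set" where "spat a x = {N \<in> pat a. real N \<le> x}"

lemma squarefree_with_pattern_eq: "squarefree_with_pattern M r a x = spat a x"
proof -
  have "num_prime_divisors M (r i) N = card (pdiv i N)" for i N
    unfolding num_prime_divisors_def pdiv_def cls_def by (rule arg_cong[where f = card]) auto
  then show ?thesis by (auto simp: squarefree_with_pattern_def spat_def pat_def)
qed

lemma finite_pdiv: "N > 0 \<Longrightarrow> finite (pdiv i N)"
  unfolding pdiv_def by (rule finite_subset[of _ "{..N}"]) (auto dest: dvd_imp_le)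

lemma finite_spat [simp]: "finite (spat a x)"
  by (rule finite_subset[of _ "{..nat \<lfloor>x\<rfloor>}"]) (auto simp: spat_def le_nat_floor)

lemma patD: "N \<in> pat a \<Longrightarrow> N > 0" "N \<in> pat a \<Longrightarrow> i \<in> {1..totient M} \<Longrightarrow> card (pdiv i N) = a i"
  by (auto simp: pat_def)

lemma spatD: "N \<in> spat a x \<Longrightarrow> N \<in> pat a" "N \<in> spat a x \<Longrightarrow> real N \<le> x" "N \<in> spat a x \<Longrightarrow> N > 0"
  by (auto simp: spat_def pat_def)

lemma pdiv_mult:
  assumes i: "i \<in> {1..totient M}" "j \<in> {1..totient M}" and p: "cls i p"
  shows "pdiv j (p * N) = (if j = i then insert p (pdiv j N) else pdiv j N)"
proof -
  have dvd: "q dvd p * N \<longleftrightarrow> q = p \<or> q dvd N" if "cls j q" for q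
    using that p by (auto simp: cls_def prime_dvd_mult_iff primes_dvd_imp_eq)
  show ?thesis
  proof (cases "j = i")
    case True
    then show ?thesis using dvd p unfolding pdiv_def by (intro equalityI subsetI) auto
  next
    case False
    then have "\<not> cls j p" using cls_unique[OF i(2,1) _ p] by blast
    then have "cls j q \<and> q dvd p * N \<longleftrightarrow> cls j q \<and> q dvd N" for q using dvd by blast
    then show ?thesis using False unfolding pdiv_def by simp
  qed
qed

text \<open>A new prime of class \<open>i\<close> raises only the i-th count. The condition
  \<open>a i > 0\<close> guards the truncated subtraction.\<close>

lemma pat_mult:
  assumes i: "i \<in> {1..totient M}" and p: "cls i p" and N: "\<not> p dvd N" "N > 0"
  shows "p * N \<in> pat a \<longleftrightarrow> a i > 0 \<and> N \<in> pat (a(i := a i - 1))"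
proof -
  have pp: "prime p" "p > 0" using p by (auto simp: cls_def prime_gt_0_nat)
  have "coprime p N" using pp N by (simp add: prime_imp_coprime)
  then have sq: "squarefree (p * N) \<longleftrightarrow> squarefree N"
    using squarefree_mult_coprime[of p N] squarefree_mono[of N "p * N"] squarefree_prime[of p] pp by auto
  have cp: "coprime (p * N) M \<longleftrightarrow> coprime N M" using cls_coprime[OF i p] by simp
  have "p \<notin> pdiv i N" using N by (simp add: pdiv_def)
  then have card: "card (pdiv j (p * N)) = (if j = i then Suc (card (pdiv j N)) else card (pdiv j N))"
    if "j \<in> {1..totient M}" for j
    using pdiv_mult[OF i that p, of N] finite_pdiv[OF N(2)] by auto
  have "(\<forall>j\<in>{1..totient M}. card (pdiv j (p * N)) = a j) \<longleftrightarrow>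
      (a i > 0 \<and> (\<forall>j\<in>{1..totient M}. card (pdiv j N) = (a(i := a i - 1)) j))"
    using i card by (auto split: if_splits)
  then show ?thesis using sq cp pp N by (auto simp: pat_def)
qed

lemma pat_div:
  assumes N: "N \<in> pat a" and p: "p \<in> pdiv i N"
  shows "N = p * (N div p)" "\<not> p dvd N div p" "N div p > 0" "cls i p"
proof -
  show c: "cls i p" and e: "N = p * (N div p)" using p by (auto simp: pdiv_def)
  then have pp: "prime p" by (simp add: cls_def)
  show "N div p > 0" using e patD(1)[OF N] by (metis mult_0_right neq0_conv)
  show "\<not> p dvd N div p"
  proof
    assume "p dvd N div p"
    then have "p * p dvd N" using e by (metis dvd_refl mult_dvd_mono)
    moreover have "squarefree N" using N by (simp add: pat_def)
    ultimately have "p dvd 1" using squarefreeD[of N p] by (simp add: power2_eq_square)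
    then show False using pp by simp
  qed
qed

text \<open>The primes of class \<open>i\<close> that may be appended to a squarefree
  \<open>N\<close> so that the product stays squarefree and at most \<open>x\<close>.\<close>

definition cofac :: "nat \<Rightarrow> nat \<Rightarrow> real \<Rightarrow> nat set" where
  "cofac i N x = {p. cls i p \<and> \<not> p dvd N \<and> real p * real N \<le> x}"

lemma finite_cofac: "N > 0 \<Longrightarrow> finite (cofac i N x)"
proof (rule finite_subset)
  assume N: "N > 0"
  show "cofac i N x \<subseteq> {..nat \<lfloor>x\<rfloor>}"
  proof
    fix p assume "p \<in> cofac i N x"
    then have "real p * real N \<le> x" by (simp add: cofac_def)
    moreover have "real p * 1 \<le> real p * real N" using N by (intro mult_left_mono) auto
    ultimately show "p \<in> {..nat \<lfloor>x\<rfloor>}" by (simp add: le_nat_floor)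
  qed
qed simp

text \<open>The pairs (N, p) correspond to (N/p, p). The weight \<open>h\<close> is left open
  because the identity is used with 1/(p N) for reciprocal sums and with ln p for logarithmic
  ones.\<close>

lemma pattern_double_sum:
  fixes h :: "nat \<Rightarrow> nat \<Rightarrow> real"
  assumes i: "i \<in> {1..totient M}" and ai: "a i > 0"
  shows "(\<Sum>N\<in>spat a x. \<Sum>p\<in>pdiv i N. h p (N div p)) =
         (\<Sum>N\<in>spat (a(i := a i - 1)) x. \<Sum>p\<in>cofac i N x. h p N)"
proof -
  have "(\<Sum>N\<in>spat a x. \<Sum>p\<in>pdiv i N. h p (N div p)) = (\<Sum>(N, p)\<in>Sigma (spat a x) (pdiv i). h p (N div p))"
    by (rule sum.Sigma) (auto intro: finite_pdiv dest: spatD)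
  also have "\<dots> = (\<Sum>(N, p)\<in>Sigma (spat (a(i := a i - 1)) x) (\<lambda>N. cofac i N x). h p N)"
  proof -
    obtain b where b: "b = a(i := a i - 1)" by blast
    have to: "p * (N div p) = N \<and> N div p \<in> spat b x \<and> p \<in> cofac i (N div p) x"
      if N: "N \<in> spat a x" and p: "p \<in> pdiv i N" for N p
    proof -
      note d = pat_div[OF spatD(1)[OF N] p]
      have 1: "N div p \<in> pat b"
        using pat_mult[OF i d(4,2,3), of a] spatD(1)[OF N] d(1) unfolding b by simp
      have "real (N div p) \<le> real N" by simp
      then have 2: "real (N div p) \<le> x" using spatD(2)[OF N] by linarith
      have "real p * real (N div p) = real N" using d(1) by (metis of_nat_mult)
      then have "N div p \<in> spat b x" "p \<in> cofac i (N div p) x"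
        using 1 2 d spatD(2)[OF N] by (simp_all add: spat_def cofac_def)
      then show ?thesis using d(1) by simp
    qed
    have fro: "p * N div p = N \<and> p * N \<in> spat a x \<and> p \<in> pdiv i (p * N)"
      if N: "N \<in> spat b x" and p: "p \<in> cofac i N x" for N p
    proof -
      have c: "cls i p" "\<not> p dvd N" "real p * real N \<le> x" using p by (auto simp: cofac_def)
      have p0: "p > 0" using c(1) by (simp add: cls_def prime_gt_0_nat)
      have "p * N \<in> pat a" using pat_mult[OF i c(1,2) spatD(3)[OF N], of a] ai spatD(1)[OF N] unfolding b by simp
      then show ?thesis using c p0 by (simp add: spat_def pdiv_def)
    qed
    show ?thesis unfolding b[symmetric]
      by (rule sum.reindex_bij_witness[where i = "\<lambda>(N, p). (p * N, p)" and j = "\<lambda>(N, p). (N div p, p)"])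
         (auto simp: to fro)
  qed
  also have "\<dots> = (\<Sum>N\<in>spat (a(i := a i - 1)) x. \<Sum>p\<in>cofac i N x. h p N)"
    by (rule sum.Sigma[symmetric]) (auto intro: finite_cofac dest: spatD)
  finally show ?thesis .
qed

section \<open>Reciprocal sums over a pattern\<close>

definition rsum :: "(nat \<Rightarrow> nat) \<Rightarrow> real \<Rightarrow> real" where
  "rsum a x = (\<Sum>N\<in>spat a x. 1 / real N)"

definition prec :: "nat \<Rightarrow> real \<Rightarrow> real" where "prec i x = recip_sum (rep i) (nat \<lfloor>x\<rfloor>)"

lemma prec_eq: "prec i x = (\<Sum>p | cls i p \<and> p \<le> nat \<lfloor>x\<rfloor>. 1 / real p)"
  unfolding prec_def recip_sum_def by (rule sum.cong) (auto simp: cls_iff)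

text \<open>Each number of pattern \<open>a\<close> arises once for each of its \<open>a i\<close>
  primes of class \<open>i\<close>.\<close>

lemma rsum_rec:
  assumes "i \<in> {1..totient M}" "a i > 0"
  shows "real (a i) * rsum a x = (\<Sum>N\<in>spat (a(i := a i - 1)) x. 1 / real N * (\<Sum>p\<in>cofac i N x. 1 / real p))"
proof -
  have "real (a i) * rsum a x = (\<Sum>N\<in>spat a x. \<Sum>p\<in>pdiv i N. 1 / (real p * real (N div p)))"
    unfolding rsum_def sum_distrib_left
  proof (rule sum.cong[OF refl])
    fix N assume N: "N \<in> spat a x"
    have "(\<Sum>p\<in>pdiv i N. 1 / (real p * real (N div p))) = (\<Sum>p\<in>pdiv i N. 1 / real N)"
      using pat_div(1)[OF spatD(1)[OF N]] by (intro sum.cong refl) (metis of_nat_mult)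
    also have "\<dots> = real (a i) * (1 / real N)" using patD(2)[OF spatD(1)[OF N] assms(1)] by simp
    finally show "real (a i) * (1 / real N) = (\<Sum>p\<in>pdiv i N. 1 / (real p * real (N div p)))" by simp
  qed
  also have "\<dots> = (\<Sum>N\<in>spat (a(i := a i - 1)) x. \<Sum>p\<in>cofac i N x. 1 / (real p * real N))"
    by (rule pattern_double_sum[of i a, OF assms])
  also have "\<dots> = (\<Sum>N\<in>spat (a(i := a i - 1)) x. 1 / real N * (\<Sum>p\<in>cofac i N x. 1 / real p))"
    by (intro sum.cong refl) (simp add: sum_distrib_left mult.commute)
  finally show ?thesis .
qed

text \<open>The condition that p does not divide N is dropped, and p N <= x is relaxed to p <=
  x.\<close>

lemma rsum_upper:
  assumes "i \<in> {1..totient M}" "a i > 0"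
  shows "real (a i) * rsum a x \<le> rsum (a(i := a i - 1)) x * prec i x"
  unfolding rsum_rec[of i a x, OF assms] rsum_def[of "a(i := a i - 1)"] sum_distrib_right
proof (intro sum_mono mult_left_mono)
  fix N assume N: "N \<in> spat (a(i := a i - 1)) x"
  have "cofac i N x \<subseteq> {p. cls i p \<and> p \<le> nat \<lfloor>x\<rfloor>}"
  proof
    fix p assume "p \<in> cofac i N x"
    then have p: "cls i p" "real p * real N \<le> x" by (auto simp: cofac_def)
    have "real p * 1 \<le> real p * real N" using spatD(3)[OF N] by (intro mult_left_mono) auto
    then show "p \<in> {p. cls i p \<and> p \<le> nat \<lfloor>x\<rfloor>}" using p by (simp add: le_nat_floor)
  qed
  then show "(\<Sum>p\<in>cofac i N x. 1 / real p) \<le> prec i x"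
    unfolding prec_eq by (intro sum_mono2) auto
qed auto

text \<open>If \<open>N\<close> and \<open>p\<close> are at most \<open>sqrt x\<close>, then \<open>p N \<le> x\<close>; the primes dividing \<open>N\<close> cost at most \<open>a i\<close>, which is
  negligible against the divergent sum over all \<open>p\<close>.\<close>

lemma rsum_lower:
  assumes i: "i \<in> {1..totient M}" "a i > 0" and x: "x \<ge> 1"
  shows "rsum (a(i := a i - 1)) (sqrt x) * (prec i (sqrt x) - real (a i)) \<le> real (a i) * rsum a x"
proof -
  let ?b = "a(i := a i - 1)" and ?y = "sqrt x"
  have yy: "?y * ?y = x" "?y \<ge> 1" using x by auto
  have "?y * 1 \<le> ?y * ?y" using yy by (intro mult_left_mono) auto
  then have yx: "?y \<le> x" using yy by simp
  have "rsum ?b ?y * (prec i ?y - real (a i)) \<le> (\<Sum>N\<in>spat ?b ?y. 1 / real N * (\<Sum>p\<in>cofac i N x. 1 / real p))"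
    unfolding rsum_def sum_distrib_right
  proof (intro sum_mono mult_left_mono)
    fix N assume N: "N \<in> spat ?b ?y"
    note N0 = spatD(3)[OF N]
    have sub: "{p. cls i p \<and> p \<le> nat \<lfloor>?y\<rfloor>} \<subseteq> cofac i N x \<union> pdiv i N"
    proof
      fix p assume p: "p \<in> {p. cls i p \<and> p \<le> nat \<lfloor>?y\<rfloor>}"
      then have "real p \<le> real (nat \<lfloor>?y\<rfloor>)" by simp
      also have "\<dots> \<le> ?y" using yy by (intro of_nat_floor) auto
      finally have "real p \<le> ?y" .
      then have "real p * real N \<le> ?y * ?y" using spatD(2)[OF N] yy by (intro mult_mono) auto
      then show "p \<in> cofac i N x \<union> pdiv i N" using p yy by (auto simp: cofac_def pdiv_def)
    qed
    have "prec i ?y \<le> (\<Sum>p\<in>cofac i N x \<union> pdiv i N. 1 / real p)"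
      unfolding prec_eq by (rule sum_mono2) (use sub finite_cofac finite_pdiv N0 in auto)
    also have "\<dots> \<le> (\<Sum>p\<in>cofac i N x. 1 / real p) + (\<Sum>p\<in>pdiv i N. 1 / real p)"
      using sum.union_inter[OF finite_cofac[OF N0] finite_pdiv[OF N0], of "\<lambda>p. 1 / real p" i x i]
        sum_nonneg[of "cofac i N x \<inter> pdiv i N" "\<lambda>p. 1 / real p"] by simp
    also have "(\<Sum>p\<in>pdiv i N. 1 / real p) \<le> (\<Sum>p\<in>pdiv i N. 1)"
      by (intro sum_mono) (auto simp: pdiv_def cls_def dest: prime_gt_0_nat)
    also have "\<dots> \<le> real (a i)" using patD(2)[OF spatD(1)[OF N] i(1)] by simp
    finally show "prec i ?y - real (a i) \<le> (\<Sum>p\<in>cofac i N x. 1 / real p)" by simp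
  qed auto
  also have "\<dots> \<le> (\<Sum>N\<in>spat ?b x. 1 / real N * (\<Sum>p\<in>cofac i N x. 1 / real p))"
  proof (rule sum_mono2)
    show "spat ?b ?y \<subseteq> spat ?b x" using yx by (auto simp: spat_def)
  qed (auto intro!: sum_nonneg divide_nonneg_nonneg)
  also have "\<dots> = real (a i) * rsum a x" by (rule rsum_rec[of i a x, OF i, symmetric])
  finally show ?thesis .
qed

definition psize :: "(nat \<Rightarrow> nat) \<Rightarrow> nat" where "psize a = (\<Sum>i=1..totient M. a i)"

text \<open>The limiting constant of the reciprocal sums: a factor 1/m for each prime, and the
  factorials for the orderings within each class.\<close>

definition pconst :: "(nat \<Rightarrow> nat) \<Rightarrow> real" where
  "pconst a = 1 / (real (totient M) ^ psize a * (\<Prod>i=1..totient M. fact (a i)))"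

lemma psize_dec:
  assumes "i \<in> {1..totient M}" "a i > 0" shows "psize a = Suc (psize (a(i := a i - 1)))"
proof -
  have "psize a = a i + (\<Sum>j\<in>{1..totient M} - {i}. a j)"
    unfolding psize_def using assms by (intro sum.remove) auto
  moreover have "psize (a(i := a i - 1)) = (a i - 1) + (\<Sum>j\<in>{1..totient M} - {i}. a j)"
    unfolding psize_def using assms by (subst sum.remove[of _ i]) auto
  ultimately show ?thesis using assms(2) by simp
qed

lemma pconst_dec:
  assumes i: "i \<in> {1..totient M}" "a i > 0"
  shows "pconst (a(i := a i - 1)) / real (totient M) = real (a i) * pconst a"
proof -
  have f: "(fact (a i) :: real) = real (a i) * fact (a i - 1)" using i(2) by (simp add: fact_reduce)
  have "(\<Prod>j=1..totient M. fact (a j) :: real) = fact (a i) * (\<Prod>j\<in>{1..totient M} - {i}. fact (a j))"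
    using i by (intro prod.remove) auto
  moreover have "(\<Prod>j=1..totient M. fact ((a(i := a i - 1)) j) :: real) = fact (a i - 1) * (\<Prod>j\<in>{1..totient M} - {i}. fact (a j))"
    using i by (subst prod.remove[of _ i]) auto
  ultimately have "(\<Prod>j=1..totient M. fact (a j) :: real) = real (a i) * (\<Prod>j=1..totient M. fact ((a(i := a i - 1)) j))"
    by (simp only: f mult.assoc)
  then show ?thesis unfolding pconst_def psize_dec[of i a, OF i] using i(2) by simp
qed

lemma spat_psize_0:
  assumes "psize a = 0" shows "spat a x \<subseteq> {1}" "x \<ge> 1 \<Longrightarrow> spat a x = {1}"
proof -
  have a0: "a i = 0" if "i \<in> {1..totient M}" for i using assms that by (auto simp: psize_def)
  have "N = 1" if N: "N \<in> pat a" for N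
  proof (rule ccontr)
    assume "N \<noteq> 1"
    then obtain p where p: "prime p" "p dvd N" using prime_factor_nat by blast
    have "coprime p M" using N p(2) by (auto simp: pat_def intro: coprime_divisors)
    then obtain i where i: "i \<in> {1..totient M}" "cls i p" using cls_ex1[OF p(1)] by blast
    then have "p \<in> pdiv i N" using p by (simp add: pdiv_def)
    moreover have "card (pdiv i N) = 0" using patD(2)[OF N i(1)] a0[OF i(1)] by simp
    ultimately show False using finite_pdiv[OF patD(1)[OF N], of i] by auto
  qed
  then show "spat a x \<subseteq> {1}" by (auto simp: spat_def)
  have "pdiv i (Suc 0) = {}" for i by (auto simp: pdiv_def cls_def)
  then have "1 \<in> pat a" using a0 by (simp add: pat_def)
  then show "spat a x = {1}" if "x \<ge> 1" using \<open>spat a x \<subseteq> {1}\<close> that by (auto simp: spat_def)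
qed

lemma prec_asymp:
  assumes "i \<in> {1..totient M}"
  shows "((\<lambda>x. prec i x / ln (ln x)) \<longlongrightarrow> 1 / real (totient M)) at_top"
  unfolding prec_def by (rule recip_sum_asymp[OF coprime_rep[OF assms]])

text \<open>Induction on the number of primes, removing one prime of a class that occurs; the upper
  and lower recursions enclose the quotient between expressions with the same limit.\<close>

lemma rsum_asymp: "((\<lambda>x. rsum a x / ln (ln x) ^ psize a) \<longlongrightarrow> pconst a) at_top"
proof (induction "psize a" arbitrary: a)
  case 0
  then have p0: "psize a = 0" by simp
  then have "a i = 0" if "i \<in> {1..totient M}" for i using that by (auto simp: psize_def)
  then have c1: "pconst a = 1" using p0 by (simp add: pconst_def)
  have "\<forall>\<^sub>F x in at_top. 1 = rsum a x / ln (ln x) ^ psize a"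
    using eventually_ge_at_top[of 1]
  proof eventually_elim
    case (elim x)
    then show ?case using spat_psize_0(2)[OF p0 elim] by (simp add: rsum_def p0)
  qed
  from Lim_transform_eventually[OF tendsto_const this] show ?case using c1 by simp
next
  case (Suc n)
  then obtain i where i: "i \<in> {1..totient M}" "a i > 0"
    by (metis gr0I psize_def sum.neutral Zero_not_Suc)
  define b where "b = a(i := a i - 1)"
  have nb: "n = psize b" using Suc.hyps(2) psize_dec[of i a, OF i] by (simp add: b_def)
  have pa: "psize a = Suc n" using Suc.hyps(2) by simp
  have IH: "((\<lambda>x. rsum b x / ln (ln x) ^ n) \<longlongrightarrow> pconst b) at_top" using Suc.hyps(1)[OF nb] nb by simp
  have ai: "real (a i) > 0" using i by simp
  have c: "pconst b * (1 / real (totient M)) / real (a i) = pconst a"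
    using pconst_dec[of i a, OF i] ai by (simp add: b_def)
  have ll: "\<forall>\<^sub>F x in at_top. ln (ln x) > (0::real)" by real_asymp
  have upper: "((\<lambda>x. rsum b x / ln (ln x) ^ n * (prec i x / ln (ln x)) / real (a i)) \<longlongrightarrow> pconst a) at_top"
    using tendsto_divide[OF tendsto_mult[OF IH prec_asymp[OF i(1)]] tendsto_const[of "real (a i)"]] ai c by simp
  have sq: "filterlim sqrt at_top (at_top :: real filter)" by (rule sqrt_at_top)
  have q1: "((\<lambda>x. rsum b (sqrt x) / ln (ln (sqrt x)) ^ n) \<longlongrightarrow> pconst b) at_top"
    using filterlim_compose[OF IH sq] .
  have "((\<lambda>x. prec i (sqrt x) / ln (ln (sqrt x))) \<longlongrightarrow> 1 / real (totient M)) at_top"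
    using filterlim_compose[OF prec_asymp[OF i(1)] sq] .
  moreover have "((\<lambda>x. real (a i) / ln (ln (sqrt x))) \<longlongrightarrow> 0) at_top" by real_asymp
  ultimately have q2: "((\<lambda>x. prec i (sqrt x) / ln (ln (sqrt x)) - real (a i) / ln (ln (sqrt x))) \<longlongrightarrow> 1 / real (totient M) - 0) at_top"
    by (rule tendsto_diff)
  \<comment> \<open>Replacing x by sqrt x lowers ln ln x only by ln 2, so the loss in the lower
    recursion is invisible in the limit.\<close>
  have "((\<lambda>x::real. ln (ln (sqrt x)) / ln (ln x)) \<longlongrightarrow> 1) at_top" by real_asymp
  from tendsto_power[OF this, of "Suc n"]
  have q3: "((\<lambda>x::real. (ln (ln (sqrt x)) / ln (ln x)) ^ Suc n) \<longlongrightarrow> 1) at_top" by simp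
  have q4: "((\<lambda>x. rsum b (sqrt x) / ln (ln (sqrt x)) ^ n * (prec i (sqrt x) / ln (ln (sqrt x)) - real (a i) / ln (ln (sqrt x))) *
      (ln (ln (sqrt x)) / ln (ln x)) ^ Suc n / real (a i)) \<longlongrightarrow> pconst a) at_top"
    using tendsto_divide[OF tendsto_mult[OF tendsto_mult[OF q1 q2] q3] tendsto_const[of "real (a i)"]] ai c by simp
  have lls: "\<forall>\<^sub>F x in at_top. ln (ln (sqrt x)) > (0::real)" by real_asymp
  have "((\<lambda>x. rsum a x / ln (ln x) ^ Suc n) \<longlongrightarrow> pconst a) at_top"
  proof (rule tendsto_sandwich[OF _ _ q4 upper])
    show "\<forall>\<^sub>F x in at_top. rsum b (sqrt x) / ln (ln (sqrt x)) ^ n * (prec i (sqrt x) / ln (ln (sqrt x)) - real (a i) / ln (ln (sqrt x))) *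
      (ln (ln (sqrt x)) / ln (ln x)) ^ Suc n / real (a i) \<le> rsum a x / ln (ln x) ^ Suc n"
      using ll lls eventually_ge_at_top[of 1]
    proof eventually_elim
      case (elim x)
      define u v where "u = ln (ln x)" and "v = ln (ln (sqrt x))"
      have uv: "u > 0" "v > 0" using elim by (auto simp: u_def v_def)
      have "rsum b (sqrt x) * (prec i (sqrt x) - real (a i)) \<le> real (a i) * rsum a x"
        using rsum_lower[of i a x, OF i elim(3)] by (simp add: b_def)
      then have "rsum b (sqrt x) * (prec i (sqrt x) - real (a i)) / (u ^ Suc n * real (a i)) \<le> real (a i) * rsum a x / (u ^ Suc n * real (a i))"
        using uv by (intro divide_right_mono) auto
      moreover have "real (a i) * rsum a x / (u ^ Suc n * real (a i)) = rsum a x / u ^ Suc n" using ai by simp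
      moreover have "rsum b (sqrt x) / v ^ n * (prec i (sqrt x) / v - real (a i) / v) * (v / u) ^ Suc n / real (a i) =
          rsum b (sqrt x) * (prec i (sqrt x) - real (a i)) / (u ^ Suc n * real (a i))"
        using uv by (simp add: power_divide diff_divide_distrib[symmetric])
      ultimately show ?case unfolding u_def v_def by simp
    qed
    show "\<forall>\<^sub>F x in at_top. rsum a x / ln (ln x) ^ Suc n \<le> rsum b x / ln (ln x) ^ n * (prec i x / ln (ln x)) / real (a i)"
      using ll
    proof eventually_elim
      case (elim x)
      define u where "u = ln (ln x)"
      have u: "u > 0" using elim by (simp add: u_def)
      have "real (a i) * rsum a x / (u ^ Suc n * real (a i)) \<le> rsum b x * prec i x / (u ^ Suc n * real (a i))"
        using u rsum_upper[of i a x, OF i] by (intro divide_right_mono) (auto simp: b_def)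
      moreover have "real (a i) * rsum a x / (u ^ Suc n * real (a i)) = rsum a x / u ^ Suc n" using ai by simp
      moreover have "rsum b x * prec i x / (u ^ Suc n * real (a i)) = rsum b x / u ^ n * (prec i x / u) / real (a i)"
        by simp
      ultimately have "rsum a x / u ^ Suc n \<le> rsum b x / u ^ n * (prec i x / u) / real (a i)" by (simp only:)
      then show ?case unfolding u_def .
    qed
  qed
  then show ?case unfolding pa .
qed

section \<open>Logarithmically weighted sums and the final count\<close>

lemma card_spat_le: "x \<ge> 0 \<Longrightarrow> real (card (spat a x)) \<le> x"
proof -
  assume x: "x \<ge> 0"
  have "spat a x \<subseteq> {1..nat \<lfloor>x\<rfloor>}" using spatD(3) by (auto simp: spat_def le_nat_floor Suc_le_eq pat_def)
  then have "card (spat a x) \<le> nat \<lfloor>x\<rfloor>" using card_mono[of "{1..nat \<lfloor>x\<rfloor>}" "spat a x"] by simp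
  then show ?thesis using x by linarith
qed

text \<open>The empty pattern contains only 1, and otherwise the trivial bound x is beaten by a
  power of ln ln x. This is what absorbs the constant \<open>K\<close> of the prime number
  theorem.\<close>

lemma card_spat_small: "((\<lambda>x. real (card (spat a x)) / (x * ln (ln x) ^ psize a)) \<longlongrightarrow> 0) at_top"
proof (cases "psize a = 0")
  case True
  show ?thesis
  proof (rule Lim_null_comparison)
    show "((\<lambda>x::real. 1 / x) \<longlongrightarrow> 0) at_top" by real_asymp
    show "\<forall>\<^sub>F x in at_top. norm (real (card (spat a x)) / (x * ln (ln x) ^ psize a)) \<le> 1 / x"
      using eventually_ge_at_top[of 1] by eventually_elim (use spat_psize_0(2)[OF True] True in simp)
  qed
next
  case False
  show ?thesis
  proof (rule Lim_null_comparison)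
    show "((\<lambda>x::real. 1 / ln (ln x)) \<longlongrightarrow> 0) at_top" by real_asymp
    have "\<forall>\<^sub>F x in at_top. ln (ln x) \<ge> (1::real)" by real_asymp
    then show "\<forall>\<^sub>F x in at_top. norm (real (card (spat a x)) / (x * ln (ln x) ^ psize a)) \<le> 1 / ln (ln x)"
      using eventually_gt_at_top[of 0]
    proof eventually_elim
      case (elim x)
      have "ln (ln x) ^ 1 \<le> ln (ln x) ^ psize a" using elim False by (intro power_increasing) auto
      then have "real (card (spat a x)) / (x * ln (ln x) ^ psize a) \<le> x / (x * ln (ln x))"
        using elim card_spat_le[of x a] by (intro frac_le mult_left_mono) auto
      then show ?case using elim by simp
    qed
  qed
qed

definition tsum :: "nat \<Rightarrow> (nat \<Rightarrow> nat) \<Rightarrow> real \<Rightarrow> real" where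
  "tsum i b x = (\<Sum>N\<in>spat b x. \<Sum>p\<in>cofac i N x. ln (real p))"

text \<open>With y = x / N the sum is \<open>theta\<close> at y minus the primes dividing N. There
  are at most \<open>b i\<close> of those, each contributing at most ln y, which is again of the
  form small * y + constant.\<close>

lemma cofac_sum_error:
  assumes i: "i \<in> {1..totient M}" and e: "e > 0"
  obtains K where "K \<ge> 0" "\<And>N x. N \<in> spat b x \<Longrightarrow>
    \<bar>(\<Sum>p\<in>cofac i N x. ln (real p)) - x / real N / real (totient M)\<bar> \<le> e * (x / real N) + K"
proof -
  \<comment> \<open>Chosen so that the error \<open>d\<close> from \<open>theta\<close> and the
    error \<open>b i * d\<close> from the excluded primes add up to \<open>e\<close>.\<close>
  define d where "d = e / (1 + real (b i))"
  have b1: "1 + real (b i) > 0" by simp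
  then have "d > 0" using e by (simp add: d_def)
  moreover have "(1 + real (b i)) * d = e" using b1 by (simp add: d_def)
  ultimately have d: "d > 0" "d + real (b i) * d = e" by (simp_all add: distrib_right)
  obtain K where K: "\<And>x. x \<ge> 1 \<Longrightarrow> \<bar>theta (rep i) (nat \<lfloor>x\<rfloor>) - x / real (totient M)\<bar> \<le> d * x + K"
    using theta_error[OF coprime_rep[OF i] d(1)] by blast
  define K' where "K' = \<bar>K\<bar> + real (b i) * \<bar>ln d\<bar>"
  have "\<bar>(\<Sum>p\<in>cofac i N x. ln (real p)) - x / real N / real (totient M)\<bar> \<le> e * (x / real N) + K'"
    if N: "N \<in> spat b x" for N x
  proof -
    define y where "y = x / real N"
    note N0 = spatD(3)[OF N]
    have y: "y \<ge> 1" using spatD(2)[OF N] N0 by (simp add: y_def)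
    define E where "E = {p \<in> pdiv i N. p \<le> nat \<lfloor>y\<rfloor>}"
    have le_iff: "p \<le> nat \<lfloor>y\<rfloor> \<longleftrightarrow> real p * real N \<le> x" for p
    proof -
      have "p \<le> nat \<lfloor>y\<rfloor> \<longleftrightarrow> real p \<le> y" using y by (simp add: le_nat_iff le_floor_iff)
      then show ?thesis using N0 by (simp add: y_def field_simps)
    qed
    have "theta (rep i) (nat \<lfloor>y\<rfloor>) = (\<Sum>p\<in>cofac i N x \<union> E. ln (real p))"
      unfolding theta_def by (rule sum.cong) (auto simp: cofac_def E_def pdiv_def cls_iff le_iff)
    also have "\<dots> = (\<Sum>p\<in>cofac i N x. ln (real p)) + (\<Sum>p\<in>E. ln (real p))"
      by (rule sum.union_disjoint) (auto simp: E_def finite_cofac finite_pdiv N0, auto simp: cofac_def pdiv_def)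
    finally have th: "theta (rep i) (nat \<lfloor>y\<rfloor>) = (\<Sum>p\<in>cofac i N x. ln (real p)) + (\<Sum>p\<in>E. ln (real p))" .
    have lnE: "0 \<le> ln (real p)" "ln (real p) \<le> ln y" if "p \<in> E" for p
    proof -
      have p1: "real p \<ge> 1" using that by (auto simp: E_def pdiv_def cls_def Suc_le_eq prime_gt_0_nat)
      have "real p \<le> y" using that y by (simp add: E_def le_nat_iff le_floor_iff)
      then show "0 \<le> ln (real p)" "ln (real p) \<le> ln y" using p1 by auto
    qed
    have E0: "(\<Sum>p\<in>E. ln (real p)) \<ge> 0" by (intro sum_nonneg lnE)
    have "(\<Sum>p\<in>E. ln (real p)) \<le> real (card E) * ln y" by (intro sum_bounded_above lnE)
    also have "\<dots> \<le> real (b i) * (d * y + \<bar>ln d\<bar>)"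
    proof (rule mult_mono)
      have "card E \<le> card (pdiv i N)" unfolding E_def by (intro card_mono finite_pdiv N0) auto
      then show "real (card E) \<le> real (b i)" using patD(2)[OF spatD(1)[OF N] i] by simp
      show "ln y \<le> d * y + \<bar>ln d\<bar>" by (rule ln_le_eps[OF y d(1)])
    qed (use y d in auto)
    finally have E1: "(\<Sum>p\<in>E. ln (real p)) \<le> real (b i) * d * y + real (b i) * \<bar>ln d\<bar>"
      by (simp add: algebra_simps)
    have "\<bar>(\<Sum>p\<in>cofac i N x. ln (real p)) - y / real (totient M)\<bar> \<le> d * y + K + (real (b i) * d * y + real (b i) * \<bar>ln d\<bar>)"
      using K[OF y] th E0 E1 by linarith
    also have "\<dots> \<le> (d + real (b i) * d) * y + K'" unfolding K'_def by (simp add: algebra_simps)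
    finally show ?thesis unfolding d(2) y_def .
  qed
  moreover have "K' \<ge> 0" by (simp add: K'_def)
  ultimately show ?thesis using that by blast
qed

text \<open>The main terms x / (N m) add up to x / m times the reciprocal sum, whose limit is known;
  the error is e times that sum plus \<open>K\<close> times a count of smaller order.\<close>

lemma tsum_asymp:
  assumes i: "i \<in> {1..totient M}"
  shows "((\<lambda>x. tsum i b x / (x * ln (ln x) ^ psize b)) \<longlongrightarrow> pconst b / real (totient M)) at_top"
proof -
  define \<phi> where "\<phi> = real (totient M)"
  define w where "w x = x * ln (ln x) ^ psize b" for x :: real
  have wpos: "\<forall>\<^sub>F x in at_top. w x > 0"
  proof -
    have "\<forall>\<^sub>F x in at_top. ln (ln x) > (0::real)" by real_asymp
    then show ?thesis using eventually_gt_at_top[of 0] by eventually_elim (simp add: w_def)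
  qed
  have rs: "((\<lambda>x. x * rsum b x / w x) \<longlongrightarrow> pconst b) at_top"
  proof (rule Lim_transform_eventually[OF rsum_asymp])
    show "\<forall>\<^sub>F x in at_top. rsum b x / ln (ln x) ^ psize b = x * rsum b x / w x"
      using eventually_gt_at_top[of 0] by eventually_elim (simp add: w_def)
  qed
  have small: "((\<lambda>x. real (card (spat b x)) / w x) \<longlongrightarrow> 0) at_top"
    unfolding w_def by (rule card_spat_small)
  have "((\<lambda>x. tsum i b x / w x - x * rsum b x / w x / \<phi>) \<longlongrightarrow> 0) at_top"
  proof (rule tendstoI)
    fix \<epsilon> :: real assume eps: "\<epsilon> > 0"
    \<comment> \<open>Then \<open>e * pconst b\<close> is at most \<epsilon>/2; the 1 avoids a
      division by 0.\<close>
    define e where "e = \<epsilon> / (2 * (pconst b + 1))"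
    have pc: "pconst b \<ge> 0" by (simp add: pconst_def prod_nonneg)
    have e: "e > 0" using eps pc by (simp add: e_def)
    obtain K where K: "K \<ge> 0" "\<And>N x. N \<in> spat b x \<Longrightarrow>
      \<bar>(\<Sum>p\<in>cofac i N x. ln (real p)) - x / real N / real (totient M)\<bar> \<le> e * (x / real N) + K"
      using cofac_sum_error[OF i e, of b] by blast
    have bound: "\<bar>tsum i b x - x * rsum b x / \<phi>\<bar> \<le> e * (x * rsum b x) + K * real (card (spat b x))" for x
    proof -
      have "tsum i b x - x * rsum b x / \<phi> = (\<Sum>N\<in>spat b x. (\<Sum>p\<in>cofac i N x. ln (real p)) - x / real N / real (totient M))"
        by (simp add: tsum_def rsum_def sum_subtractf sum_distrib_left sum_divide_distrib \<phi>_def)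
      also have "\<bar>\<dots>\<bar> \<le> (\<Sum>N\<in>spat b x. e * (x / real N) + K)"
        by (intro order_trans[OF sum_abs] sum_mono K(2))
      also have "\<dots> = e * (x * rsum b x) + K * real (card (spat b x))"
        by (simp add: rsum_def sum.distrib sum_distrib_left mult.commute)
      finally show ?thesis .
    qed
    have "((\<lambda>x. e * (x * rsum b x / w x) + K * (real (card (spat b x)) / w x)) \<longlongrightarrow> e * pconst b + K * 0) at_top"
      by (intro tendsto_intros rs small)
    moreover have "e * pconst b + K * 0 < \<epsilon>"
    proof -
      have "e * pconst b \<le> e * (pconst b + 1)" using e by simp
      also have "\<dots> = \<epsilon> / 2" using pc by (simp add: e_def field_simps)
      finally show ?thesis using eps by simp
    qed
    ultimately have "\<forall>\<^sub>F x in at_top. e * (x * rsum b x / w x) + K * (real (card (spat b x)) / w x) < \<epsilon>"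
      by (rule order_tendstoD)
    then show "\<forall>\<^sub>F x in at_top. dist (tsum i b x / w x - x * rsum b x / w x / \<phi>) 0 < \<epsilon>"
      using wpos
    proof eventually_elim
      case (elim x)
      have "tsum i b x / w x - x * rsum b x / w x / \<phi> = (tsum i b x - x * rsum b x / \<phi>) / w x"
        by (simp add: diff_divide_distrib)
      also have "\<bar>\<dots>\<bar> = \<bar>tsum i b x - x * rsum b x / \<phi>\<bar> / w x" using elim by simp
      also have "\<dots> \<le> (e * (x * rsum b x) + K * real (card (spat b x))) / w x"
        using bound[of x] elim by (intro divide_right_mono) auto
      also have "\<dots> = e * (x * rsum b x / w x) + K * (real (card (spat b x)) / w x)"
        by (simp add: add_divide_distrib)
      also have "\<dots> < \<epsilon>" by (rule elim(1))
      finally show ?case by (simp add: dist_real_def)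
    qed
  qed
  from tendsto_add[OF this tendsto_divide[OF rs tendsto_const[of \<phi>]]]
  show ?thesis using M unfolding w_def \<phi>_def by simp
qed

definition lsum :: "(nat \<Rightarrow> nat) \<Rightarrow> real \<Rightarrow> real" where
  "lsum a x = (\<Sum>N\<in>spat a x. ln (real N))"

text \<open>ln N is split over the prime divisors of N, sorted by class. Classes with
  \<open>a i = 0\<close> are left out: there the truncated \<open>a i - 1\<close> would give back
  \<open>a\<close> itself.\<close>

lemma lsum_eq: "lsum a x = (\<Sum>i\<in>{i \<in> {1..totient M}. a i > 0}. tsum i (a(i := a i - 1)) x)"
proof -
  have "lsum a x = (\<Sum>N\<in>spat a x. \<Sum>i=1..totient M. \<Sum>p\<in>pdiv i N. ln (real p))"
    unfolding lsum_def
  proof (rule sum.cong[OF refl])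
    fix N assume N: "N \<in> spat a x"
    then have pN: "N > 0" "squarefree N" "coprime N M" using spatD(1)[OF N] by (auto simp: pat_def)
    have un: "{p. prime p \<and> p dvd N} = (\<Union>i\<in>{1..totient M}. pdiv i N)"
    proof (intro equalityI subsetI)
      fix p assume p: "p \<in> {p. prime p \<and> p dvd N}"
      then have "coprime p M" using coprime_divisors[OF _ dvd_refl pN(3)] by blast
      then show "p \<in> (\<Union>i\<in>{1..totient M}. pdiv i N)" using cls_ex1[of p] p by (auto simp: pdiv_def)
    qed (auto simp: pdiv_def cls_def)
    have "(\<Sum>p\<in>(\<Union>i\<in>{1..totient M}. pdiv i N). ln (real p)) = (\<Sum>i=1..totient M. \<Sum>p\<in>pdiv i N. ln (real p))"
    proof (rule sum.UNION_disjoint)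
      show "\<forall>i\<in>{1..totient M}. \<forall>j\<in>{1..totient M}. i \<noteq> j \<longrightarrow> pdiv i N \<inter> pdiv j N = {}"
        using cls_unique by (auto simp: pdiv_def)
    qed (use finite_pdiv[OF pN(1)] in auto)
    then show "ln (real N) = (\<Sum>i=1..totient M. \<Sum>p\<in>pdiv i N. ln (real p))"
      using ln_squarefree[OF pN(1,2)] unfolding un by simp
  qed
  also have "\<dots> = (\<Sum>i=1..totient M. \<Sum>N\<in>spat a x. \<Sum>p\<in>pdiv i N. ln (real p))"
    by (rule sum.swap)
  also have "\<dots> = (\<Sum>i\<in>{i \<in> {1..totient M}. a i > 0}. \<Sum>N\<in>spat a x. \<Sum>p\<in>pdiv i N. ln (real p))"
  proof -
    have "(\<Sum>N\<in>spat a x. \<Sum>p\<in>pdiv i N. ln (real p)) = 0" if i: "i \<in> {1..totient M}" "a i = 0" for i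
    proof (rule sum.neutral, rule ballI)
      fix N assume N: "N \<in> spat a x"
      have "card (pdiv i N) = 0" using patD(2)[OF spatD(1)[OF N] i(1)] i(2) by simp
      then have "pdiv i N = {}" using finite_pdiv[OF spatD(3)[OF N]] by simp
      then show "(\<Sum>p\<in>pdiv i N. ln (real p)) = 0" by simp
    qed
    then show ?thesis by (intro sum.mono_neutral_right) auto
  qed
  also have "\<dots> = (\<Sum>i\<in>{i \<in> {1..totient M}. a i > 0}. tsum i (a(i := a i - 1)) x)"
    unfolding tsum_def by (intro sum.cong refl pattern_double_sum[where h = "\<lambda>p N. ln (real p)"]) auto
  finally show ?thesis .
qed

text \<open>Class \<open>i\<close> contributes \<open>a i * pconst a\<close>, and these coefficients
  add up to the total number of primes.\<close>

lemma lsum_asymp: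
  assumes "psize a > 0"
  shows "((\<lambda>x. lsum a x / (x * ln (ln x) ^ (psize a - 1))) \<longlongrightarrow> real (psize a) * pconst a) at_top"
proof -
  let ?I = "{i \<in> {1..totient M}. a i > 0}"
  have "((\<lambda>x. \<Sum>i\<in>?I. tsum i (a(i := a i - 1)) x / (x * ln (ln x) ^ (psize a - 1))) \<longlongrightarrow> (\<Sum>i\<in>?I. real (a i) * pconst a)) at_top"
  proof (rule tendsto_sum)
    fix i assume "i \<in> ?I"
    then have i: "i \<in> {1..totient M}" "a i > 0" by auto
    have "psize a - 1 = psize (a(i := a i - 1))" using psize_dec[of i a, OF i] by simp
    then show "((\<lambda>x. tsum i (a(i := a i - 1)) x / (x * ln (ln x) ^ (psize a - 1))) \<longlongrightarrow> real (a i) * pconst a) at_top"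
      using tsum_asymp[OF i(1), of "a(i := a i - 1)"] pconst_dec[of i a, OF i] by simp
  qed
  moreover have "(\<Sum>i\<in>?I. real (a i) * pconst a) = real (psize a) * pconst a"
  proof -
    have "(\<Sum>i\<in>?I. a i) = psize a" unfolding psize_def by (rule sum.mono_neutral_left) auto
    then have "real (psize a) = (\<Sum>i\<in>?I. real (a i))" by (simp flip: of_nat_sum)
    then show ?thesis by (simp only: sum_distrib_right)
  qed
  ultimately show ?thesis by (simp add: lsum_eq sum_divide_distrib)
qed

text \<open>Trading ln N for ln x: one direction is ln N <= ln x. For the other, the N up to
  x^(1-\<delta>) are negligible, and the remaining ones satisfy ln N > (1-\<delta>) ln x.\<close>

lemma card_spat_asymp:
  assumes A: "psize a > 0"
  shows "((\<lambda>x. real (card (spat a x)) * ln x / (x * ln (ln x) ^ (psize a - 1))) \<longlongrightarrow> real (psize a) * pconst a) at_top"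
proof -
  define n where "n = psize a - 1"
  define \<kappa> where "\<kappa> = real (psize a) * pconst a"
  define w where "w x = x * ln (ln x) ^ n" for x :: real
  define c where "c x = real (card (spat a x))" for x
  have k0: "\<kappa> \<ge> 0" by (simp add: \<kappa>_def pconst_def prod_nonneg)
  have ev: "\<forall>\<^sub>F x in at_top. x > 1 \<and> w x > 0"
  proof -
    have "\<forall>\<^sub>F x in at_top. ln (ln x) > (0::real)" by real_asymp
    then show ?thesis using eventually_gt_at_top[of 1] by eventually_elim (simp add: w_def)
  qed
  have L: "((\<lambda>x. lsum a x / w x) \<longlongrightarrow> \<kappa>) at_top" using lsum_asymp[OF A] by (simp add: w_def n_def \<kappa>_def)
  have lower: "lsum a x \<le> c x * ln x" if "x > 1" for x
  proof -
    have "lsum a x \<le> (\<Sum>N\<in>spat a x. ln x)"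
      unfolding lsum_def using spatD(2,3)[of _ a x] that by (intro sum_mono) (simp add: Suc_le_eq)
    then show ?thesis by (simp add: c_def)
  qed
  have upper: "c x * ln x \<le> x powr (1 - \<delta>) * ln x + lsum a x / (1 - \<delta>)" if x: "x > 1" and d: "0 < \<delta>" "\<delta> < 1" for x \<delta>
  proof -
    define z where "z = x powr (1 - \<delta>)"
    have z: "z > 0" "ln z = (1 - \<delta>) * ln x" using x by (auto simp: z_def ln_powr)
    have "spat a x = spat a z \<union> {N \<in> spat a x. real N > z}" if "z \<le> x"
      using that by (auto simp: spat_def)
    moreover have "z \<le> x" using x d powr_mono[of "1 - \<delta>" 1 x] by (simp add: z_def)
    ultimately have "card (spat a x) \<le> card (spat a z) + card {N \<in> spat a x. real N > z}"
      using card_Un_le by metis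
    then have cx: "c x \<le> c z + real (card {N \<in> spat a x. real N > z})" by (simp add: c_def)
    have "real (card {N \<in> spat a x. real N > z}) * ln z = (\<Sum>N\<in>{N \<in> spat a x. real N > z}. ln z)" by simp
    also have "\<dots> \<le> (\<Sum>N\<in>{N \<in> spat a x. real N > z}. ln (real N))"
      using z(1) by (intro sum_mono) auto
    also have "\<dots> \<le> lsum a x"
      unfolding lsum_def using spatD(3)[of _ a x] by (intro sum_mono2) (auto simp: Suc_le_eq)
    finally have "real (card {N \<in> spat a x. real N > z}) * ln x \<le> lsum a x / (1 - \<delta>)"
      unfolding z(2) using d by (simp add: field_simps)
    moreover have "c z \<le> z" unfolding c_def using z by (intro card_spat_le) auto
    then have "c z * ln x \<le> z * ln x" using x by (intro mult_right_mono) auto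
    moreover have "c x * ln x \<le> (c z + real (card {N \<in> spat a x. real N > z})) * ln x"
      using cx x by (intro mult_right_mono) auto
    ultimately show ?thesis unfolding z_def by (simp add: distrib_right)
  qed
  have "((\<lambda>x. c x * ln x / w x) \<longlongrightarrow> \<kappa>) at_top"
  proof (rule order_tendstoI)
    fix l assume "l < \<kappa>"
    from order_tendstoD(1)[OF L this] ev show "\<forall>\<^sub>F x in at_top. l < c x * ln x / w x"
    proof eventually_elim
      case (elim x)
      have "lsum a x / w x \<le> c x * ln x / w x" using lower[of x] elim by (intro divide_right_mono) auto
      then show ?case using elim by simp
    qed
  next
    fix l assume l: "\<kappa> < l"
    \<comment> \<open>This makes (1 - \<open>\<delta>\<close>) l the midpoint of
      \<open>\<kappa>\<close> and l, so that \<open>\<kappa>\<close> / (1 - \<open>\<delta>\<close>)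
      is still below l.\<close>
    define \<delta> where "\<delta> = (l - \<kappa>) / (2 * l)"
    have l0: "l > 0" using l k0 by simp
    have d: "0 < \<delta>" "\<delta> < 1" using l k0 l0 by (auto simp: \<delta>_def field_simps)
    have "\<kappa> < (1 - \<delta>) * l" using l l0 by (simp add: \<delta>_def field_simps)
    then have "0 + \<kappa> / (1 - \<delta>) < l" using d by (simp add: field_simps)
    moreover have "((\<lambda>x. x powr (1 - \<delta>) * ln x / w x + lsum a x / w x / (1 - \<delta>)) \<longlongrightarrow> 0 + \<kappa> / (1 - \<delta>)) at_top"
    proof (intro tendsto_add tendsto_divide L tendsto_const)
      show "((\<lambda>x. x powr (1 - \<delta>) * ln x / w x) \<longlongrightarrow> 0) at_top"
        unfolding w_def using d by real_asymp
    qed (use d in simp)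
    ultimately have "\<forall>\<^sub>F x in at_top. x powr (1 - \<delta>) * ln x / w x + lsum a x / w x / (1 - \<delta>) < l"
      using order_tendstoD(2) by blast
    then show "\<forall>\<^sub>F x in at_top. c x * ln x / w x < l"
      using ev
    proof eventually_elim
      case (elim x)
      have "c x * ln x / w x \<le> (x powr (1 - \<delta>) * ln x + lsum a x / (1 - \<delta>)) / w x"
        using upper[of x \<delta>] elim d by (intro divide_right_mono) auto
      also have "\<dots> = x powr (1 - \<delta>) * ln x / w x + lsum a x / w x / (1 - \<delta>)"
        by (simp add: add_divide_distrib mult.commute)
      finally show ?case using elim by simp
    qed
  qed
  then show ?thesis by (simp add: c_def w_def n_def \<kappa>_def)
qed

end

text \<open>The hypothesis \<open>A \<ge> 1\<close> excludes the empty pattern, for which the set is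
  {1} as soon as x >= 1 while the right-hand side is identically 0.\<close>

theorem theorem1p2:
  fixes M m A :: nat and r :: "nat \<Rightarrow> int" and a :: "nat \<Rightarrow> nat"
  assumes "M \<ge> 3"
    and "m = totient M"
    and "unit_representatives M r"
    and "A = (\<Sum>i=1..m. a i)"
    and "A \<ge> 1"
  shows "(\<lambda>x::real. real (card (squarefree_with_pattern M r a x))) \<sim>[at_top]
         (\<lambda>x::real. real A / ((\<Prod>i=1..m. fact (a i)) * real m ^ A)
                      * x * ln x powi (-1) * ln (ln x) powi (int A - 1))"
proof -
  interpret residue_reps M r using assms by unfold_locales
  have A: "A = psize a" "psize a > 0" using assms by (simp_all add: psize_def)
  define \<kappa> where "\<kappa> = real A / ((\<Prod>i=1..m. fact (a i)) * real m ^ A)"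
  have k: "\<kappa> = real (psize a) * pconst a" by (simp add: \<kappa>_def pconst_def A assms(2) mult.commute)
  have "(\<Prod>i=1..m. fact (a i) :: real) > 0" by (intro prod_pos) auto
  then have k0: "\<kappa> > 0" using A assms(1,2) by (simp add: \<kappa>_def)
  have pw: "int A - 1 = int (A - 1)" using assms(5) by simp
  have lim: "((\<lambda>x. real (card (spat a x)) * ln x / (x * ln (ln x) ^ (A - 1)) / \<kappa>) \<longlongrightarrow> \<kappa> / \<kappa>) at_top"
    using card_spat_asymp[OF A(2)] k0 by (intro tendsto_divide tendsto_const) (auto simp: k A)
  have "((\<lambda>x. real (card (spat a x)) / (\<kappa> * x * ln x powi (-1) * ln (ln x) powi (int A - 1))) \<longlongrightarrow> 1) at_top"
  proof (rule Lim_transform_eventually)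
    show "((\<lambda>x. real (card (spat a x)) * ln x / (x * ln (ln x) ^ (A - 1)) / \<kappa>) \<longlongrightarrow> 1) at_top"
      using lim k0 by simp
    show "\<forall>\<^sub>F x in at_top. real (card (spat a x)) * ln x / (x * ln (ln x) ^ (A - 1)) / \<kappa> =
        real (card (spat a x)) / (\<kappa> * x * ln x powi (-1) * ln (ln x) powi (int A - 1))"
    \<comment> \<open>The rearrangement holds for every x, also where a logarithm vanishes, because
      inversion is total and multiplicative.\<close>
    proof (rule always_eventually, rule allI)
      fix x :: real
      show "real (card (spat a x)) * ln x / (x * ln (ln x) ^ (A - 1)) / \<kappa> =
        real (card (spat a x)) / (\<kappa> * x * ln x powi (-1) * ln (ln x) powi (int A - 1))"
        unfolding pw power_int_of_nat by (simp add: power_int_minus divide_inverse mult_ac)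
    qed
  qed
  then show ?thesis
    unfolding squarefree_with_pattern_eq \<kappa>_def[symmetric]
    by (rule asymp_equivI')
qed

end
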